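(* Let $\mathbb{G}$ be a discrete quantum group. Then $\widehat{\mathbb{G}}_{MaxKac}=\widehat{\mathbb{G}}_{Kac}$ as closed quantum subgroups of $\widehat{\mathbb{G}}$.
   Context: A discrete quantum group (DQG) $\mathbb{G}$ is a locally compact quantum group (Kustermans–Vaes) whose dual $\widehat{\mathbb{G}}$ is a compact quantum group (CQG). $\mathrm{Pol}(\widehat{\mathbb{G}})$ is the Hopf $*$-algebra spanned by matrix coefficients of irreducible unitary representations of $\widehat{\mathbb{G}}$, with Haar state $h_{\widehat{\mathbb{G}}}$, and $C_u(\widehat{\mathbb{G}})$ is its universal $C^*$-completion. A CQG is of Kac type if its Haar state is tracial. For a DQG $\mathbb{H}$, $\widehat{\mathbb{H}}\le\widehat{\mathbb{G}}$ (closed quantum subgroup) means there is a surjective unital $*$-homomorphism $\pi_{\widehat{\mathbb{H}}}:\mathrm{Pol}(\widehat{\mathbb{G}})\to\mathrm{Pol}(\widehat{\mathbb{H}})$ intertwining coproducts. For $\widehat{\mathbb{K}},\widehat{\mathbb{H}}\le\widehat{\mathbb{G}}$, $\widehat{\mathbb{K}}\le\widehat{\mathbb{H}}$ means that $\pi_{\widehat{\mathbb{K}}}$ factors through $\pi_{\widehat{\mathbb{H}}}$, and $\widehat{\mathbb{K}}=\widehat{\mathbb{H}}$ means that both $\widehat{\mathbb{K}}\le\widehat{\mathbb{H}}$ and $\widehat{\mathbb{H}}\le\widehat{\mathbb{K}}$ (i.e. $\ker\pi_{\widehat{\mathbb{K}}}=\ker\pi_{\widehat{\mathbb{H}}}$).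 Canonical Kac quotient (Sołtan): let $I_{Kac}=\{a\in C_u(\widehat{\mathbb{G}}):\tau(aa^* )=0\text{ for every tracial state }\tau\in C_u(\widehat{\mathbb{G}})^*\}$, a closed two-sided ideal. The quotient $C_u(\widehat{\mathbb{G}})/I_{Kac}$ carries a unique coproduct making the quotient map intertwine coproducts, and is a (possibly exotic) $C^*$-completion of $\mathrm{Pol}$ of a CQG, denoted $\widehat{\mathbb{G}}_{Kac}$; $\mathrm{Pol}(\widehat{\mathbb{G}}_{Kac})$ is the image of $\mathrm{Pol}(\widehat{\mathbb{G}})$ in this quotient, so $\widehat{\mathbb{G}}_{Kac}\le\widehat{\mathbb{G}}$, and $\widehat{\mathbb{G}}_{Kac}$ is of Kac type. $\widehat{\mathbb{G}}_{MaxKac}\le\widehat{\mathbb{G}}$ is the maximal Kac type closed quantum subgroup of $\widehat{\mathbb{G}}$ (known to exist): it is of Kac type and $\widehat{\mathbb{H}}\le\widehat{\mathbb{G}}_{MaxKac}$ for every Kac type closed quantum subgroup $\widehat{\mathbb{H}}\le\widehat{\mathbb{G}}$. *)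

theory Defs
  imports "HOL-Analysis.Analysis" "HOL-Algebra.Module" "HOL-Algebra.QuotRing"
begin

section \<open>Complex unital *-algebras\<close>

definition complex_ring :: "complex ring" where
  "complex_ring = \<lparr>carrier = UNIV, mult = (*), one = 1, zero = 0, add = (+)\<rparr>"

record 'a star_algebra = "(complex, 'a) module" +
  star :: "'a \<Rightarrow> 'a"

locale star_algebra = ring A + mod: module complex_ring A for A (structure) +
  assumes smult_mult_l: "x \<in> carrier A \<Longrightarrow> y \<in> carrier A \<Longrightarrow>
      (k \<odot>\<^bsub>A\<^esub> x) \<otimes>\<^bsub>A\<^esub> y = k \<odot>\<^bsub>A\<^esub> (x \<otimes>\<^bsub>A\<^esub> y)"
    and smult_mult_r: "x \<in> carrier A \<Longrightarrow> y \<in> carrier A \<Longrightarrow>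
      x \<otimes>\<^bsub>A\<^esub> (k \<odot>\<^bsub>A\<^esub> y) = k \<odot>\<^bsub>A\<^esub> (x \<otimes>\<^bsub>A\<^esub> y)"
    and star_closed: "x \<in> carrier A \<Longrightarrow> star A x \<in> carrier A"
    and star_star: "x \<in> carrier A \<Longrightarrow> star A (star A x) = x"
    and star_add: "x \<in> carrier A \<Longrightarrow> y \<in> carrier A \<Longrightarrow>
      star A (x \<oplus>\<^bsub>A\<^esub> y) = star A x \<oplus>\<^bsub>A\<^esub> star A y"
    and star_smult: "x \<in> carrier A \<Longrightarrow> star A (k \<odot>\<^bsub>A\<^esub> x) = cnj k \<odot>\<^bsub>A\<^esub> star A x"
    and star_mult: "x \<in> carrier A \<Longrightarrow> y \<in> carrier A \<Longrightarrow>
      star A (x \<otimes>\<^bsub>A\<^esub> y) = star A y \<otimes>\<^bsub>A\<^esub> star A x"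

definition linear_map ::
  "('a, 'x) star_algebra_scheme \<Rightarrow> ('b, 'y) star_algebra_scheme \<Rightarrow> ('a \<Rightarrow> 'b) \<Rightarrow> bool" where
  "linear_map A B f \<longleftrightarrow> f \<in> carrier A \<rightarrow> carrier B \<and>
     (\<forall>x\<in>carrier A. \<forall>y\<in>carrier A. f (x \<oplus>\<^bsub>A\<^esub> y) = f x \<oplus>\<^bsub>B\<^esub> f y) \<and>
     (\<forall>k. \<forall>x\<in>carrier A. f (k \<odot>\<^bsub>A\<^esub> x) = k \<odot>\<^bsub>B\<^esub> f x)"

definition linear_functional :: "('a, 'x) star_algebra_scheme \<Rightarrow> ('a \<Rightarrow> complex) \<Rightarrow> bool" where
  "linear_functional A f \<longleftrightarrow>
     (\<forall>x\<in>carrier A. \<forall>y\<in>carrier A. f (x \<oplus>\<^bsub>A\<^esub> y) = f x + f y) \<and>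
     (\<forall>k. \<forall>x\<in>carrier A. f (k \<odot>\<^bsub>A\<^esub> x) = k * f x)"

definition star_hom ::
  "('a, 'x) star_algebra_scheme \<Rightarrow> ('b, 'y) star_algebra_scheme \<Rightarrow> ('a \<Rightarrow> 'b) \<Rightarrow> bool" where
  "star_hom A B f \<longleftrightarrow> f \<in> ring_hom A B \<and> linear_map A B f \<and>
     (\<forall>x\<in>carrier A. f (star A x) = star B (f x))"

text \<open>On a unital C*-algebra, a functional is positive of norm 1 iff it is positive and unital.\<close>

definition state :: "('a, 'x) star_algebra_scheme \<Rightarrow> ('a \<Rightarrow> complex) \<Rightarrow> bool" where
  "state A \<tau> \<longleftrightarrow> linear_functional A \<tau> \<and> \<tau> \<one>\<^bsub>A\<^esub> = 1 \<and>
     (\<forall>x\<in>carrier A. \<tau> (star A x \<otimes>\<^bsub>A\<^esub> x) \<in> \<real>\<^sub>\<ge>\<^sub>0)"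

definition tracial :: "('a, 'x) star_algebra_scheme \<Rightarrow> ('a \<Rightarrow> complex) \<Rightarrow> bool" where
  "tracial A \<tau> \<longleftrightarrow> (\<forall>x\<in>carrier A. \<forall>y\<in>carrier A. \<tau> (x \<otimes>\<^bsub>A\<^esub> y) = \<tau> (y \<otimes>\<^bsub>A\<^esub> x))"


section \<open>Algebraic tensor products\<close>

text \<open>
  The algebraic tensor product of A and B is realized inside the dual of the space of bilinear
  forms on A and B: the elementary tensor of a and b is evaluation of forms at (a, b), and the
  tensor product is the linear span of these. Over a field this is the usual algebraic tensor
  product. Only the values of a form on the carriers matter, and elements of the tensor product
  are extensional functions, so equality in the tensor product is HOL equality.
\<close>

type_synonym ('a, 'b) tensor = "('a \<Rightarrow> 'b \<Rightarrow> complex) \<Rightarrow> complex"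

definition bilinear_forms ::
  "('a, 'x) star_algebra_scheme \<Rightarrow> ('b, 'y) star_algebra_scheme \<Rightarrow> ('a \<Rightarrow> 'b \<Rightarrow> complex) set" where
  "bilinear_forms A B =
     {\<beta>. (\<forall>b\<in>carrier B. linear_functional A (\<lambda>a. \<beta> a b)) \<and>
         (\<forall>a\<in>carrier A. linear_functional B (\<beta> a))}"

definition elem_tensor ::
  "('a, 'x) star_algebra_scheme \<Rightarrow> ('b, 'y) star_algebra_scheme \<Rightarrow> 'a \<Rightarrow> 'b \<Rightarrow> ('a, 'b) tensor" where
  "elem_tensor A B a b = (\<lambda>\<beta>\<in>bilinear_forms A B. \<beta> a b)"

text \<open>
  Multiplication and involution below are the ones with (a \<otimes> b)(c \<otimes> d) = ac \<otimes> bd and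
  (a \<otimes> b)* = a* \<otimes> b*; see the two lemmas that follow.
\<close>

definition tensor_algebra ::
  "('a, 'x) star_algebra_scheme \<Rightarrow> ('b, 'y) star_algebra_scheme \<Rightarrow> ('a, 'b) tensor star_algebra" where
  "tensor_algebra A B =
     \<lparr>carrier = {T. \<exists>(n::nat) x y. x \<in> {..<n} \<rightarrow> carrier A \<and> y \<in> {..<n} \<rightarrow> carrier B \<and>
                      T = (\<lambda>\<beta>\<in>bilinear_forms A B. \<Sum>i<n. \<beta> (x i) (y i))},
      mult = (\<lambda>T U. \<lambda>\<beta>\<in>bilinear_forms A B.
                T (\<lambda>a b. U (\<lambda>c d. \<beta> (a \<otimes>\<^bsub>A\<^esub> c) (b \<otimes>\<^bsub>B\<^esub> d)))),
      one = elem_tensor A B \<one>\<^bsub>A\<^esub> \<one>\<^bsub>B\<^esub>,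
      zero = (\<lambda>\<beta>\<in>bilinear_forms A B. 0),
      add = (\<lambda>T U. \<lambda>\<beta>\<in>bilinear_forms A B. T \<beta> + U \<beta>),
      smult = (\<lambda>k T. \<lambda>\<beta>\<in>bilinear_forms A B. k * T \<beta>),
      star = (\<lambda>T. \<lambda>\<beta>\<in>bilinear_forms A B. cnj (T (\<lambda>a b. cnj (\<beta> (star A a) (star B b)))))\<rparr>"

lemma elem_tensor_mult:
  assumes "star_algebra A" "star_algebra B"
    and "a \<in> carrier A" "c \<in> carrier A" "b \<in> carrier B" "d \<in> carrier B"
  shows "elem_tensor A B a b \<otimes>\<^bsub>tensor_algebra A B\<^esub> elem_tensor A B c d =
         elem_tensor A B (a \<otimes>\<^bsub>A\<^esub> c) (b \<otimes>\<^bsub>B\<^esub> d)"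
proof -
  interpret A: star_algebra A by fact
  interpret B: star_algebra B by fact
  have inner: "(\<lambda>c d. \<beta> (a' \<otimes>\<^bsub>A\<^esub> c) (b' \<otimes>\<^bsub>B\<^esub> d)) \<in> bilinear_forms A B"
    if "\<beta> \<in> bilinear_forms A B" "a' \<in> carrier A" "b' \<in> carrier B" for \<beta> a' b'
    using that
    by (auto simp: bilinear_forms_def linear_functional_def A.r_distr B.r_distr
        A.smult_mult_r B.smult_mult_r complex_ring_def)
  have outer: "(\<lambda>a b. elem_tensor A B c d (\<lambda>c d. \<beta> (a \<otimes>\<^bsub>A\<^esub> c) (b \<otimes>\<^bsub>B\<^esub> d))) \<in> bilinear_forms A B"
    if \<beta>: "\<beta> \<in> bilinear_forms A B" for \<beta>
  proof -
    have "elem_tensor A B c d (\<lambda>c d. \<beta> (a' \<otimes>\<^bsub>A\<^esub> c) (b' \<otimes>\<^bsub>B\<^esub> d)) =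
            \<beta> (a' \<otimes>\<^bsub>A\<^esub> c) (b' \<otimes>\<^bsub>B\<^esub> d)"
      if "a' \<in> carrier A" "b' \<in> carrier B" for a' b'
      using inner[OF \<beta> that] by (simp add: elem_tensor_def)
    moreover have "k \<odot>\<^bsub>A\<^esub> x \<in> carrier A" if "x \<in> carrier A" for k x
      using that by (simp add: complex_ring_def)
    moreover have "k \<odot>\<^bsub>B\<^esub> x \<in> carrier B" if "x \<in> carrier B" for k x
      using that by (simp add: complex_ring_def)
    ultimately show ?thesis
      using assms \<beta>
      by (simp add: bilinear_forms_def linear_functional_def A.l_distr B.l_distr
          A.smult_mult_l B.smult_mult_l)
  qed
  show ?thesis
    using inner outer assms by (simp add: tensor_algebra_def elem_tensor_def cong: restrict_cong)
qed

lemma elem_tensor_star: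
  assumes "star_algebra A" "star_algebra B" "a \<in> carrier A" "b \<in> carrier B"
  shows "star (tensor_algebra A B) (elem_tensor A B a b) = elem_tensor A B (star A a) (star B b)"
proof -
  interpret A: star_algebra A by fact
  interpret B: star_algebra B by fact
  have "(\<lambda>a b. cnj (\<beta> (star A a) (star B b))) \<in> bilinear_forms A B"
    if "\<beta> \<in> bilinear_forms A B" for \<beta>
    using that
    by (auto simp: bilinear_forms_def linear_functional_def A.star_add B.star_add
        A.star_smult B.star_smult A.star_closed B.star_closed)
  then show ?thesis
    by (simp add: tensor_algebra_def elem_tensor_def cong: restrict_cong)
qed

text \<open>The linear extension of a \<otimes> b \<mapsto> \<phi> a b to the tensor product, for bilinear \<phi> with values in V.\<close>

definition tensor_lift ::
  "('a, 'x) star_algebra_scheme \<Rightarrow> ('b, 'y) star_algebra_scheme \<Rightarrow> ('v, 'z) star_algebra_scheme \<Rightarrow>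
   ('a \<Rightarrow> 'b \<Rightarrow> 'v) \<Rightarrow> ('a, 'b) tensor \<Rightarrow> 'v" where
  "tensor_lift A B V \<phi> T =
     (THE v. \<exists>(n::nat) x y. x \<in> {..<n} \<rightarrow> carrier A \<and> y \<in> {..<n} \<rightarrow> carrier B \<and>
               T = (\<lambda>\<beta>\<in>bilinear_forms A B. \<Sum>i<n. \<beta> (x i) (y i)) \<and>
               v = (\<Oplus>\<^bsub>V\<^esub>i\<in>{..<n}. \<phi> (x i) (y i)))"

definition tensor_map ::
  "('a, 'x) star_algebra_scheme \<Rightarrow> ('b, 'y) star_algebra_scheme \<Rightarrow>
   ('c, 'z) star_algebra_scheme \<Rightarrow> ('d, 'w) star_algebra_scheme \<Rightarrow>
   ('a \<Rightarrow> 'c) \<Rightarrow> ('b \<Rightarrow> 'd) \<Rightarrow> ('a, 'b) tensor \<Rightarrow> ('c, 'd) tensor" where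
  "tensor_map A B C D f g =
     tensor_lift A B (tensor_algebra C D) (\<lambda>a b. elem_tensor C D (f a) (g b))"

definition tensor_assoc ::
  "('a, 'x) star_algebra_scheme \<Rightarrow> ('b, 'y) star_algebra_scheme \<Rightarrow> ('c, 'z) star_algebra_scheme \<Rightarrow>
   (('a, 'b) tensor, 'c) tensor \<Rightarrow> ('a, ('b, 'c) tensor) tensor" where
  "tensor_assoc A B C =
     tensor_lift (tensor_algebra A B) C (tensor_algebra A (tensor_algebra B C))
       (\<lambda>t c. tensor_lift A B (tensor_algebra A (tensor_algebra B C))
          (\<lambda>a b. elem_tensor A (tensor_algebra B C) a (elem_tensor B C b c)) t)"


section \<open>Compact quantum groups as Hopf *-algebras\<close>

record 'a quantum_group = "'a star_algebra" +
  comult :: "'a \<Rightarrow> ('a, 'a) tensor"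

text \<open>
  The counit \<epsilon> and antipode S are uniquely determined by the comultiplication, hence quantified
  rather than stored; the counit and antipode laws use \<complex> \<otimes> P = P = P \<otimes> \<complex>.
\<close>

definition hopf_star_algebra :: "('a, 'x) quantum_group_scheme \<Rightarrow> bool" where
  "hopf_star_algebra P \<longleftrightarrow>
     star_algebra P \<and>
     star_hom P (tensor_algebra P P) (comult P) \<and>
     (\<forall>a\<in>carrier P.
        tensor_assoc P P P (tensor_map P P (tensor_algebra P P) P (comult P) id (comult P a)) =
        tensor_map P P P (tensor_algebra P P) id (comult P) (comult P a)) \<and>
     (\<exists>\<epsilon> S. \<epsilon> \<in> ring_hom P complex_ring \<and> linear_functional P \<epsilon> \<and> linear_map P P S \<and>
        (\<forall>a\<in>carrier P.
           tensor_lift P P P (\<lambda>x y. \<epsilon> x \<odot>\<^bsub>P\<^esub> y) (comult P a) = a \<and>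
           tensor_lift P P P (\<lambda>x y. \<epsilon> y \<odot>\<^bsub>P\<^esub> x) (comult P a) = a \<and>
           tensor_lift P P P (\<lambda>x y. S x \<otimes>\<^bsub>P\<^esub> y) (comult P a) = \<epsilon> a \<odot>\<^bsub>P\<^esub> \<one>\<^bsub>P\<^esub> \<and>
           tensor_lift P P P (\<lambda>x y. x \<otimes>\<^bsub>P\<^esub> S y) (comult P a) = \<epsilon> a \<odot>\<^bsub>P\<^esub> \<one>\<^bsub>P\<^esub>))"

definition unitary_rep ::
  "('a, 'x) quantum_group_scheme \<Rightarrow> nat \<Rightarrow> (nat \<Rightarrow> nat \<Rightarrow> 'a) \<Rightarrow> bool" where
  "unitary_rep P n u \<longleftrightarrow>
     (\<forall>i<n. \<forall>j<n. u i j \<in> carrier P \<and>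
        comult P (u i j) =
          (\<Oplus>\<^bsub>tensor_algebra P P\<^esub>k\<in>{..<n}. elem_tensor P P (u i k) (u k j)) \<and>
        (\<Oplus>\<^bsub>P\<^esub>k\<in>{..<n}. u i k \<otimes>\<^bsub>P\<^esub> star P (u j k)) = (if i = j then \<one>\<^bsub>P\<^esub> else \<zero>\<^bsub>P\<^esub>) \<and>
        (\<Oplus>\<^bsub>P\<^esub>k\<in>{..<n}. star P (u k i) \<otimes>\<^bsub>P\<^esub> u k j) = (if i = j then \<one>\<^bsub>P\<^esub> else \<zero>\<^bsub>P\<^esub>))"

definition matrix_coeffs :: "('a, 'x) quantum_group_scheme \<Rightarrow> 'a set" where
  "matrix_coeffs P = {u i j |u n i j. unitary_rep P n u \<and> i < n \<and> j < n}"

text \<open>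
  The Hopf *-algebras of the form Pol of a compact quantum group are those spanned by the matrix
  coefficients of their finite-dimensional unitary representations (Dijkhuizen and Koornwinder);
  as these representations are direct sums of irreducible ones, the irreducible ones have the
  same span. A discrete quantum group is represented by the Hopf *-algebra Pol of its dual.
\<close>

definition cqg_algebra :: "('a, 'x) quantum_group_scheme \<Rightarrow> bool" where
  "cqg_algebra P \<longleftrightarrow> hopf_star_algebra P \<and>
     (\<forall>a\<in>carrier P. \<exists>(m::nat) c x. x \<in> {..<m} \<rightarrow> matrix_coeffs P \<and>
        a = (\<Oplus>\<^bsub>P\<^esub>l\<in>{..<m}. c l \<odot>\<^bsub>P\<^esub> x l))"

definition haar_state :: "('a, 'x) quantum_group_scheme \<Rightarrow> ('a \<Rightarrow> complex) \<Rightarrow> bool" where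
  "haar_state P h \<longleftrightarrow> state P h \<and>
     (\<forall>a\<in>carrier P.
        tensor_lift P P P (\<lambda>x y. h y \<odot>\<^bsub>P\<^esub> x) (comult P a) = h a \<odot>\<^bsub>P\<^esub> \<one>\<^bsub>P\<^esub> \<and>
        tensor_lift P P P (\<lambda>x y. h x \<odot>\<^bsub>P\<^esub> y) (comult P a) = h a \<odot>\<^bsub>P\<^esub> \<one>\<^bsub>P\<^esub>)"

definition kac_type :: "('a, 'x) quantum_group_scheme \<Rightarrow> bool" where
  "kac_type P \<longleftrightarrow> cqg_algebra P \<and> (\<exists>h. haar_state P h \<and> tracial P h)"


section \<open>Closed quantum subgroups\<close>

definition closed_qsubgroup ::
  "('a, 'x) quantum_group_scheme \<Rightarrow> ('b, 'y) quantum_group_scheme \<Rightarrow> ('a \<Rightarrow> 'b) \<Rightarrow> bool" where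
  "closed_qsubgroup G H \<pi> \<longleftrightarrow> cqg_algebra G \<and> cqg_algebra H \<and>
     star_hom G H \<pi> \<and> \<pi> ` carrier G = carrier H \<and>
     (\<forall>a\<in>carrier G. comult H (\<pi> a) = tensor_map G G H H \<pi> \<pi> (comult G a))"

definition qsubgroup_le ::
  "('a, 'x) quantum_group_scheme \<Rightarrow> ('b, 'y) quantum_group_scheme \<Rightarrow> ('a \<Rightarrow> 'b) \<Rightarrow>
   ('c, 'z) quantum_group_scheme \<Rightarrow> ('a \<Rightarrow> 'c) \<Rightarrow> bool" where
  "qsubgroup_le G K \<pi>\<^sub>K H \<pi>\<^sub>H \<longleftrightarrow> closed_qsubgroup G K \<pi>\<^sub>K \<and> closed_qsubgroup G H \<pi>\<^sub>H \<and>
     (\<exists>\<rho>. star_hom H K \<rho> \<and> (\<forall>a\<in>carrier G. \<pi>\<^sub>K a = \<rho> (\<pi>\<^sub>H a)))"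

definition qsubgroup_eq ::
  "('a, 'x) quantum_group_scheme \<Rightarrow> ('b, 'y) quantum_group_scheme \<Rightarrow> ('a \<Rightarrow> 'b) \<Rightarrow>
   ('c, 'z) quantum_group_scheme \<Rightarrow> ('a \<Rightarrow> 'c) \<Rightarrow> bool" where
  "qsubgroup_eq G K \<pi>\<^sub>K H \<pi>\<^sub>H \<longleftrightarrow> qsubgroup_le G K \<pi>\<^sub>K H \<pi>\<^sub>H \<and> qsubgroup_le G H \<pi>\<^sub>H K \<pi>\<^sub>K"

text \<open>
  The competitors H live on the type 'a set, which is no restriction: replacing each
  element of Pol of H by its fibre under \<pi> yields an isomorphic closed quantum subgroup whose
  elements are subsets of the carrier of G.
\<close>

definition max_kac ::
  "'a quantum_group \<Rightarrow> ('m, 'y) quantum_group_scheme \<Rightarrow> ('a \<Rightarrow> 'm) \<Rightarrow> bool" where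
  "max_kac G M \<pi>\<^sub>M \<longleftrightarrow> closed_qsubgroup G M \<pi>\<^sub>M \<and> kac_type M \<and>
     (\<forall>(H :: 'a set quantum_group) \<pi>\<^sub>H.
        closed_qsubgroup G H \<pi>\<^sub>H \<and> kac_type H \<longrightarrow> qsubgroup_le G H \<pi>\<^sub>H M \<pi>\<^sub>M)"


section \<open>The universal C*-completion and the canonical Kac quotient\<close>

definition cstar_seminorm :: "('a, 'x) star_algebra_scheme \<Rightarrow> ('a \<Rightarrow> real) \<Rightarrow> bool" where
  "cstar_seminorm A p \<longleftrightarrow>
     (\<forall>x\<in>carrier A. 0 \<le> p x \<and> p (star A x \<otimes>\<^bsub>A\<^esub> x) = (p x)\<^sup>2 \<and>
        (\<forall>k. p (k \<odot>\<^bsub>A\<^esub> x) = cmod k * p x)) \<and>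
     (\<forall>x\<in>carrier A. \<forall>y\<in>carrier A.
        p (x \<oplus>\<^bsub>A\<^esub> y) \<le> p x + p y \<and> p (x \<otimes>\<^bsub>A\<^esub> y) \<le> p x * p y)"

record 'a cstar_algebra = "'a star_algebra" +
  cnorm :: "'a \<Rightarrow> real"

definition cstar_algebra :: "('a, 'x) cstar_algebra_scheme \<Rightarrow> bool" where
  "cstar_algebra A \<longleftrightarrow> star_algebra A \<and> cstar_seminorm A (cnorm A) \<and>
     (\<forall>x\<in>carrier A. cnorm A x = 0 \<longrightarrow> x = \<zero>\<^bsub>A\<^esub>) \<and>
     (\<forall>s :: nat \<Rightarrow> 'a. range s \<subseteq> carrier A \<longrightarrow>
        (\<forall>e>0. \<exists>N. \<forall>m\<ge>N. \<forall>n\<ge>N. cnorm A (s m \<ominus>\<^bsub>A\<^esub> s n) < e) \<longrightarrow>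
        (\<exists>x\<in>carrier A. (\<lambda>n. cnorm A (s n \<ominus>\<^bsub>A\<^esub> x)) \<longlonglongrightarrow> 0))"

text \<open>C together with \<iota> is the completion of P with respect to the largest C*-seminorm on P.\<close>

definition universal_completion ::
  "('a, 'x) star_algebra_scheme \<Rightarrow> ('c, 'y) cstar_algebra_scheme \<Rightarrow> ('a \<Rightarrow> 'c) \<Rightarrow> bool" where
  "universal_completion P C \<iota> \<longleftrightarrow> cstar_algebra C \<and> star_hom P C \<iota> \<and>
     (\<forall>c\<in>carrier C. \<forall>e>0. \<exists>a\<in>carrier P. cnorm C (c \<ominus>\<^bsub>C\<^esub> \<iota> a) < e) \<and>
     (\<forall>p. cstar_seminorm P p \<longrightarrow> (\<forall>a\<in>carrier P. p a \<le> cnorm C (\<iota> a)))"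

definition kac_ideal :: "('c, 'y) star_algebra_scheme \<Rightarrow> 'c set" where
  "kac_ideal C = {a \<in> carrier C.
     \<forall>\<tau>. state C \<tau> \<and> tracial C \<tau> \<longrightarrow> \<tau> (a \<otimes>\<^bsub>C\<^esub> star C a) = 0}"

definition star_quotient ::
  "('c, 'y) star_algebra_scheme \<Rightarrow> 'c set \<Rightarrow> 'c set star_algebra" where
  "star_quotient C I =
     \<lparr>carrier = carrier (C Quot I), mult = mult (C Quot I), one = one (C Quot I),
      zero = zero (C Quot I), add = add (C Quot I),
      smult = (\<lambda>k X. \<Union>a\<in>X. I +>\<^bsub>C\<^esub> (k \<odot>\<^bsub>C\<^esub> a)),
      star = (\<lambda>X. \<Union>a\<in>X. I +>\<^bsub>C\<^esub> star C a)\<rparr>"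

definition kac_proj :: "('c, 'y) star_algebra_scheme \<Rightarrow> ('a \<Rightarrow> 'c) \<Rightarrow> 'a \<Rightarrow> 'c set" where
  "kac_proj C \<iota> a = kac_ideal C +>\<^bsub>C\<^esub> \<iota> a"

text \<open>
  Pol of the canonical Kac quotient: the image of P in the quotient of C by the Kac ideal, with
  the comultiplication making the quotient map intertwine comultiplications. For P = Pol of a
  compact quantum group and C its universal completion, that comultiplication is well-defined.
\<close>

definition kac_quotient ::
  "('a, 'x) quantum_group_scheme \<Rightarrow> ('c, 'y) star_algebra_scheme \<Rightarrow> ('a \<Rightarrow> 'c) \<Rightarrow>
   'c set quantum_group" where
  "kac_quotient P C \<iota> =
     (let Q = star_quotient C (kac_ideal C); q = kac_proj C \<iota>; B = Q\<lparr>carrier := q ` carrier P\<rparr>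
      in \<lparr>carrier = carrier B, mult = mult B, one = one B, zero = zero B, add = add B,
          smult = smult B, star = star B,
          comult = (\<lambda>X. THE T. \<exists>a\<in>carrier P. X = q a \<and> T = tensor_map P P B B q q (comult P a))\<rparr>)"

end

theory Submission
  imports Defs
begin

text \<open>
  Write P for Pol of the dual of the discrete quantum group, and J for its Kac ideal: the elements a
  with \<tau> (star a a) = 0 for every tracial state \<tau> of P. Both closed quantum subgroups are quotients of
  P, and the proof shows that both projections have kernel J.

  For the canonical Kac quotient this says that the tracial states of P and of the universal completion
  correspond. A tracial state of P is dominated by the C*-seminorm of its GNS representation, hence by
  the universal norm, and extends by continuity (\<open>tracial_state_extends\<close>).

  For the maximal Kac type subgroup M, one inclusion holds for every quotient of Kac type: its Haar
  state is tracial and faithful (\<open>haar_state_faithful\<close>), so its pullback to P shows that J is mapped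
  to 0. For the other inclusion, by maximality of M, it suffices that the quotient of P by J is itself
  a compact quantum group of Kac type. There are three points.

  \<^item> The ideal J is a coideal (\<open>comult_kac_ideal\<close>), because the convolution of two tracial states is
    a tracial state.
  \<^item> The quotient has a tracial Haar state (\<open>tracial_haar_modulo_kac_ideal\<close>). The tracial states
    form a compact convex semigroup under convolution. On finitely many unitary representations, a
    tracial state whose matrices have least Hilbert-Schmidt norm absorbs all the others
    (\<open>absorbing_tracial_state\<close>), and unitarity turns this into invariance modulo J.
  \<^item> The antipode preserves J (\<open>antipode_kac_ideal\<close>). Averaging with the tracial Haar state shows
    that conjugates of unitary representations are unitary modulo J; hence the antipode commutes with
    the involution modulo J, and composition with it preserves the tracial states.

  Tensors are functionals on bilinear forms here. Identities between them, and between their images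
  under lifted maps, are therefore checked by evaluation, since linear functionals separate points
  (\<open>separating_functional\<close>). Statements about ideals in tensor products are reduced to slices by linear
  functionals (\<open>tensor_slices_vanish\<close>).
\<close>


section \<open>Linear functionals\<close>

lemma complex_ring_simps [simp]:
  "carrier complex_ring = UNIV" "mult complex_ring = (*)" "one complex_ring = 1"
  "zero complex_ring = 0" "add complex_ring = (+)"
  by (simp_all add: complex_ring_def)

lemma cring_complex_ring: "cring complex_ring"
proof (rule cringI)
  show "abelian_group complex_ring"
    by (rule abelian_groupI) (auto simp: algebra_simps intro: exI[of _ "- x" for x])
  show "comm_monoid complex_ring"
    by (rule comm_monoidI) (auto simp: algebra_simps)
qed (auto simp: algebra_simps)

locale complex_space = module complex_ring V for V :: "('v, 'z) star_algebra_scheme" (structure)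
begin

lemma scale_closed [simp, intro]: "x \<in> carrier V \<Longrightarrow> k \<odot> x \<in> carrier V"
  using smult_closed by simp

lemma scale_add_left: "x \<in> carrier V \<Longrightarrow> (k + l) \<odot> x = k \<odot> x \<oplus> l \<odot> x"
  using smult_l_distr[of k l x] by simp

lemma scale_add_right:
  "x \<in> carrier V \<Longrightarrow> y \<in> carrier V \<Longrightarrow> k \<odot> (x \<oplus> y) = k \<odot> x \<oplus> k \<odot> y"
  using smult_r_distr[of k x y] by simp

lemma scale_scale: "x \<in> carrier V \<Longrightarrow> k \<odot> (l \<odot> x) = (k * l) \<odot> x"
  using smult_assoc1[of k l x] by simp

lemma scale_one [simp]: "x \<in> carrier V \<Longrightarrow> 1 \<odot> x = x"
  using smult_one[of x] by simp

lemma scale_zero_left [simp]: "x \<in> carrier V \<Longrightarrow> 0 \<odot> x = \<zero>"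
  using smult_l_null[of x] by simp

lemma scale_zero_right [simp]: "k \<odot> \<zero> = \<zero>"
  using smult_r_null[of k] by simp

lemma minus_eq_scale: "x \<in> carrier V \<Longrightarrow> \<ominus> x = (-1) \<odot> x"
  using scale_add_left[of x "-1" 1] by (simp add: M.minus_equality)

lemma diff_eq_zero_iff:
  assumes "x \<in> carrier V" "y \<in> carrier V" shows "x \<ominus> y = \<zero> \<longleftrightarrow> x = y"
proof
  assume "x \<ominus> y = \<zero>"
  moreover have "x = (x \<ominus> y) \<oplus> y" using assms by (simp add: a_minus_def M.a_assoc M.l_neg)
  ultimately show "x = y" using assms by simp
qed (use assms in \<open>simp add: a_minus_def M.r_neg\<close>)

end

sublocale star_algebra \<subseteq> complex_space A
  by unfold_locales

lemma linear_functional_add: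
  "linear_functional V f \<Longrightarrow> x \<in> carrier V \<Longrightarrow> y \<in> carrier V \<Longrightarrow> f (x \<oplus>\<^bsub>V\<^esub> y) = f x + f y"
  by (simp add: linear_functional_def)

lemma linear_functional_scale:
  "linear_functional V f \<Longrightarrow> x \<in> carrier V \<Longrightarrow> f (k \<odot>\<^bsub>V\<^esub> x) = k * f x"
  by (simp add: linear_functional_def)

context complex_space
begin

lemma linear_functional_zero:
  assumes "linear_functional V f" shows "f \<zero> = 0"
  using linear_functional_scale[OF assms M.zero_closed, of 0] by simp

lemma linear_functional_diff:
  assumes "linear_functional V f" "x \<in> carrier V" "y \<in> carrier V"
  shows "f (x \<ominus> y) = f x - f y"
  using assms by (simp add: a_minus_def minus_eq_scale linear_functional_add linear_functional_scale)

lemma linear_functional_finsum: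
  assumes f: "linear_functional V f" and "finite I" and "g \<in> I \<rightarrow> carrier V"
  shows "f (\<Oplus>i\<in>I. g i) = (\<Sum>i\<in>I. f (g i))"
  using assms(2,3)
proof (induction I)
  case empty
  then show ?case by (simp add: linear_functional_zero[OF f])
next
  case (insert i I)
  then have "g \<in> I \<rightarrow> carrier V" "g i \<in> carrier V" by auto
  then show ?case using insert by (simp add: linear_functional_add[OF f])
qed

end

definition linear_subspace :: "('v, 'z) star_algebra_scheme \<Rightarrow> 'v set \<Rightarrow> bool" where
  "linear_subspace V W \<longleftrightarrow> W \<subseteq> carrier V \<and> \<zero>\<^bsub>V\<^esub> \<in> W \<and>
     (\<forall>x\<in>W. \<forall>y\<in>W. x \<oplus>\<^bsub>V\<^esub> y \<in> W) \<and> (\<forall>k. \<forall>x\<in>W. k \<odot>\<^bsub>V\<^esub> x \<in> W)"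

lemma (in complex_space) linear_subspace_zero: "linear_subspace V {\<zero>}"
  by (simp add: linear_subspace_def)

text \<open>
  By Zorn's lemma there is a subspace H that is maximal among those containing W and avoiding v. It
  is a complement of the line spanned by v, and the coordinate along that line is the functional.
\<close>

lemma (in complex_space) separating_functional:
  assumes W: "linear_subspace V W" and v: "v \<in> carrier V" "v \<notin> W"
  obtains f where "linear_functional V f" "\<And>w. w \<in> W \<Longrightarrow> f w = 0" "f v = 1"
proof -
  define \<A> where "\<A> = {U. linear_subspace V U \<and> W \<subseteq> U \<and> v \<notin> U}"
  have "\<exists>H\<in>\<A>. \<forall>X\<in>\<A>. H \<subseteq> X \<longrightarrow> X = H"
  proof (rule subset_Zorn_nonempty)
    show "\<A> \<noteq> {}" using W v by (auto simp: \<A>_def)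
  next
    fix \<C> assume ne: "\<C> \<noteq> {}" and ch: "subset.chain \<A> \<C>"
    have sub: "\<C> \<subseteq> \<A>" using ch by (simp add: subset.chain_def)
    have mem: "\<exists>U\<in>\<C>. x \<in> U \<and> y \<in> U" if "x \<in> \<Union>\<C>" "y \<in> \<Union>\<C>" for x y
    proof -
      obtain X Y where X: "X \<in> \<C>" "x \<in> X" and Y: "Y \<in> \<C>" "y \<in> Y" using \<open>x \<in> \<Union>\<C>\<close> \<open>y \<in> \<Union>\<C>\<close> by auto
      have "X \<subseteq> Y \<or> Y \<subseteq> X" using ch X Y unfolding subset.chain_def by blast
      then show ?thesis using X Y by blast
    qed
    have "linear_subspace V (\<Union>\<C>)"
      unfolding linear_subspace_def
    proof (intro conjI ballI allI)
      show "\<Union>\<C> \<subseteq> carrier V" using sub by (auto simp: \<A>_def linear_subspace_def)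
      show "\<zero> \<in> \<Union>\<C>" using sub ne by (auto simp: \<A>_def linear_subspace_def)
    next
      fix x y assume "x \<in> \<Union>\<C>" "y \<in> \<Union>\<C>"
      then obtain U where "U \<in> \<C>" "x \<in> U" "y \<in> U" using mem by meson
      moreover have "U \<in> \<A>" using sub \<open>U \<in> \<C>\<close> by auto
      ultimately have "x \<oplus> y \<in> U" by (simp add: \<A>_def linear_subspace_def)
      then show "x \<oplus> y \<in> \<Union>\<C>" using \<open>U \<in> \<C>\<close> by auto
    next
      fix k x assume "x \<in> \<Union>\<C>"
      then obtain U where "U \<in> \<C>" "x \<in> U" by auto
      moreover have "U \<in> \<A>" using sub \<open>U \<in> \<C>\<close> by auto
      ultimately have "k \<odot> x \<in> U" by (simp add: \<A>_def linear_subspace_def)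
      then show "k \<odot> x \<in> \<Union>\<C>" using \<open>U \<in> \<C>\<close> by auto
    qed
    then show "\<Union>\<C> \<in> \<A>" using sub ne by (auto simp: \<A>_def)
  qed
  then obtain H where H: "H \<in> \<A>" and Hmax: "\<And>X. X \<in> \<A> \<Longrightarrow> H \<subseteq> X \<Longrightarrow> X = H" by blast
  have Hsub: "H \<subseteq> carrier V" and H0: "\<zero> \<in> H" and Hadd: "\<And>x y. x \<in> H \<Longrightarrow> y \<in> H \<Longrightarrow> x \<oplus> y \<in> H"
    and Hsc: "\<And>k x. x \<in> H \<Longrightarrow> k \<odot> x \<in> H" and HW: "W \<subseteq> H" and Hv: "v \<notin> H"
    using H by (auto simp: \<A>_def linear_subspace_def)
  have uniq: "c = d" if "h \<in> H" "h' \<in> H" "h \<oplus> c \<odot> v = h' \<oplus> d \<odot> v" for h h' c d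
  proof (rule ccontr)
    assume ne: "c \<noteq> d"
    have hc: "h \<in> carrier V" "h' \<in> carrier V" using that Hsub by auto
    have "(c - d) \<odot> v = c \<odot> v \<oplus> (-1) \<odot> (d \<odot> v)"
      using scale_add_left[OF v(1), of c "-d"] v by (simp add: scale_scale)
    also have "\<dots> = (\<ominus> h \<oplus> (h \<oplus> c \<odot> v)) \<oplus> \<ominus> (d \<odot> v)"
      using hc v by (simp add: minus_eq_scale[symmetric] M.r_neg1)
    also have "\<dots> = \<ominus> h \<oplus> h'" using hc v that by (simp add: M.a_assoc M.r_neg)
    also have "\<dots> \<in> H" using that hc Hadd Hsc by (simp add: minus_eq_scale)
    finally have "(1 / (c - d)) \<odot> ((c - d) \<odot> v) \<in> H" by (rule Hsc)
    then show False using Hv ne v by (simp add: scale_scale)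
  qed
  have ex: "\<exists>c. \<exists>h\<in>H. x = h \<oplus> c \<odot> v" if x: "x \<in> carrier V" for x
  proof (cases "x \<in> H")
    case True
    then show ?thesis using x v by (intro exI[of _ 0] bexI[of _ x]) auto
  next
    case False
    define X where "X = {h \<oplus> k \<odot> x | h k. h \<in> H}"
    have XH: "H \<subseteq> X"
    proof
      fix h assume "h \<in> H"
      then show "h \<in> X" using x Hsub unfolding X_def by (intro CollectI exI[of _ h] exI[of _ 0]) auto
    qed
    have xX: "x \<in> X" using x H0 unfolding X_def by (intro CollectI exI[of _ \<zero>] exI[of _ 1]) auto
    have "linear_subspace V X"
      unfolding linear_subspace_def
    proof (intro conjI ballI allI)
      show "X \<subseteq> carrier V" using x Hsub by (auto simp: X_def)
      show "\<zero> \<in> X" using XH H0 by auto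
    next
      fix a b assume "a \<in> X" "b \<in> X"
      then obtain h k h' k' where e: "a = h \<oplus> k \<odot> x" "b = h' \<oplus> k' \<odot> x" and h: "h \<in> H" "h' \<in> H"
        by (auto simp: X_def)
      then have "h \<in> carrier V" "h' \<in> carrier V" using Hsub by auto
      then have "a \<oplus> b = (h \<oplus> h') \<oplus> (k + k') \<odot> x"
        using e x by (simp add: scale_add_left M.a_ac)
      then show "a \<oplus> b \<in> X" using h Hadd by (auto simp: X_def)
    next
      fix l a assume "a \<in> X"
      then obtain h k where e: "a = h \<oplus> k \<odot> x" and h: "h \<in> H" by (auto simp: X_def)
      then have "l \<odot> a = (l \<odot> h) \<oplus> (l * k) \<odot> x"
        using x Hsub by (auto simp: scale_add_right scale_scale)
      then show "l \<odot> a \<in> X" using h Hsc by (auto simp: X_def)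
    qed
    moreover have "X \<noteq> H" using xX False by auto
    ultimately have "v \<in> X" using Hmax[of X] XH HW by (auto simp: \<A>_def)
    then obtain h k where hk: "v = h \<oplus> k \<odot> x" "h \<in> H" by (auto simp: X_def)
    then have hc: "h \<in> carrier V" using Hsub by auto
    have k: "k \<noteq> 0" using hk Hv x hc by auto
    have "x = (1 / k) \<odot> (k \<odot> x)" using k x by (simp add: scale_scale)
    also have "k \<odot> x = \<ominus> h \<oplus> v" using hk hc x by (simp add: M.r_neg1)
    also have "(1 / k) \<odot> (\<ominus> h \<oplus> v) = (1 / k) \<odot> ((-1) \<odot> h) \<oplus> (1 / k) \<odot> v"
      using hc v by (simp add: scale_add_right minus_eq_scale)
    finally show ?thesis using hk(2) Hsc by blast
  qed
  define f where "f x = (THE c. \<exists>h\<in>H. x = h \<oplus> c \<odot> v)" for x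
  have fI: "f (h \<oplus> c \<odot> v) = c" if "h \<in> H" for h c
    unfolding f_def by (rule the_equality) (use that uniq in blast)+
  show ?thesis
  proof (rule that[of f])
    show "linear_functional V f"
      unfolding linear_functional_def
    proof (intro conjI ballI allI)
      fix x y assume "x \<in> carrier V" "y \<in> carrier V"
      then obtain c h d h' where e: "h \<in> H" "x = h \<oplus> c \<odot> v" "h' \<in> H" "y = h' \<oplus> d \<odot> v"
        using ex by meson
      then have "h \<in> carrier V" "h' \<in> carrier V" using Hsub by auto
      then have "x \<oplus> y = (h \<oplus> h') \<oplus> (c + d) \<odot> v"
        using e v by (simp add: scale_add_left M.a_ac)
      then show "f (x \<oplus> y) = f x + f y" using e fI Hadd by simp
    next
      fix k x assume "x \<in> carrier V"
      then obtain c h where e: "h \<in> H" "x = h \<oplus> c \<odot> v" using ex by meson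
      then have "k \<odot> x = k \<odot> h \<oplus> (k * c) \<odot> v" using Hsub v by (auto simp: scale_add_right scale_scale)
      then show "f (k \<odot> x) = k * f x" using e fI Hsc by simp
    qed
    show "f w = 0" if "w \<in> W" for w
    proof -
      have "w \<in> H" "w \<in> carrier V" using that HW Hsub by auto
      then show ?thesis using fI[of w 0] v by simp
    qed
    show "f v = 1" using fI[OF H0, of 1] v by simp
  qed
qed

lemma (in complex_space) subspace_memI:
  assumes "linear_subspace V W" "v \<in> carrier V"
    and "\<And>f. linear_functional V f \<Longrightarrow> (\<And>w. w \<in> W \<Longrightarrow> f w = 0) \<Longrightarrow> f v = 0"
  shows "v \<in> W"
  using separating_functional[OF assms(1,2)] assms(3) by (metis one_neq_zero)

lemma (in complex_space) eqI_functional: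
  assumes "x \<in> carrier V" "y \<in> carrier V" "\<And>f. linear_functional V f \<Longrightarrow> f x = f y"
  shows "x = y"
proof -
  have "x \<ominus> y \<in> {\<zero>}"
  proof (rule subspace_memI[OF linear_subspace_zero])
    show "x \<ominus> y \<in> carrier V" using assms(1,2) by simp
    show "f (x \<ominus> y) = 0" if f: "linear_functional V f" for f
      using linear_functional_diff[OF f assms(1,2)] assms(3)[OF f] by simp
  qed
  then show ?thesis using assms(1,2) by (simp add: diff_eq_zero_iff)
qed

section \<open>Tensors as functionals on bilinear forms\<close>

definition bilinear_map ::
  "('a, 'x) star_algebra_scheme \<Rightarrow> ('b, 'y) star_algebra_scheme \<Rightarrow> ('v, 'z) star_algebra_scheme \<Rightarrow>
   ('a \<Rightarrow> 'b \<Rightarrow> 'v) \<Rightarrow> bool" where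
  "bilinear_map A B V \<phi> \<longleftrightarrow>
     (\<forall>b\<in>carrier B. linear_map A V (\<lambda>a. \<phi> a b)) \<and> (\<forall>a\<in>carrier A. linear_map B V (\<phi> a))"

lemma bilinear_map_closed:
  "bilinear_map A B V \<phi> \<Longrightarrow> a \<in> carrier A \<Longrightarrow> b \<in> carrier B \<Longrightarrow> \<phi> a b \<in> carrier V"
  by (auto simp: bilinear_map_def linear_map_def)

lemma linear_functional_comp:
  "linear_functional B f \<Longrightarrow> linear_map A B g \<Longrightarrow> linear_functional A (\<lambda>a. f (g a))"
  by (auto simp: linear_functional_def linear_map_def Pi_iff)

lemma linear_functional_comp_bilinear:
  "linear_functional V f \<Longrightarrow> bilinear_map A B V \<phi> \<Longrightarrow> (\<lambda>a b. f (\<phi> a b)) \<in> bilinear_forms A B"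
  unfolding bilinear_forms_def bilinear_map_def by (auto intro: linear_functional_comp)

lemma product_form:
  "linear_functional A f \<Longrightarrow> linear_functional B g \<Longrightarrow> (\<lambda>a b. f a * g b) \<in> bilinear_forms A B"
  by (auto simp: bilinear_forms_def linear_functional_def algebra_simps)

lemma linear_functional_combine:
  "linear_functional V f \<Longrightarrow> linear_functional V g \<Longrightarrow> linear_functional V (\<lambda>x. c * f x + d * g x)"
  by (simp add: linear_functional_def algebra_simps)

lemma linear_functional_sum:
  "(\<And>i. i \<in> I \<Longrightarrow> linear_functional V (f i)) \<Longrightarrow> linear_functional V (\<lambda>x. \<Sum>i\<in>I. f i x)"
  by (simp add: linear_functional_def sum.distrib sum_distrib_left)

lemma bilinear_forms_simps:
  assumes "\<beta> \<in> bilinear_forms A B" "a \<in> carrier A" "b \<in> carrier B"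
  shows "a' \<in> carrier A \<Longrightarrow> \<beta> (a \<oplus>\<^bsub>A\<^esub> a') b = \<beta> a b + \<beta> a' b"
    and "b' \<in> carrier B \<Longrightarrow> \<beta> a (b \<oplus>\<^bsub>B\<^esub> b') = \<beta> a b + \<beta> a b'"
    and "\<beta> (k \<odot>\<^bsub>A\<^esub> a) b = k * \<beta> a b" and "\<beta> a (k \<odot>\<^bsub>B\<^esub> b) = k * \<beta> a b"
  using assms by (simp_all add: bilinear_forms_def linear_functional_def)

lemma tensor_carrier_iff:
  "T \<in> carrier (tensor_algebra A B) \<longleftrightarrow>
     (\<exists>(n::nat) x y. x \<in> {..<n} \<rightarrow> carrier A \<and> y \<in> {..<n} \<rightarrow> carrier B \<and>
        T = (\<lambda>\<beta>\<in>bilinear_forms A B. \<Sum>i<n. \<beta> (x i) (y i)))"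
  by (simp add: tensor_algebra_def)

text \<open>
  Finite sums of elementary tensors, with the equation tested on bilinear forms only: the value of a
  tensor at any other function is a default value.
\<close>

definition tensor_rep ::
  "('a, 'x) star_algebra_scheme \<Rightarrow> ('b, 'y) star_algebra_scheme \<Rightarrow> ('a, 'b) tensor \<Rightarrow>
   nat \<Rightarrow> (nat \<Rightarrow> 'a) \<Rightarrow> (nat \<Rightarrow> 'b) \<Rightarrow> bool" where
  "tensor_rep A B T n x y \<longleftrightarrow> (\<forall>i<n. x i \<in> carrier A \<and> y i \<in> carrier B) \<and>
     (\<forall>\<beta>\<in>bilinear_forms A B. T \<beta> = (\<Sum>i<n. \<beta> (x i) (y i)))"

lemma tensor_repD:
  assumes "tensor_rep A B T n x y"
  shows "\<And>i. i < n \<Longrightarrow> x i \<in> carrier A" "\<And>i. i < n \<Longrightarrow> y i \<in> carrier B"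
    "\<And>\<beta>. \<beta> \<in> bilinear_forms A B \<Longrightarrow> T \<beta> = (\<Sum>i<n. \<beta> (x i) (y i))"
  using assms by (auto simp: tensor_rep_def)

lemma tensor_rep_exists:
  assumes "T \<in> carrier (tensor_algebra A B)"
  shows "\<exists>n x y. tensor_rep A B T n x y"
proof -
  obtain n :: nat and x y where "x \<in> {..<n} \<rightarrow> carrier A" "y \<in> {..<n} \<rightarrow> carrier B"
    "T = (\<lambda>\<beta>\<in>bilinear_forms A B. \<Sum>i<n. \<beta> (x i) (y i))"
    using assms unfolding tensor_carrier_iff by blast
  then have "tensor_rep A B T n x y" by (simp add: tensor_rep_def Pi_iff)
  then show ?thesis by blast
qed

lemma tensor_carrierI:
  assumes "\<And>i. i < (n::nat) \<Longrightarrow> x i \<in> carrier A" "\<And>i. i < n \<Longrightarrow> y i \<in> carrier B"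
    "T = (\<lambda>\<beta>\<in>bilinear_forms A B. \<Sum>i<n. \<beta> (x i) (y i))"
  shows "T \<in> carrier (tensor_algebra A B)"
  unfolding tensor_carrier_iff
  by (rule exI[of _ n], rule exI[of _ x], rule exI[of _ y]) (use assms in \<open>simp add: Pi_iff\<close>)

lemma tensor_extensional:
  "T \<in> carrier (tensor_algebra A B) \<Longrightarrow> T \<in> extensional (bilinear_forms A B)"
  by (auto simp: tensor_algebra_def)

lemma tensor_eqI:
  assumes "T \<in> carrier (tensor_algebra A B)" "U \<in> carrier (tensor_algebra A B)"
    "\<And>\<beta>. \<beta> \<in> bilinear_forms A B \<Longrightarrow> T \<beta> = U \<beta>"
  shows "T = U"
  using assms tensor_extensional by (metis extensionalityI)

lemma elem_tensor_eval [simp]: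
  "\<beta> \<in> bilinear_forms A B \<Longrightarrow> elem_tensor A B a b \<beta> = \<beta> a b"
  by (simp add: elem_tensor_def)

lemma elem_tensor_closed [simp]:
  "a \<in> carrier A \<Longrightarrow> b \<in> carrier B \<Longrightarrow> elem_tensor A B a b \<in> carrier (tensor_algebra A B)"
  by (rule tensor_carrierI[of 1 "\<lambda>_. a" _ "\<lambda>_. b"]) (auto simp: elem_tensor_def)

lemma tensor_add_eval [simp]:
  "\<beta> \<in> bilinear_forms A B \<Longrightarrow> (T \<oplus>\<^bsub>tensor_algebra A B\<^esub> U) \<beta> = T \<beta> + U \<beta>"
  by (simp add: tensor_algebra_def)

lemma tensor_scale_eval [simp]:
  "\<beta> \<in> bilinear_forms A B \<Longrightarrow> (k \<odot>\<^bsub>tensor_algebra A B\<^esub> T) \<beta> = k * T \<beta>"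
  by (simp add: tensor_algebra_def)

lemma tensor_zero_eval [simp]:
  "\<beta> \<in> bilinear_forms A B \<Longrightarrow> \<zero>\<^bsub>tensor_algebra A B\<^esub> \<beta> = 0"
  by (simp add: tensor_algebra_def)

lemma tensor_one_eval [simp]:
  "\<beta> \<in> bilinear_forms A B \<Longrightarrow> \<one>\<^bsub>tensor_algebra A B\<^esub> \<beta> = \<beta> \<one>\<^bsub>A\<^esub> \<one>\<^bsub>B\<^esub>"
  by (simp add: tensor_algebra_def)

lemma tensor_mult_eval [simp]:
  "\<beta> \<in> bilinear_forms A B \<Longrightarrow> (T \<otimes>\<^bsub>tensor_algebra A B\<^esub> U) \<beta> =
     T (\<lambda>a b. U (\<lambda>c d. \<beta> (a \<otimes>\<^bsub>A\<^esub> c) (b \<otimes>\<^bsub>B\<^esub> d)))"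
  by (simp add: tensor_algebra_def)

lemma tensor_star_eval [simp]:
  "\<beta> \<in> bilinear_forms A B \<Longrightarrow> star (tensor_algebra A B) T \<beta> =
     cnj (T (\<lambda>a b. cnj (\<beta> (star A a) (star B b))))"
  by (simp add: tensor_algebra_def)

lemma tensor_eval_linear: "\<beta> \<in> bilinear_forms A B \<Longrightarrow> linear_functional (tensor_algebra A B) (\<lambda>T. T \<beta>)"
  by (simp add: linear_functional_def)

lemma tensor_eval_cong:
  assumes "T \<in> carrier (tensor_algebra A B)" "\<beta> \<in> bilinear_forms A B" "\<gamma> \<in> bilinear_forms A B"
    "\<And>a b. a \<in> carrier A \<Longrightarrow> b \<in> carrier B \<Longrightarrow> \<beta> a b = \<gamma> a b"
  shows "T \<beta> = T \<gamma>"
proof -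
  obtain n x y where r1: "tensor_rep A B T n x y"
      using tensor_rep_exists[OF assms(1)] by blast
    note 1 = tensor_repD[OF r1]
  show ?thesis using assms 1 by simp
qed

lemma bilinear_forms_combine:
  "\<beta> \<in> bilinear_forms A B \<Longrightarrow> \<gamma> \<in> bilinear_forms A B \<Longrightarrow>
    (\<lambda>a b. c * \<beta> a b + d * \<gamma> a b) \<in> bilinear_forms A B"
  by (simp add: bilinear_forms_def linear_functional_combine)

lemma tensor_eval_combine:
  assumes "T \<in> carrier (tensor_algebra A B)" "\<beta> \<in> bilinear_forms A B" "\<gamma> \<in> bilinear_forms A B"
  shows "T (\<lambda>a b. c * \<beta> a b + d * \<gamma> a b) = c * T \<beta> + d * T \<gamma>"
proof -
  obtain n x y where r1: "tensor_rep A B T n x y"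
      using tensor_rep_exists[OF assms(1)] by blast
    note 1 = tensor_repD[OF r1]
  show ?thesis using assms bilinear_forms_combine[OF assms(2,3)]
    by (simp add: 1 sum.distrib sum_distrib_left)
qed

lemma tensor_algebra_space:
  assumes "complex_space A"
  shows "complex_space (tensor_algebra A B)"
proof -
  interpret A: complex_space A by fact
  let ?T = "tensor_algebra A B"
  have add: "T \<oplus>\<^bsub>?T\<^esub> U \<in> carrier ?T" if T: "T \<in> carrier ?T" and U: "U \<in> carrier ?T" for T U
  proof -
    obtain n x y where r1: "tensor_rep A B T n x y"
      using tensor_rep_exists[OF T] by blast
    note 1 = tensor_repD[OF r1]
    obtain m x' y' where r2: "tensor_rep A B U m x' y'"
      using tensor_rep_exists[OF U] by blast
    note 2 = tensor_repD[OF r2]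
    have shift: "(\<Sum>i<n + m. g i) = (\<Sum>i<n. g i) + (\<Sum>i<m. g (n + i))" for g :: "nat \<Rightarrow> complex"
      by (induction m) (auto simp: add.assoc)
    show ?thesis
      by (rule tensor_carrierI[of "n + m" "\<lambda>i. if i < n then x i else x' (i - n)" _
            "\<lambda>i. if i < n then y i else y' (i - n)"])
         (use 1 2 in \<open>auto simp: tensor_algebra_def shift fun_eq_iff restrict_def\<close>)
  qed
  have scale: "k \<odot>\<^bsub>?T\<^esub> T \<in> carrier ?T" if T: "T \<in> carrier ?T" for k T
  proof -
    obtain n x y where r1: "tensor_rep A B T n x y"
      using tensor_rep_exists[OF T] by blast
    note 1 = tensor_repD[OF r1]
    have "\<beta> (k \<odot>\<^bsub>A\<^esub> x i) (y i) = k * \<beta> (x i) (y i)" if "\<beta> \<in> bilinear_forms A B" "i < n" for \<beta> i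
      using that 1 by (simp add: bilinear_forms_def linear_functional_def)
    then show ?thesis
      by (intro tensor_carrierI[of n "\<lambda>i. k \<odot>\<^bsub>A\<^esub> x i" _ y])
         (use 1 in \<open>auto simp: tensor_algebra_def fun_eq_iff restrict_def sum_distrib_left\<close>)
  qed
  have zero: "\<zero>\<^bsub>?T\<^esub> \<in> carrier ?T"
    by (rule tensor_carrierI[of 0 undefined _ undefined]) (auto simp: tensor_algebra_def)
  have abel: "abelian_group ?T"
  proof (rule abelian_groupI)
    show "\<exists>y\<in>carrier ?T. y \<oplus>\<^bsub>?T\<^esub> x = \<zero>\<^bsub>?T\<^esub>" if x: "x \<in> carrier ?T" for x
    proof
      show "(-1) \<odot>\<^bsub>?T\<^esub> x \<oplus>\<^bsub>?T\<^esub> x = \<zero>\<^bsub>?T\<^esub>"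
        by (rule tensor_eqI[of _ A B]) (simp_all add: x add scale zero)
    qed (simp add: x scale)
  qed (rule tensor_eqI[of _ A B] | simp add: add zero)+
  have "module complex_ring ?T"
    by (rule moduleI[OF cring_complex_ring abel])
       (rule tensor_eqI[of _ A B] | simp add: add scale algebra_simps)+
  then show ?thesis by (simp add: complex_space_def)
qed

lemma elem_tensor_bilinear:
  assumes "complex_space A" "complex_space B"
  shows "bilinear_map A B (tensor_algebra A B) (elem_tensor A B)"
proof -
  interpret A: complex_space A by fact
  interpret B: complex_space B by fact
  interpret T: complex_space "tensor_algebra A B" by (rule tensor_algebra_space) fact
  show ?thesis
    unfolding bilinear_map_def linear_map_def
    by (intro conjI ballI allI funcsetI tensor_eqI[of _ A B]) (simp_all add: bilinear_forms_simps)
qed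

text \<open>
  The lift is independent of the chosen sum of elementary tensors: a functional f applied to either
  candidate value is the value of T at the bilinear form f \<circ> \<phi>, and functionals separate points.
\<close>

lemma tensor_lift_props:
  assumes V: "complex_space V" and \<phi>: "bilinear_map A B V \<phi>" and T: "T \<in> carrier (tensor_algebra A B)"
  shows tensor_lift_closed: "tensor_lift A B V \<phi> T \<in> carrier V"
    and tensor_lift_functional:
      "linear_functional V f \<Longrightarrow> f (tensor_lift A B V \<phi> T) = T (\<lambda>a b. f (\<phi> a b))"
proof -
  interpret V: complex_space V by fact
  obtain n :: nat and x y where 1: "x \<in> {..<n} \<rightarrow> carrier A" "y \<in> {..<n} \<rightarrow> carrier B"
    "T = (\<lambda>\<beta>\<in>bilinear_forms A B. \<Sum>i<n. \<beta> (x i) (y i))"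
    using T unfolding tensor_carrier_iff by blast
  have sum: "(\<Oplus>\<^bsub>V\<^esub>i\<in>{..<m}. \<phi> (x i) (y i)) \<in> carrier V \<and>
      (\<forall>f. linear_functional V f \<longrightarrow> f (\<Oplus>\<^bsub>V\<^esub>i\<in>{..<m}. \<phi> (x i) (y i)) = T (\<lambda>a b. f (\<phi> a b)))"
    if xy: "x \<in> {..<m} \<rightarrow> carrier A" "y \<in> {..<m} \<rightarrow> carrier B"
    and T_eq: "T = (\<lambda>\<beta>\<in>bilinear_forms A B. \<Sum>i<m. \<beta> (x i) (y i))" for m :: nat and x y
  proof -
    have mem: "(\<lambda>i. \<phi> (x i) (y i)) \<in> {..<m} \<rightarrow> carrier V"
      using xy bilinear_map_closed[OF \<phi>] by (auto simp: Pi_iff)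
    have "f (\<Oplus>\<^bsub>V\<^esub>i\<in>{..<m}. \<phi> (x i) (y i)) = T (\<lambda>a b. f (\<phi> a b))"
      if f: "linear_functional V f" for f
      using V.linear_functional_finsum[OF f _ mem] linear_functional_comp_bilinear[OF f \<phi>]
      by (simp add: T_eq)
    then show ?thesis using V.finsum_closed[OF mem] by blast
  qed
  have "tensor_lift A B V \<phi> T = (\<Oplus>\<^bsub>V\<^esub>i\<in>{..<n}. \<phi> (x i) (y i))"
    unfolding tensor_lift_def
  proof (rule the_equality)
    show "\<exists>(m::nat) x' y'. x' \<in> {..<m} \<rightarrow> carrier A \<and> y' \<in> {..<m} \<rightarrow> carrier B \<and>
       T = (\<lambda>\<beta>\<in>bilinear_forms A B. \<Sum>i<m. \<beta> (x' i) (y' i)) \<and>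
       (\<Oplus>\<^bsub>V\<^esub>i\<in>{..<n}. \<phi> (x i) (y i)) = (\<Oplus>\<^bsub>V\<^esub>i\<in>{..<m}. \<phi> (x' i) (y' i))"
      by (rule exI[of _ n], rule exI[of _ x], rule exI[of _ y]) (intro conjI 1 refl)
  next
    fix v assume "\<exists>(m::nat) x' y'. x' \<in> {..<m} \<rightarrow> carrier A \<and> y' \<in> {..<m} \<rightarrow> carrier B \<and>
       T = (\<lambda>\<beta>\<in>bilinear_forms A B. \<Sum>i<m. \<beta> (x' i) (y' i)) \<and> v = (\<Oplus>\<^bsub>V\<^esub>i\<in>{..<m}. \<phi> (x' i) (y' i))"
    then obtain m :: nat and x' y' where 2: "x' \<in> {..<m} \<rightarrow> carrier A" "y' \<in> {..<m} \<rightarrow> carrier B"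
      "T = (\<lambda>\<beta>\<in>bilinear_forms A B. \<Sum>i<m. \<beta> (x' i) (y' i))"
      and v: "v = (\<Oplus>\<^bsub>V\<^esub>i\<in>{..<m}. \<phi> (x' i) (y' i))" by blast
    show "v = (\<Oplus>\<^bsub>V\<^esub>i\<in>{..<n}. \<phi> (x i) (y i))"
      unfolding v
      by (rule V.eqI_functional[OF conjunct1[OF sum[OF 2]] conjunct1[OF sum[OF 1]]])
         (rule trans[OF conjunct2[OF sum[OF 2], rule_format] conjunct2[OF sum[OF 1], rule_format, symmetric]])
  qed
  then have lift: "(\<Oplus>\<^bsub>V\<^esub>i\<in>{..<n}. \<phi> (x i) (y i)) = tensor_lift A B V \<phi> T" ..
  show "tensor_lift A B V \<phi> T \<in> carrier V"
    by (rule conjunct1[OF sum[OF 1], unfolded lift])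
  show "linear_functional V f \<Longrightarrow> f (tensor_lift A B V \<phi> T) = T (\<lambda>a b. f (\<phi> a b))"
    by (rule conjunct2[OF sum[OF 1], unfolded lift, rule_format])
qed

lemma tensor_lift_eqI:
  assumes "complex_space V" "bilinear_map A B V \<phi>" "T \<in> carrier (tensor_algebra A B)" "v \<in> carrier V"
    and "\<And>f. linear_functional V f \<Longrightarrow> T (\<lambda>a b. f (\<phi> a b)) = f v"
  shows "tensor_lift A B V \<phi> T = v"
proof (rule complex_space.eqI_functional[OF assms(1) tensor_lift_closed[OF assms(1-3)] assms(4)])
  fix f assume f: "linear_functional V f"
  show "f (tensor_lift A B V \<phi> T) = f v"
    by (rule trans[OF tensor_lift_functional[OF assms(1-3) f] assms(5)[OF f]])
qed

lemma tensor_lift_tensor_eval: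
  assumes "complex_space C" "bilinear_map A B (tensor_algebra C D) \<phi>"
    "T \<in> carrier (tensor_algebra A B)" "\<beta> \<in> bilinear_forms C D"
  shows "tensor_lift A B (tensor_algebra C D) \<phi> T \<beta> = T (\<lambda>a b. \<phi> a b \<beta>)"
  using tensor_lift_functional[OF tensor_algebra_space[OF assms(1)] assms(2,3)
      tensor_eval_linear[OF assms(4)]] .

lemma bilinear_map_comp:
  assumes "linear_map A C f" "linear_map B D g" "bilinear_map C D V \<phi>"
  shows "bilinear_map A B V (\<lambda>a b. \<phi> (f a) (g b))"
  using assms by (auto simp: bilinear_map_def linear_map_def Pi_iff)

lemma bilinear_forms_comp:
  assumes "linear_map A C f" "linear_map B D g" "\<beta> \<in> bilinear_forms C D"
  shows "(\<lambda>a b. \<beta> (f a) (g b)) \<in> bilinear_forms A B"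
  using assms by (auto simp: bilinear_forms_def linear_functional_def linear_map_def Pi_iff)

lemma tensor_map_closed:
  assumes "complex_space C" "complex_space D" "linear_map A C f" "linear_map B D g"
    "T \<in> carrier (tensor_algebra A B)"
  shows "tensor_map A B C D f g T \<in> carrier (tensor_algebra C D)"
  unfolding tensor_map_def
  by (rule tensor_lift_closed[OF tensor_algebra_space[OF assms(1)]
        bilinear_map_comp[OF assms(3,4) elem_tensor_bilinear[OF assms(1,2)]] assms(5)])

lemma tensor_map_eval:
  assumes "complex_space C" "complex_space D" "linear_map A C f" "linear_map B D g"
    "T \<in> carrier (tensor_algebra A B)" "\<beta> \<in> bilinear_forms C D"
  shows "tensor_map A B C D f g T \<beta> = T (\<lambda>a b. \<beta> (f a) (g b))"
  unfolding tensor_map_def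
  by (rule tensor_lift_tensor_eval[OF assms(1) bilinear_map_comp[OF assms(3,4)
        elem_tensor_bilinear[OF assms(1,2)]] assms(5,6), unfolded elem_tensor_eval[OF assms(6)]])

text \<open>
  The subspaces M and N enter because a form that vanishes on them lives on the quotients. In the
  induction on the number of terms, the last x n is either, modulo M, expressed through the
  earlier x i, or split off by a functional that vanishes on them; either way one term is dropped.
\<close>

lemma tensor_slices_sum:
  assumes A: "complex_space A" and B: "complex_space B" and M: "linear_subspace A M"
    and N: "linear_subspace B N" and \<beta>: "\<beta> \<in> bilinear_forms A B"
    and \<beta>M: "\<And>a b. a \<in> M \<Longrightarrow> b \<in> carrier B \<Longrightarrow> \<beta> a b = 0"
    and \<beta>N: "\<And>a b. a \<in> carrier A \<Longrightarrow> b \<in> N \<Longrightarrow> \<beta> a b = 0"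
  shows "(\<And>i. i < (n::nat) \<Longrightarrow> x i \<in> carrier A) \<Longrightarrow> (\<And>i. i < n \<Longrightarrow> y i \<in> carrier B) \<Longrightarrow>
    (\<And>f g. linear_functional A f \<Longrightarrow> (\<And>a. a \<in> M \<Longrightarrow> f a = 0) \<Longrightarrow>
       linear_functional B g \<Longrightarrow> (\<And>b. b \<in> N \<Longrightarrow> g b = 0) \<Longrightarrow>
       (\<Sum>i<n. f (x i) * g (y i)) = 0) \<Longrightarrow> (\<Sum>i<n. \<beta> (x i) (y i)) = 0"
proof (induction n arbitrary: y)
  case 0
  then show ?case by simp
next
  case (Suc n)
  interpret A: complex_space A by fact
  interpret B: complex_space B by fact
  let ?Q = "\<lambda>f. linear_functional A f \<and> (\<forall>a\<in>M. f a = 0)"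
  define W where "W = {w \<in> carrier A. \<exists>d. \<forall>f. ?Q f \<longrightarrow> f w = (\<Sum>i<n. d i * f (x i))}"
  have \<beta>1: "linear_functional A (\<lambda>a. \<beta> a b)" if "b \<in> carrier B" for b
    using \<beta> that by (simp add: bilinear_forms_def)
  have \<beta>2: "linear_functional B (\<beta> a)" if "a \<in> carrier A" for a
    using \<beta> that by (simp add: bilinear_forms_def)
  have W: "linear_subspace A W"
    unfolding linear_subspace_def
  proof (intro conjI ballI allI)
    show "W \<subseteq> carrier A" by (auto simp: W_def)
    show "\<zero>\<^bsub>A\<^esub> \<in> W" by (auto simp: W_def A.linear_functional_zero intro: exI[of _ "\<lambda>_. 0"])
  next
    fix v w assume "v \<in> W" "w \<in> W"
    then obtain d e where "v \<in> carrier A" "w \<in> carrier A"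
      "\<forall>f. ?Q f \<longrightarrow> f v = (\<Sum>i<n. d i * f (x i))"
      "\<forall>f. ?Q f \<longrightarrow> f w = (\<Sum>i<n. e i * f (x i))"
      by (auto simp: W_def)
    then show "v \<oplus>\<^bsub>A\<^esub> w \<in> W"
      by (auto simp: W_def linear_functional_add sum.distrib algebra_simps intro!: exI[of _ "\<lambda>i. d i + e i"])
  next
    fix k v assume "v \<in> W"
    then obtain d where "v \<in> carrier A"
      "\<forall>f. ?Q f \<longrightarrow> f v = (\<Sum>i<n. d i * f (x i))"
      by (auto simp: W_def)
    then show "k \<odot>\<^bsub>A\<^esub> v \<in> W"
      by (auto simp: W_def linear_functional_scale sum_distrib_left mult.assoc intro!: exI[of _ "\<lambda>i. k * d i"])
  qed
  have xW: "x i \<in> W" if "i < n" for i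
    using that Suc.prems(1)[of i]
    by (auto simp: W_def if_distrib[of "\<lambda>c. c * _"] cong: if_cong intro!: exI[of _ "\<lambda>j. if j = i then 1 else 0"])
  have MW: "M \<subseteq> W"
  proof
    fix a assume "a \<in> M"
    then show "a \<in> W" using M by (auto simp: W_def linear_subspace_def intro!: exI[of _ "\<lambda>_. 0"])
  qed
  show ?case
  proof (cases "x n \<in> W")
    case True
    then obtain d where d: "\<And>f. ?Q f \<Longrightarrow> f (x n) = (\<Sum>i<n. d i * f (x i))"
      by (auto simp: W_def)
    define y' where "y' i = y i \<oplus>\<^bsub>B\<^esub> d i \<odot>\<^bsub>B\<^esub> y n" for i
    have yn: "y n \<in> carrier B" using Suc.prems(2) by simp
    have y': "g (y' i) = g (y i) + d i * g (y n)" if "linear_functional B g" "i < n" for g i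
      using that Suc.prems(2)[of i] yn by (simp add: y'_def linear_functional_add linear_functional_scale)
    have "(\<Sum>i<n. \<beta> (x i) (y' i)) = 0"
    proof (rule Suc.IH)
      show "x i \<in> carrier A" if "i < n" for i using that Suc.prems(1) by simp
      show "y' i \<in> carrier B" if "i < n" for i using that Suc.prems(2)[of i] yn by (simp add: y'_def)
    next
      fix f g assume f: "linear_functional A f" "\<And>a. a \<in> M \<Longrightarrow> f a = 0" and g: "linear_functional B g" "\<And>b. b \<in> N \<Longrightarrow> g b = 0"
      have "(\<Sum>i<n. f (x i) * g (y' i)) = (\<Sum>i<n. f (x i) * g (y i)) + f (x n) * g (y n)"
        using y'[OF g(1)] by (simp add: d f algebra_simps sum.distrib sum_distrib_left)
      also have "\<dots> = 0" using Suc.prems(3)[OF f g] by simp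
      finally show "(\<Sum>i<n. f (x i) * g (y' i)) = 0" .
    qed
    moreover have "(\<Sum>i<n. \<beta> (x i) (y' i)) = (\<Sum>i<n. \<beta> (x i) (y i)) + \<beta> (x n) (y n)"
      using y'[OF \<beta>2] Suc.prems(1)
      by (simp add: d[of "\<lambda>a. \<beta> a (y n)"] \<beta>1[OF yn] \<beta>M yn algebra_simps sum.distrib sum_distrib_left)
    ultimately show ?thesis by simp
  next
    case False
    obtain f0 where f0: "linear_functional A f0" "\<And>w. w \<in> W \<Longrightarrow> f0 w = 0" "f0 (x n) = 1"
      using A.separating_functional[OF W _ False] Suc.prems(1) by blast
    have g0: "g (y n) = 0" if g: "linear_functional B g" "\<And>b. b \<in> N \<Longrightarrow> g b = 0" for g
      using Suc.prems(3)[OF f0(1) _ g] f0(2)[OF xW] f0(2)[OF subsetD[OF MW]] f0(3) by simp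
    have "y n \<in> N" using B.subspace_memI[OF N] Suc.prems(2) g0 by simp
    moreover have "(\<Sum>i<n. \<beta> (x i) (y i)) = 0"
    proof (rule Suc.IH)
      fix f g assume f: "linear_functional A f" "\<And>a. a \<in> M \<Longrightarrow> f a = 0" and g: "linear_functional B g" "\<And>b. b \<in> N \<Longrightarrow> g b = 0"
      show "(\<Sum>i<n. f (x i) * g (y i)) = 0" using Suc.prems(3)[OF f g] g0[OF g] by simp
    qed (use Suc.prems in auto)
    ultimately show ?thesis using \<beta>N Suc.prems(1) by simp
  qed
qed

lemma tensor_slices_vanish:
  assumes "complex_space A" "complex_space B" "linear_subspace A M" "linear_subspace B N"
    and "T \<in> carrier (tensor_algebra A B)"
    and "\<beta> \<in> bilinear_forms A B" "\<And>a b. a \<in> M \<Longrightarrow> b \<in> carrier B \<Longrightarrow> \<beta> a b = 0"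
    "\<And>a b. a \<in> carrier A \<Longrightarrow> b \<in> N \<Longrightarrow> \<beta> a b = 0"
    and "\<And>f g. linear_functional A f \<Longrightarrow> (\<And>a. a \<in> M \<Longrightarrow> f a = 0) \<Longrightarrow>
       linear_functional B g \<Longrightarrow> (\<And>b. b \<in> N \<Longrightarrow> g b = 0) \<Longrightarrow> T (\<lambda>a b. f a * g b) = 0"
  shows "T \<beta> = 0"
proof -
  obtain n x y where r1: "tensor_rep A B T n x y"
    using tensor_rep_exists[OF assms(5)] by blast
  note 1 = tensor_repD[OF r1]
  have "(\<Sum>i<n. \<beta> (x i) (y i)) = 0"
  proof (rule tensor_slices_sum[OF assms(1-4,6-8)])
    fix f g assume f: "linear_functional A f" "\<And>a. a \<in> M \<Longrightarrow> f a = 0"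
      and g: "linear_functional B g" "\<And>b. b \<in> N \<Longrightarrow> g b = 0"
    then show "(\<Sum>i<n. f (x i) * g (y i)) = 0"
      using assms(9)[OF f g] 1(3)[OF product_form[OF f(1) g(1)]] by simp
  qed (use 1 in auto)
  then show ?thesis using 1(3)[OF assms(6)] by simp
qed


section \<open>Positive functionals and the Kac ideal\<close>

lemma nonneg_two_by_two:
  fixes A B C D :: complex
  assumes nn: "\<And>c d. cnj c * c * A + cnj c * d * B + cnj d * c * C + cnj d * d * D \<in> \<real>\<^sub>\<ge>\<^sub>0"
  shows "C = cnj B" and "(cmod B)\<^sup>2 \<le> Re A * Re D"
proof -
  have A: "Re A \<ge> 0" "Im A = 0" using nn[of 1 0] by (auto simp: complex_nonneg_Reals_iff)
  have D: "Re D \<ge> 0" "Im D = 0" using nn[of 0 1] by (auto simp: complex_nonneg_Reals_iff)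
  have "Im (B + C) = 0" using nn[of 1 1] A D by (auto simp: complex_nonneg_Reals_iff)
  moreover have "Re B = Re C" using nn[of 1 \<i>] A D by (auto simp: complex_nonneg_Reals_iff)
  ultimately show C: "C = cnj B" by (auto simp: complex_eq_iff)
  have cB: "(cmod B)\<^sup>2 = Re B * Re B + Im B * Im B"
    unfolding cmod_power2 by (simp add: power2_eq_square)
  \<comment> \<open>With c = t real and d = - cnj B the hypothesis becomes a real quadratic in t.\<close>
  have q: "t\<^sup>2 * Re A - 2 * t * (cmod B)\<^sup>2 + (cmod B)\<^sup>2 * Re D \<ge> 0" for t :: real
    using nn[of "complex_of_real t" "- cnj B"]
    unfolding cB by (simp add: C A D complex_nonneg_Reals_iff power2_eq_square algebra_simps)
  show "(cmod B)\<^sup>2 \<le> Re A * Re D"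
  proof (cases "Re A = 0")
    case True
    have "(cmod B)\<^sup>2 = 0"
    proof (rule ccontr)
      assume ne: "(cmod B)\<^sup>2 \<noteq> 0"
      have "(cmod B)\<^sup>2 * (Re D - 2 * (Re D + 1)) \<ge> 0"
        using q[of "Re D + 1"] True by (simp add: algebra_simps)
      then show False using ne D(1) by (simp add: zero_le_mult_iff)
    qed
    then show ?thesis using True by simp
  next
    case False
    then have pos: "Re A > 0" using A by simp
    let ?b = "(cmod B)\<^sup>2"
    have "(?b / Re A)\<^sup>2 * Re A - 2 * (?b / Re A) * ?b + ?b * Re D = ?b * (Re D - ?b / Re A)"
      using pos by (simp add: power2_eq_square field_simps)
    then have "?b * (Re D - ?b / Re A) \<ge> 0" using q[of "?b / Re A"] by simp
    then have "?b = 0 \<or> ?b / Re A \<le> Re D" by (auto simp: zero_le_mult_iff)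
    then show ?thesis using pos D by (auto simp: field_simps)
  qed
qed

definition positive_functional :: "('a, 'x) star_algebra_scheme \<Rightarrow> ('a \<Rightarrow> complex) \<Rightarrow> bool" where
  "positive_functional A \<tau> \<longleftrightarrow> linear_functional A \<tau> \<and>
     (\<forall>x\<in>carrier A. \<tau> (star A x \<otimes>\<^bsub>A\<^esub> x) \<in> \<real>\<^sub>\<ge>\<^sub>0)"

lemma positive_functional_state: "state A \<tau> \<Longrightarrow> positive_functional A \<tau>"
  by (simp add: state_def positive_functional_def)

definition tracial_state :: "('a, 'x) star_algebra_scheme \<Rightarrow> ('a \<Rightarrow> complex) \<Rightarrow> bool" where
  "tracial_state A \<tau> \<longleftrightarrow> state A \<tau> \<and> tracial A \<tau>"

lemma tracial_stateD:
  assumes "tracial_state A \<tau>"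
  shows "state A \<tau>" "linear_functional A \<tau>" "positive_functional A \<tau>" "\<tau> \<one>\<^bsub>A\<^esub> = 1"
    "x \<in> carrier A \<Longrightarrow> \<tau> (star A x \<otimes>\<^bsub>A\<^esub> x) \<in> \<real>\<^sub>\<ge>\<^sub>0"
    "x \<in> carrier A \<Longrightarrow> y \<in> carrier A \<Longrightarrow> \<tau> (x \<otimes>\<^bsub>A\<^esub> y) = \<tau> (y \<otimes>\<^bsub>A\<^esub> x)"
  using assms by (auto simp: tracial_state_def state_def tracial_def positive_functional_def)

context star_algebra
begin

lemma star_one: "star A \<one> = \<one>"
proof -
  have 1: "star A \<one> \<in> carrier A" by (simp add: star_closed)
  have "star A (\<one> \<otimes> star A \<one>) = star A (star A \<one>) \<otimes> star A \<one>" using 1 star_mult by blast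
  then show ?thesis using 1 by (simp add: star_star)
qed

lemma linear_functional_mult_left:
  "linear_functional A f \<Longrightarrow> a \<in> carrier A \<Longrightarrow> linear_functional A (\<lambda>x. f (a \<otimes> x))"
  by (simp add: linear_functional_def r_distr smult_mult_r)

lemma linear_functional_mult_right:
  "linear_functional A f \<Longrightarrow> a \<in> carrier A \<Longrightarrow> linear_functional A (\<lambda>x. f (x \<otimes> a))"
  by (simp add: linear_functional_def l_distr smult_mult_l)

lemma star_zero: "star A \<zero> = \<zero>"
  using star_smult[of \<zero> 0] by (simp add: star_closed)

lemma star_finsum:
  assumes "finite I" "g \<in> I \<rightarrow> carrier A"
  shows "star A (\<Oplus>i\<in>I. g i) = (\<Oplus>i\<in>I. star A (g i))"
  using assms
proof (induction I)
  case empty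
  then show ?case by (simp add: star_zero)
next
  case (insert i I)
  then have "g \<in> I \<rightarrow> carrier A" "g i \<in> carrier A" by auto
  moreover from this have "(\<lambda>i. star A (g i)) \<in> I \<rightarrow> carrier A"
    by (simp add: Pi_iff star_closed)
  ultimately show ?case using insert by (simp add: star_add star_closed)
qed

lemma combination_closed [simp]:
  "(\<And>i. i < n \<Longrightarrow> x i \<in> carrier A) \<Longrightarrow> (\<Oplus>i\<in>{..<(n::nat)}. c i \<odot> x i) \<in> carrier A"
  by (rule finsum_closed) auto

lemma functional_combination:
  assumes f: "linear_functional A f" and x: "\<And>i. i < n \<Longrightarrow> x i \<in> carrier A"
  shows "f (\<Oplus>i\<in>{..<(n::nat)}. c i \<odot> x i) = (\<Sum>i<n. c i * f (x i))"
proof -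
  have "f (\<Oplus>i\<in>{..<n}. c i \<odot> x i) = (\<Sum>i<n. f (c i \<odot> x i))"
    by (rule linear_functional_finsum[OF f]) (use x in auto)
  then show ?thesis using x by (simp add: linear_functional_scale[OF f])
qed

lemma functional_star_mult_combination:
  assumes f: "linear_functional A f" and x: "\<And>i. i < n \<Longrightarrow> x i \<in> carrier A"
    and y: "\<And>j. j < m \<Longrightarrow> y j \<in> carrier A"
  shows "f (star A (\<Oplus>i\<in>{..<(n::nat)}. c i \<odot> x i) \<otimes> (\<Oplus>j\<in>{..<(m::nat)}. d j \<odot> y j)) =
    (\<Sum>i<n. \<Sum>j<m. cnj (c i) * d j * f (star A (x i) \<otimes> y j))"
proof -
  let ?X = "\<Oplus>i\<in>{..<n}. c i \<odot> x i" and ?Y = "\<Oplus>j\<in>{..<m}. d j \<odot> y j"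
  have Y: "?Y \<in> carrier A" using y by simp
  have "star A ?X = (\<Oplus>i\<in>{..<n}. star A (c i \<odot> x i))"
    by (rule star_finsum) (use x in auto)
  also have "\<dots> = (\<Oplus>i\<in>{..<n}. cnj (c i) \<odot> star A (x i))"
    by (rule finsum_cong') (use x in \<open>auto simp: star_smult star_closed\<close>)
  finally have "f (star A ?X \<otimes> ?Y) = (\<Sum>i<n. cnj (c i) * f (star A (x i) \<otimes> ?Y))"
    using functional_combination[OF linear_functional_mult_right[OF f Y], of n "\<lambda>i. star A (x i)"] x
    by (simp add: star_closed)
  moreover have "f (star A (x i) \<otimes> ?Y) = (\<Sum>j<m. d j * f (star A (x i) \<otimes> y j))" if "i < n" for i
    using functional_combination[OF linear_functional_mult_left[OF f], of "star A (x i)" m y] that x y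
    by (simp add: star_closed)
  ultimately show ?thesis by (simp add: sum_distrib_left mult.assoc)
qed

lemma Cauchy_Schwarz:
  assumes \<tau>: "positive_functional A \<tau>" and x: "x \<in> carrier A" and y: "y \<in> carrier A"
  shows positive_functional_swap: "\<tau> (star A y \<otimes> x) = cnj (\<tau> (star A x \<otimes> y))"
    and "(cmod (\<tau> (star A x \<otimes> y)))\<^sup>2 \<le> Re (\<tau> (star A x \<otimes> x)) * Re (\<tau> (star A y \<otimes> y))"
proof -
  have lin: "linear_functional A \<tau>" using \<tau> by (simp add: positive_functional_def)
  have "cnj c * c * \<tau> (star A x \<otimes> x) + cnj c * d * \<tau> (star A x \<otimes> y) +
      cnj d * c * \<tau> (star A y \<otimes> x) + cnj d * d * \<tau> (star A y \<otimes> y) \<in> \<real>\<^sub>\<ge>\<^sub>0" for c d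
  proof -
    let ?z = "c \<odot> x \<oplus> d \<odot> y"
    have "\<tau> (star A ?z \<otimes> ?z) \<in> \<real>\<^sub>\<ge>\<^sub>0" using \<tau> x y by (simp add: positive_functional_def)
    also have "\<tau> (star A ?z \<otimes> ?z) = cnj c * c * \<tau> (star A x \<otimes> x) + cnj c * d * \<tau> (star A x \<otimes> y) +
      cnj d * c * \<tau> (star A y \<otimes> x) + cnj d * d * \<tau> (star A y \<otimes> y)"
      using x y by (simp add: star_add star_smult star_closed l_distr r_distr smult_mult_l smult_mult_r
          linear_functional_add[OF lin] linear_functional_scale[OF lin] algebra_simps)
    finally show ?thesis .
  qed
  from nonneg_two_by_two[OF this]
  show "\<tau> (star A y \<otimes> x) = cnj (\<tau> (star A x \<otimes> y))"
    "(cmod (\<tau> (star A x \<otimes> y)))\<^sup>2 \<le> Re (\<tau> (star A x \<otimes> x)) * Re (\<tau> (star A y \<otimes> y))" by auto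
qed

lemma state_star:
  assumes "state A \<tau>" "x \<in> carrier A" shows "\<tau> (star A x) = cnj (\<tau> x)"
  using positive_functional_swap[OF positive_functional_state[OF assms(1)], of \<one> x] assms(2)
  by (simp add: star_one star_closed)

lemma state_norm_le:
  assumes "state A \<tau>" "x \<in> carrier A"
  shows "(cmod (\<tau> x))\<^sup>2 \<le> Re (\<tau> (star A x \<otimes> x))"
  using Cauchy_Schwarz(2)[OF positive_functional_state[OF assms(1)], of \<one> x] assms
  by (simp add: star_one state_def)

text \<open>
  The Cauchy-Schwarz inequality turns the quadratic condition that defines the Kac ideal into a
  linear one, for which the ideal properties are immediate.
\<close>

lemma kac_ideal_iff:
  "a \<in> kac_ideal A \<longleftrightarrow> a \<in> carrier A \<and>
     (\<forall>\<tau>. tracial_state A \<tau> \<longrightarrow> (\<forall>y\<in>carrier A. \<tau> (a \<otimes> y) = 0))"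
proof
  assume R: "a \<in> carrier A \<and> (\<forall>\<tau>. tracial_state A \<tau> \<longrightarrow> (\<forall>y\<in>carrier A. \<tau> (a \<otimes> y) = 0))"
  then show "a \<in> kac_ideal A" by (simp add: kac_ideal_def tracial_state_def star_closed)
next
  assume L: "a \<in> kac_ideal A"
  have a: "a \<in> carrier A" using L by (simp add: kac_ideal_def)
  have "\<tau> (a \<otimes> y) = 0" if \<tau>: "tracial_state A \<tau>" and y: "y \<in> carrier A" for \<tau> y
  proof -
    have "\<tau> (a \<otimes> star A a) = 0" using L \<tau> by (simp add: kac_ideal_def tracial_state_def)
    then show ?thesis
      using Cauchy_Schwarz(2)[OF tracial_stateD(3)[OF \<tau>], of "star A a" y] a y
      by (simp add: star_closed star_star)
  qed
  then show "a \<in> carrier A \<and> (\<forall>\<tau>. tracial_state A \<tau> \<longrightarrow> (\<forall>y\<in>carrier A. \<tau> (a \<otimes> y) = 0))"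
    using a by blast
qed

lemma kac_idealI:
  assumes "a \<in> carrier A" "\<And>\<tau>. tracial_state A \<tau> \<Longrightarrow> \<tau> (star A a \<otimes> a) = 0"
  shows "a \<in> kac_ideal A"
  using assms by (auto simp: kac_ideal_def tracial_state_def tracial_def star_closed)

lemma kac_idealD:
  assumes "a \<in> kac_ideal A"
  shows kac_ideal_closed: "a \<in> carrier A"
    and "tracial_state A \<tau> \<Longrightarrow> y \<in> carrier A \<Longrightarrow> \<tau> (a \<otimes> y) = 0"
    and kac_ideal_vanish: "tracial_state A \<tau> \<Longrightarrow> \<tau> a = 0"
    and "tracial_state A \<tau> \<Longrightarrow> \<tau> (star A a \<otimes> a) = 0"
proof -
  show a: "a \<in> carrier A" using assms by (simp add: kac_ideal_iff)
  show *: "tracial_state A \<tau> \<Longrightarrow> y \<in> carrier A \<Longrightarrow> \<tau> (a \<otimes> y) = 0" for y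
    using assms kac_ideal_iff by blast
  show "tracial_state A \<tau> \<Longrightarrow> \<tau> a = 0" using *[of \<one>] a by simp
  show "tracial_state A \<tau> \<Longrightarrow> \<tau> (star A a \<otimes> a) = 0"
    using *[of "star A a"] a tracial_stateD(6) by (metis star_closed)
qed

lemma kac_ideal_subspace: "linear_subspace A (kac_ideal A)"
  unfolding linear_subspace_def
proof (intro conjI ballI allI)
  show "kac_ideal A \<subseteq> carrier A" by (auto simp: kac_ideal_closed)
  show "\<zero> \<in> kac_ideal A"
    by (simp add: kac_ideal_iff linear_functional_zero[OF tracial_stateD(2)])
next
  fix x y assume "x \<in> kac_ideal A" "y \<in> kac_ideal A"
  then show "x \<oplus> y \<in> kac_ideal A"
    by (auto simp: kac_ideal_iff l_distr linear_functional_add[OF tracial_stateD(2)])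
next
  fix k x assume "x \<in> kac_ideal A"
  then show "k \<odot> x \<in> kac_ideal A"
    by (auto simp: kac_ideal_iff smult_mult_l linear_functional_scale[OF tracial_stateD(2)])
qed

lemma kac_ideal_mult_left:
  assumes "a \<in> kac_ideal A" "x \<in> carrier A" shows "x \<otimes> a \<in> kac_ideal A"
proof -
  have a: "a \<in> carrier A" using assms kac_ideal_closed by blast
  have "\<tau> (x \<otimes> a \<otimes> y) = 0" if \<tau>: "tracial_state A \<tau>" and y: "y \<in> carrier A" for \<tau> y
  proof -
    have "\<tau> (x \<otimes> a \<otimes> y) = \<tau> (x \<otimes> (a \<otimes> y))" using assms a y by (simp add: m_assoc)
    also have "\<dots> = \<tau> ((a \<otimes> y) \<otimes> x)" using tracial_stateD(6)[OF \<tau>] assms a y by simp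
    also have "\<dots> = \<tau> (a \<otimes> (y \<otimes> x))" using assms a y by (simp add: m_assoc)
    finally show ?thesis using kac_idealD(2)[OF assms(1) \<tau>] assms y by simp
  qed
  then show ?thesis using assms a by (simp add: kac_ideal_iff)
qed

lemma kac_ideal_mult_right:
  assumes "a \<in> kac_ideal A" "x \<in> carrier A" shows "a \<otimes> x \<in> kac_ideal A"
  using assms kac_idealD(1,2)[OF assms(1)] by (simp add: kac_ideal_iff m_assoc)

lemma kac_ideal_star:
  assumes "a \<in> kac_ideal A" shows "star A a \<in> kac_ideal A"
proof (rule kac_idealI)
  show "star A a \<in> carrier A" using assms by (simp add: star_closed kac_ideal_closed)
  show "\<tau> (star A (star A a) \<otimes> star A a) = 0" if "tracial_state A \<tau>" for \<tau>
    using assms that by (simp add: star_star kac_ideal_closed kac_idealD(2) star_closed)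
qed

lemma kac_ideal_ideal: "ideal (kac_ideal A) A"
proof (rule idealI)
  show "ring A" by (rule ring_axioms)
  show "subgroup (kac_ideal A) (add_monoid A)"
  proof (rule add.subgroupI)
    show "kac_ideal A \<subseteq> carrier A" by (auto simp: kac_ideal_closed)
    show "kac_ideal A \<noteq> {}" using kac_ideal_subspace by (auto simp: linear_subspace_def)
    show "\<ominus> a \<in> kac_ideal A" if "a \<in> kac_ideal A" for a
      using kac_ideal_subspace that by (simp add: minus_eq_scale kac_ideal_closed linear_subspace_def)
    show "a \<oplus> b \<in> kac_ideal A" if "a \<in> kac_ideal A" "b \<in> kac_ideal A" for a b
      using kac_ideal_subspace that by (simp add: linear_subspace_def)
  qed
qed (simp_all add: kac_ideal_mult_left kac_ideal_mult_right)

end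

section \<open>Convolution of tracial states\<close>

text \<open>Cholesky decomposition of a positive semidefinite matrix, by splitting off the last pivot.\<close>

lemma Cholesky_decomposition:
  fixes H :: "nat \<Rightarrow> nat \<Rightarrow> complex"
  shows "(\<And>c. (\<Sum>i<n. \<Sum>j<n. cnj (c i) * c j * H i j) \<in> \<real>\<^sub>\<ge>\<^sub>0) \<Longrightarrow>
    \<exists>L. \<forall>i<n. \<forall>j<n. H i j = (\<Sum>k<n. cnj (L k i) * L k j)"
proof (induction n arbitrary: H)
  case 0
  then show ?case by simp
next
  case (Suc n)
  define r s where "r c = (\<Sum>i<n. cnj (c i) * H i n)" and "s c = (\<Sum>j<n. c j * H n j)" for c
  let ?D = "H n n"
  have split: "(\<Sum>i<Suc n. \<Sum>j<Suc n. cnj (c i) * c j * H i j) =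
      (\<Sum>i<n. \<Sum>j<n. cnj (c i) * c j * H i j) + c n * r c + cnj (c n) * s c + cnj (c n) * c n * ?D" for c
    by (simp add: r_def s_def sum.distrib sum_distrib_left algebra_simps)
  have two: "H n i = cnj (H i n)" "(cmod (H i n))\<^sup>2 \<le> Re (H i i) * Re ?D" if i: "i < n" for i
  proof -
    have "cnj c * c * H i i + cnj c * d * H i n + cnj d * c * H n i + cnj d * d * ?D \<in> \<real>\<^sub>\<ge>\<^sub>0" for c d
    proof -
      let ?c = "\<lambda>j. if j = i then c else if j = n then d else 0"
      have e: "?c j = (if j = i then c else 0)" if "j < n" for j using that by auto
      have "(\<Sum>k<n. cnj (?c j) * ?c k * H j k) = (if j = i then cnj c * c * H i i else 0)" if "j < n" for j
      proof -
        have "(\<Sum>k<n. cnj (?c j) * ?c k * H j k) = (\<Sum>k<n. if k = i then cnj (?c j) * c * H j i else 0)"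
          by (intro sum.cong refl) auto
        then show ?thesis using i that by auto
      qed
      then have "(\<Sum>j<n. \<Sum>k<n. cnj (?c j) * ?c k * H j k) = (\<Sum>j<n. if j = i then cnj c * c * H i i else 0)"
        by (intro sum.cong refl) auto
      then have 1: "(\<Sum>j<n. \<Sum>k<n. cnj (?c j) * ?c k * H j k) = cnj c * c * H i i" using i by simp
      have 2: "r ?c = cnj c * H i n"
      proof -
        have "r ?c = (\<Sum>j<n. if j = i then cnj c * H i n else 0)"
          unfolding r_def by (intro sum.cong refl) auto
        then show ?thesis using i by simp
      qed
      have 3: "s ?c = c * H n i"
      proof -
        have "s ?c = (\<Sum>j<n. if j = i then c * H n i else 0)"
          unfolding s_def by (intro sum.cong refl) auto
        then show ?thesis using i by simp
      qed
      show ?thesis using Suc.prems[of ?c] i unfolding split 1 2 3 by (simp add: algebra_simps)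
    qed
    from nonneg_two_by_two[OF this] show "H n i = cnj (H i n)" "(cmod (H i n))\<^sup>2 \<le> Re (H i i) * Re ?D"
      by auto
  qed
  have D: "Re ?D \<ge> 0" "Im ?D = 0"
    using Suc.prems[of "\<lambda>i. if i = n then 1 else 0"]
    unfolding split by (auto simp: r_def s_def complex_nonneg_Reals_iff cong: if_cong)
  have rs: "r c = cnj (s c)" for c by (simp add: r_def s_def two(1))
  show ?case
  proof (cases "?D = 0")
    case True
    have z: "H i n = 0" "H n i = 0" if "i < n" for i using two[OF that] True by auto
    have "(\<Sum>i<n. \<Sum>j<n. cnj (c i) * c j * H i j) \<in> \<real>\<^sub>\<ge>\<^sub>0" for c
      using Suc.prems[of "\<lambda>i. if i = n then 0 else c i"] unfolding split by simp
    then obtain L where L: "\<forall>i<n. \<forall>j<n. H i j = (\<Sum>k<n. cnj (L k i) * L k j)"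
      using Suc.IH by blast
    define L' where "L' k i = (if k = n \<or> i = n then 0 else L k i)" for k i
    have "H i j = (\<Sum>k<Suc n. cnj (L' k i) * L' k j)" if "i < Suc n" "j < Suc n" for i j
      using that L z True by (cases "i = n"; cases "j = n") (auto simp: L'_def)
    then show ?thesis by blast
  next
    case False
    define d where "d = sqrt (Re ?D)"
    have d: "complex_of_real d \<noteq> 0" "complex_of_real d * complex_of_real d = ?D"
    proof -
      have "complex_of_real d * complex_of_real d = complex_of_real (Re ?D)"
        using D by (simp add: d_def flip: of_real_mult)
      then show "complex_of_real d * complex_of_real d = ?D" using D by (simp add: complex_eq_iff)
      then show "complex_of_real d \<noteq> 0" using False by auto
    qed
    define H' where "H' i j = H i j - H i n * H n j / ?D" for i j
    have "(\<Sum>i<n. \<Sum>j<n. cnj (c i) * c j * H' i j) \<in> \<real>\<^sub>\<ge>\<^sub>0" for c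
    proof -
      let ?c = "\<lambda>i. if i = n then - s c / ?D else c i"
      have "r c * s c = (\<Sum>i<n. \<Sum>j<n. cnj (c i) * H i n * (c j * H n j))"
        by (simp add: r_def s_def sum_product)
      then have "(\<Sum>i<n. \<Sum>j<n. cnj (c i) * c j * H' i j) =
          (\<Sum>i<n. \<Sum>j<n. cnj (c i) * c j * H i j) - r c * s c / ?D"
        by (simp add: H'_def right_diff_distrib sum_subtractf sum_divide_distrib algebra_simps)
      moreover have "(\<Sum>i<n. \<Sum>j<n. cnj (?c i) * ?c j * H i j) = (\<Sum>i<n. \<Sum>j<n. cnj (c i) * c j * H i j)"
        "r ?c = r c" "s ?c = s c" by (simp_all add: r_def s_def)
      moreover have "?c n * r c + cnj (?c n) * s c + cnj (?c n) * ?c n * ?D = - (r c * s c / ?D)"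
      proof -
        have "cnj ?D = ?D" using D by (simp add: complex_eq_iff)
        then show ?thesis using False by (simp add: rs field_simps)
      qed
      ultimately have "(\<Sum>i<n. \<Sum>j<n. cnj (c i) * c j * H' i j) =
          (\<Sum>i<Suc n. \<Sum>j<Suc n. cnj (?c i) * ?c j * H i j)"
        unfolding split by (simp only: add.assoc) simp
      then show ?thesis using Suc.prems[of ?c] by simp
    qed
    then obtain L where L: "\<forall>i<n. \<forall>j<n. H' i j = (\<Sum>k<n. cnj (L k i) * L k j)"
      using Suc.IH[of H'] by blast
    define L' where "L' k i = (if k = n then H n i / d else if i = n then 0 else L k i)" for k i
    have cD: "cnj ?D = ?D" using D by (simp add: complex_eq_iff)
    have "H i j = (\<Sum>k<Suc n. cnj (L' k i) * L' k j)" if "i < Suc n" "j < Suc n" for i j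
    proof -
      have "cnj (H n i) = H i n" using two(1)[of i] cD that by (cases "i = n") auto
      then have top: "cnj (L' n i) * L' n j = H i n * H n j / ?D" by (simp add: L'_def d(2)[symmetric])
      show ?thesis
      proof (cases "i = n \<or> j = n")
        case True
        then have "(\<Sum>k<n. cnj (L' k i) * L' k j) = 0" by (auto simp: L'_def)
        then show ?thesis using True False top by auto
      next
        case False
        then have ij: "i < n" "j < n" using that by auto
        have "(\<Sum>k<n. cnj (L' k i) * L' k j) = (\<Sum>k<n. cnj (L k i) * L k j)"
          using ij by (intro sum.cong) (auto simp: L'_def)
        also have "\<dots> = H' i j" using L ij by simp
        finally show ?thesis using top by (simp add: H'_def)
      qed
    qed
    then show ?thesis by blast
  qed
qed

lemma (in star_algebra) Gram_decomposition:
  assumes \<tau>: "positive_functional A \<tau>" and x: "\<And>i. i < (n::nat) \<Longrightarrow> x i \<in> carrier A"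
  shows "\<exists>L. \<forall>i<n. \<forall>j<n. \<tau> (star A (x i) \<otimes> x j) = (\<Sum>k<n. cnj (L k i) * L k j)"
proof (rule Cholesky_decomposition[where n = n and H = "\<lambda>i j. \<tau> (star A (x i) \<otimes> x j)"])
  fix c :: "nat \<Rightarrow> complex"
  have lin: "linear_functional A \<tau>" using \<tau> by (simp add: positive_functional_def)
  let ?w = "\<Oplus>i\<in>{..<n}. c i \<odot> x i"
  have "?w \<in> carrier A" using x by simp
  then have "\<tau> (star A ?w \<otimes> ?w) \<in> \<real>\<^sub>\<ge>\<^sub>0" using \<tau> by (simp add: positive_functional_def)
  also have "\<tau> (star A ?w \<otimes> ?w) = (\<Sum>i<n. \<Sum>j<n. cnj (c i) * c j * \<tau> (star A (x i) \<otimes> x j))"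
    by (rule functional_star_mult_combination[OF lin x x])
  finally show "(\<Sum>i<n. \<Sum>j<n. cnj (c i) * c j * \<tau> (star A (x i) \<otimes> x j)) \<in> \<real>\<^sub>\<ge>\<^sub>0" .
qed

lemma linear_functional_cong:
  assumes "complex_space V" "linear_functional V f" "\<And>x. x \<in> carrier V \<Longrightarrow> g x = f x"
  shows "linear_functional V g"
proof -
  interpret V: complex_space V by fact
  show ?thesis using assms(2,3) by (simp add: linear_functional_def)
qed

lemma bilinear_forms_cong:
  assumes "complex_space A" "complex_space B" "\<beta> \<in> bilinear_forms A B"
    "\<And>a b. a \<in> carrier A \<Longrightarrow> b \<in> carrier B \<Longrightarrow> \<gamma> a b = \<beta> a b"
  shows "\<gamma> \<in> bilinear_forms A B"
proof -
  interpret A: complex_space A by fact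
  interpret B: complex_space B by fact
  show ?thesis using assms(3,4) by (simp add: bilinear_forms_def linear_functional_def)
qed

lemma bilinear_forms_sum:
  "(\<And>i. i \<in> I \<Longrightarrow> \<beta> i \<in> bilinear_forms A B) \<Longrightarrow> (\<lambda>a b. \<Sum>i\<in>I. \<beta> i a b) \<in> bilinear_forms A B"
  by (simp add: bilinear_forms_def linear_functional_sum)

context
  fixes A :: "('a, 'x) star_algebra_scheme" and B :: "('b, 'y) star_algebra_scheme"
  assumes A: "star_algebra A" and B: "star_algebra B"
begin

interpretation A: star_algebra A by (rule A)
interpretation B: star_algebra B by (rule B)

lemma bilinear_forms_mult_left:
  "\<beta> \<in> bilinear_forms A B \<Longrightarrow> a \<in> carrier A \<Longrightarrow> b \<in> carrier B \<Longrightarrow>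
    (\<lambda>c d. \<beta> (a \<otimes>\<^bsub>A\<^esub> c) (b \<otimes>\<^bsub>B\<^esub> d)) \<in> bilinear_forms A B"
  by (simp add: bilinear_forms_def linear_functional_def A.r_distr B.r_distr
        A.smult_mult_r B.smult_mult_r)

lemma bilinear_forms_mult_right:
  "\<beta> \<in> bilinear_forms A B \<Longrightarrow> c \<in> carrier A \<Longrightarrow> d \<in> carrier B \<Longrightarrow>
    (\<lambda>a b. \<beta> (a \<otimes>\<^bsub>A\<^esub> c) (b \<otimes>\<^bsub>B\<^esub> d)) \<in> bilinear_forms A B"
  by (simp add: bilinear_forms_def linear_functional_def A.l_distr B.l_distr
        A.smult_mult_l B.smult_mult_l)

lemma bilinear_forms_star:
  "\<beta> \<in> bilinear_forms A B \<Longrightarrow> (\<lambda>a b. cnj (\<beta> (star A a) (star B b))) \<in> bilinear_forms A B"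
  by (simp add: bilinear_forms_def linear_functional_def A.star_add B.star_add
        A.star_smult B.star_smult A.star_closed B.star_closed)

lemma tensor_mult_rep:
  assumes T: "tensor_rep A B T n x y" and U: "tensor_rep A B U m z w" and \<beta>: "\<beta> \<in> bilinear_forms A B"
  shows "(T \<otimes>\<^bsub>tensor_algebra A B\<^esub> U) \<beta> = (\<Sum>i<n. \<Sum>j<m. \<beta> (x i \<otimes>\<^bsub>A\<^esub> z j) (y i \<otimes>\<^bsub>B\<^esub> w j))"
proof -
  note T = tensor_repD[OF T] and U = tensor_repD[OF U]
  have e: "U (\<lambda>c d. \<beta> (a \<otimes>\<^bsub>A\<^esub> c) (b \<otimes>\<^bsub>B\<^esub> d)) = (\<Sum>j<m. \<beta> (a \<otimes>\<^bsub>A\<^esub> z j) (b \<otimes>\<^bsub>B\<^esub> w j))"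
    if "a \<in> carrier A" "b \<in> carrier B" for a b
    by (rule U(3)[OF bilinear_forms_mult_left[OF \<beta> that]])
  have "(\<lambda>a b. \<Sum>j<m. \<beta> (a \<otimes>\<^bsub>A\<^esub> z j) (b \<otimes>\<^bsub>B\<^esub> w j)) \<in> bilinear_forms A B"
    by (intro bilinear_forms_sum bilinear_forms_mult_right \<beta>) (auto simp: U)
  from bilinear_forms_cong[OF A.complex_space_axioms B.complex_space_axioms this e]
  have "(\<lambda>a b. U (\<lambda>c d. \<beta> (a \<otimes>\<^bsub>A\<^esub> c) (b \<otimes>\<^bsub>B\<^esub> d))) \<in> bilinear_forms A B" .
  then show ?thesis unfolding tensor_mult_eval[OF \<beta>] by (simp add: T e)
qed

lemma tensor_star_rep:
  assumes "tensor_rep A B T n x y"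
  shows "tensor_rep A B (star (tensor_algebra A B) T) n (\<lambda>i. star A (x i)) (\<lambda>i. star B (y i))"
  using tensor_repD[OF assms] bilinear_forms_star
  by (simp add: tensor_rep_def A.star_closed B.star_closed)

lemma tensor_star_mult_self_rep:
  assumes "tensor_rep A B T n x y" "\<beta> \<in> bilinear_forms A B"
  shows "(star (tensor_algebra A B) T \<otimes>\<^bsub>tensor_algebra A B\<^esub> T) \<beta> =
    (\<Sum>i<n. \<Sum>j<n. \<beta> (star A (x i) \<otimes>\<^bsub>A\<^esub> x j) (star B (y i) \<otimes>\<^bsub>B\<^esub> y j))"
  by (rule tensor_mult_rep[OF tensor_star_rep[OF assms(1)] assms])

text \<open>
  A tensor product of positive functionals is positive: writing the Gram matrix of the second
  factors as a sum of squares turns its value at a square into a sum of values of the first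
  functional at squares.
\<close>

lemma product_functional_sum_squares:
  assumes T: "tensor_rep A B T n x y"
    and \<sigma>: "linear_functional A \<sigma>" and \<tau>: "linear_functional B \<tau>"
    and L: "\<forall>i<n. \<forall>j<n. \<tau> (star B (y i) \<otimes>\<^bsub>B\<^esub> y j) = (\<Sum>k<n. cnj (L k i) * L k j)"
  shows "(star (tensor_algebra A B) T \<otimes>\<^bsub>tensor_algebra A B\<^esub> T) (\<lambda>a b. \<sigma> a * \<tau> b) =
      (\<Sum>k<n. \<sigma> (star A (\<Oplus>\<^bsub>A\<^esub>i\<in>{..<n}. L k i \<odot>\<^bsub>A\<^esub> x i) \<otimes>\<^bsub>A\<^esub> (\<Oplus>\<^bsub>A\<^esub>i\<in>{..<n}. L k i \<odot>\<^bsub>A\<^esub> x i)))"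
proof -
  note xy = tensor_repD[OF T]
  have "(star (tensor_algebra A B) T \<otimes>\<^bsub>tensor_algebra A B\<^esub> T) (\<lambda>a b. \<sigma> a * \<tau> b) =
      (\<Sum>i<n. \<Sum>j<n. \<Sum>k<n. cnj (L k i) * L k j * \<sigma> (star A (x i) \<otimes>\<^bsub>A\<^esub> x j))"
    using L by (simp add: tensor_star_mult_self_rep[OF T product_form[OF \<sigma> \<tau>]] sum_distrib_left mult_ac)
  also have "\<dots> = (\<Sum>i<n. \<Sum>k<n. \<Sum>j<n. cnj (L k i) * L k j * \<sigma> (star A (x i) \<otimes>\<^bsub>A\<^esub> x j))"
    by (intro sum.cong refl sum.swap)
  also have "\<dots> = (\<Sum>k<n. \<Sum>i<n. \<Sum>j<n. cnj (L k i) * L k j * \<sigma> (star A (x i) \<otimes>\<^bsub>A\<^esub> x j))"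
    by (rule sum.swap)
  also have "\<dots> = (\<Sum>k<n. \<sigma> (star A (\<Oplus>\<^bsub>A\<^esub>i\<in>{..<n}. L k i \<odot>\<^bsub>A\<^esub> x i) \<otimes>\<^bsub>A\<^esub> (\<Oplus>\<^bsub>A\<^esub>i\<in>{..<n}. L k i \<odot>\<^bsub>A\<^esub> x i)))"
    by (intro sum.cong refl A.functional_star_mult_combination[OF \<sigma>, symmetric]) (simp_all add: xy(1))
  finally show ?thesis .
qed

lemma product_functional_nonneg:
  assumes T: "T \<in> carrier (tensor_algebra A B)"
    and \<sigma>: "positive_functional A \<sigma>" and \<tau>: "positive_functional B \<tau>"
  shows "(star (tensor_algebra A B) T \<otimes>\<^bsub>tensor_algebra A B\<^esub> T) (\<lambda>a b. \<sigma> a * \<tau> b) \<in> \<real>\<^sub>\<ge>\<^sub>0"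
proof -
  obtain n x y where r: "tensor_rep A B T n x y" using tensor_rep_exists[OF T] by blast
  note xy = tensor_repD[OF r]
  have lin: "linear_functional A \<sigma>" "linear_functional B \<tau>"
    using \<sigma> \<tau> by (simp_all add: positive_functional_def)
  obtain L where L: "\<forall>i<n. \<forall>j<n. \<tau> (star B (y i) \<otimes>\<^bsub>B\<^esub> y j) = (\<Sum>k<n. cnj (L k i) * L k j)"
    using B.Gram_decomposition[OF \<tau>, of n y] xy(2) by blast
  have "\<sigma> (star A (\<Oplus>\<^bsub>A\<^esub>i\<in>{..<n}. L k i \<odot>\<^bsub>A\<^esub> x i) \<otimes>\<^bsub>A\<^esub> (\<Oplus>\<^bsub>A\<^esub>i\<in>{..<n}. L k i \<odot>\<^bsub>A\<^esub> x i)) \<in> \<real>\<^sub>\<ge>\<^sub>0" for k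
    using \<sigma> xy(1) by (simp add: positive_functional_def)
  then show ?thesis
    unfolding product_functional_sum_squares[OF r lin L]
    by (simp add: complex_nonneg_Reals_iff sum_nonneg)
qed

text \<open>
  This identifies the kernel of the tensor product of the two quotient maps. Decompose the Gram
  matrix of the second factors for \<tau> as a sum of squares with coefficients L. By hypothesis, the
  combinations of the first factors with the rows of L lie in the Kac ideal of A, so a functional f
  that vanishes there kills them. Hence \<tau> kills the square of the slice of T by f, and this slice
  lies in the Kac ideal of B.
\<close>

lemma tensor_vanish_modulo_kac_ideal:
  assumes T: "T \<in> carrier (tensor_algebra A B)"
    and zero: "\<And>\<sigma> \<tau>. tracial_state A \<sigma> \<Longrightarrow> tracial_state B \<tau> \<Longrightarrow>
      (star (tensor_algebra A B) T \<otimes>\<^bsub>tensor_algebra A B\<^esub> T) (\<lambda>a b. \<sigma> a * \<tau> b) = 0"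
    and \<beta>: "\<beta> \<in> bilinear_forms A B"
    "\<And>a b. a \<in> kac_ideal A \<Longrightarrow> b \<in> carrier B \<Longrightarrow> \<beta> a b = 0"
    "\<And>a b. a \<in> carrier A \<Longrightarrow> b \<in> kac_ideal B \<Longrightarrow> \<beta> a b = 0"
  shows "T \<beta> = 0"
proof (rule tensor_slices_vanish[OF A.complex_space_axioms B.complex_space_axioms
      A.kac_ideal_subspace B.kac_ideal_subspace T \<beta>])
  fix f g assume f: "linear_functional A f" "\<And>a. a \<in> kac_ideal A \<Longrightarrow> f a = 0"
    and g: "linear_functional B g" "\<And>b. b \<in> kac_ideal B \<Longrightarrow> g b = 0"
  obtain n x y where r: "tensor_rep A B T n x y" using tensor_rep_exists[OF T] by blast
  note xy = tensor_repD[OF r]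
  let ?w = "\<Oplus>\<^bsub>B\<^esub>j\<in>{..<n}. f (x j) \<odot>\<^bsub>B\<^esub> y j"
  have "?w \<in> kac_ideal B"
  proof (rule B.kac_idealI)
    show "?w \<in> carrier B" using xy by simp
    fix \<tau> assume \<tau>: "tracial_state B \<tau>"
    obtain L where L: "\<forall>i<n. \<forall>j<n. \<tau> (star B (y i) \<otimes>\<^bsub>B\<^esub> y j) = (\<Sum>k<n. cnj (L k i) * L k j)"
      using B.Gram_decomposition[OF tracial_stateD(3)[OF \<tau>], of n y] xy(2) by blast
    let ?v = "\<lambda>k. \<Oplus>\<^bsub>A\<^esub>i\<in>{..<n}. L k i \<odot>\<^bsub>A\<^esub> x i"
    have vc: "?v k \<in> carrier A" for k using xy by simp
    have v: "?v k \<in> kac_ideal A" if k: "k < n" for k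
    proof (rule A.kac_idealI[OF vc])
      fix \<sigma> assume \<sigma>: "tracial_state A \<sigma>"
      have lin: "linear_functional A \<sigma>" "linear_functional B \<tau>" using \<sigma> \<tau> tracial_stateD by auto
      have "(\<Sum>k<n. Re (\<sigma> (star A (?v k) \<otimes>\<^bsub>A\<^esub> ?v k))) = 0"
        using zero[OF \<sigma> \<tau>] unfolding product_functional_sum_squares[OF r lin L] by (simp flip: Re_sum)
      moreover have nn: "\<sigma> (star A (?v k) \<otimes>\<^bsub>A\<^esub> ?v k) \<in> \<real>\<^sub>\<ge>\<^sub>0" for k
        using tracial_stateD(5)[OF \<sigma> vc] .
      ultimately have "Re (\<sigma> (star A (?v k) \<otimes>\<^bsub>A\<^esub> ?v k)) = 0"
        using k by (subst (asm) sum_nonneg_eq_0_iff) (auto simp: complex_nonneg_Reals_iff)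
      then show "\<sigma> (star A (?v k) \<otimes>\<^bsub>A\<^esub> ?v k) = 0"
        using nn[of k] by (simp add: complex_nonneg_Reals_iff complex_eq_iff)
    qed
    have fv: "(\<Sum>i<n. L k i * f (x i)) = 0" if "k < n" for k
      using f(2)[OF v[OF that]] A.functional_combination[OF f(1), of n x "L k"] xy(1) by simp
    have "\<tau> (star B ?w \<otimes>\<^bsub>B\<^esub> ?w) =
        (\<Sum>i<n. \<Sum>j<n. cnj (f (x i)) * f (x j) * (\<Sum>k<n. cnj (L k i) * L k j))"
      using L xy(2) B.functional_star_mult_combination[OF tracial_stateD(2)[OF \<tau>], of n y n y]
      by simp
    also have "\<dots> = (\<Sum>i<n. \<Sum>j<n. \<Sum>k<n. cnj (L k i * f (x i)) * (L k j * f (x j)))"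
      by (simp add: sum_distrib_left mult_ac)
    also have "\<dots> = (\<Sum>i<n. \<Sum>k<n. \<Sum>j<n. cnj (L k i * f (x i)) * (L k j * f (x j)))"
      by (intro sum.cong refl sum.swap)
    also have "\<dots> = (\<Sum>k<n. \<Sum>i<n. \<Sum>j<n. cnj (L k i * f (x i)) * (L k j * f (x j)))"
      by (rule sum.swap)
    also have "\<dots> = 0" using fv by (simp flip: sum_distrib_left)
    finally show "\<tau> (star B ?w \<otimes>\<^bsub>B\<^esub> ?w) = 0" .
  qed
  from g(2)[OF this] show "T (\<lambda>a b. f a * g b) = 0"
    using xy(3)[OF product_form[OF f(1) g(1)]] B.functional_combination[OF g(1), of n y] xy(2) by simp
qed

end


section \<open>Compact quantum groups through functionals\<close>

context star_algebra
begin

lemma mult_bilinear: "bilinear_map A A A (\<otimes>)"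
  by (auto simp: bilinear_map_def linear_map_def l_distr r_distr smult_mult_l smult_mult_r)

lemma scale_bilinear:
  assumes "linear_functional A g"
  shows scale_left_bilinear: "bilinear_map A A A (\<lambda>x y. g x \<odot> y)"
    and scale_right_bilinear: "bilinear_map A A A (\<lambda>x y. g y \<odot> x)"
  using assms by (auto simp: bilinear_map_def linear_map_def linear_functional_def scale_add_left
      scale_add_right scale_scale mult.commute)

lemma tensor_lift_scale:
  assumes T: "T \<in> carrier (tensor_algebra A A)" and g: "linear_functional A g" and f: "linear_functional A f"
  shows tensor_lift_scale_left: "f (tensor_lift A A A (\<lambda>x y. g x \<odot> y) T) = T (\<lambda>x y. g x * f y)"
    and tensor_lift_scale_right: "f (tensor_lift A A A (\<lambda>x y. g y \<odot> x) T) = T (\<lambda>x y. f x * g y)"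
proof -
  note l = scale_left_bilinear[OF g] and r = scale_right_bilinear[OF g]
  have "T (\<lambda>x y. f (g x \<odot> y)) = T (\<lambda>x y. g x * f y)"
    by (rule tensor_eval_cong[OF T linear_functional_comp_bilinear[OF f l] product_form[OF g f]])
       (simp add: linear_functional_scale[OF f])
  then show "f (tensor_lift A A A (\<lambda>x y. g x \<odot> y) T) = T (\<lambda>x y. g x * f y)"
    by (rule trans[OF tensor_lift_functional[OF complex_space_axioms l T f]])
  have "T (\<lambda>x y. f (g y \<odot> x)) = T (\<lambda>x y. f x * g y)"
    by (rule tensor_eval_cong[OF T linear_functional_comp_bilinear[OF f r] product_form[OF f g]])
       (simp add: linear_functional_scale[OF f])
  then show "f (tensor_lift A A A (\<lambda>x y. g y \<odot> x) T) = T (\<lambda>x y. f x * g y)"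
    by (rule trans[OF tensor_lift_functional[OF complex_space_axioms r T f]])
qed

end

text \<open>
  The counit and the antipode are determined by the comultiplication; as parameters they can be
  named in the statements below.
\<close>

locale cqg = star_algebra P for P :: "('a, 'x) quantum_group_scheme" (structure) +
  fixes \<epsilon> :: "'a \<Rightarrow> complex" and S :: "'a \<Rightarrow> 'a"
  assumes comult_star_hom: "star_hom P (tensor_algebra P P) (comult P)"
    and coassociative: "\<And>a. a \<in> carrier P \<Longrightarrow>
        tensor_assoc P P P (tensor_map P P (tensor_algebra P P) P (comult P) id (comult P a)) =
        tensor_map P P P (tensor_algebra P P) id (comult P) (comult P a)"
    and counit_hom: "\<epsilon> \<in> ring_hom P complex_ring"
    and counit_linear: "linear_functional P \<epsilon>"
    and antipode_linear: "linear_map P P S"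
    and counit_left_lift: "\<And>a. a \<in> carrier P \<Longrightarrow> tensor_lift P P P (\<lambda>x y. \<epsilon> x \<odot> y) (comult P a) = a"
    and counit_right_lift: "\<And>a. a \<in> carrier P \<Longrightarrow> tensor_lift P P P (\<lambda>x y. \<epsilon> y \<odot> x) (comult P a) = a"
    and antipode_left_lift:
      "\<And>a. a \<in> carrier P \<Longrightarrow> tensor_lift P P P (\<lambda>x y. S x \<otimes> y) (comult P a) = \<epsilon> a \<odot> \<one>"
    and antipode_right_lift:
      "\<And>a. a \<in> carrier P \<Longrightarrow> tensor_lift P P P (\<lambda>x y. x \<otimes> S y) (comult P a) = \<epsilon> a \<odot> \<one>"
    and coefficients_span: "\<And>a. a \<in> carrier P \<Longrightarrow>
        \<exists>(m::nat) c x. x \<in> {..<m} \<rightarrow> matrix_coeffs P \<and> a = (\<Oplus>l\<in>{..<m}. c l \<odot> x l)"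

lemma cqg_algebra_iff: "cqg_algebra P \<longleftrightarrow> (\<exists>\<epsilon> S. cqg P \<epsilon> S)"
proof
  assume L: "cqg_algebra P"
  then obtain \<epsilon> S where "\<epsilon> \<in> ring_hom P complex_ring" "linear_functional P \<epsilon>" "linear_map P P S"
    "\<forall>a\<in>carrier P.
           tensor_lift P P P (\<lambda>x y. \<epsilon> x \<odot>\<^bsub>P\<^esub> y) (comult P a) = a \<and>
           tensor_lift P P P (\<lambda>x y. \<epsilon> y \<odot>\<^bsub>P\<^esub> x) (comult P a) = a \<and>
           tensor_lift P P P (\<lambda>x y. S x \<otimes>\<^bsub>P\<^esub> y) (comult P a) = \<epsilon> a \<odot>\<^bsub>P\<^esub> \<one>\<^bsub>P\<^esub> \<and>
           tensor_lift P P P (\<lambda>x y. x \<otimes>\<^bsub>P\<^esub> S y) (comult P a) = \<epsilon> a \<odot>\<^bsub>P\<^esub> \<one>\<^bsub>P\<^esub>"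
    unfolding cqg_algebra_def hopf_star_algebra_def by blast
  then have "cqg P \<epsilon> S"
    using L unfolding cqg_def cqg_axioms_def cqg_algebra_def hopf_star_algebra_def by blast
  then show "\<exists>\<epsilon> S. cqg P \<epsilon> S" by blast
next
  assume "\<exists>\<epsilon> S. cqg P \<epsilon> S"
  then obtain \<epsilon> S where "cqg P \<epsilon> S" by blast
  then have a: "star_algebra P" and b: "cqg_axioms P \<epsilon> S" by (simp_all add: cqg_def)
  note b = b[unfolded cqg_axioms_def]
  have "hopf_star_algebra P"
    unfolding hopf_star_algebra_def using a b by (intro conjI exI[of _ \<epsilon>] exI[of _ S]) blast+
  then show "cqg_algebra P" using b unfolding cqg_algebra_def by blast
qed

lemma unitary_repD:
  assumes "unitary_rep P n u" "star_algebra P"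
  shows "i < n \<Longrightarrow> j < n \<Longrightarrow> u i j \<in> carrier P"
    and "i < n \<Longrightarrow> j < n \<Longrightarrow> \<beta> \<in> bilinear_forms P P \<Longrightarrow>
      comult P (u i j) \<beta> = (\<Sum>k<n. \<beta> (u i k) (u k j))"
    and "i < n \<Longrightarrow> j < n \<Longrightarrow> linear_functional P f \<Longrightarrow>
      (\<Sum>k<n. f (u i k \<otimes>\<^bsub>P\<^esub> star P (u j k))) = (if i = j then f \<one>\<^bsub>P\<^esub> else 0)"
    and "i < n \<Longrightarrow> j < n \<Longrightarrow> linear_functional P f \<Longrightarrow>
      (\<Sum>k<n. f (star P (u k i) \<otimes>\<^bsub>P\<^esub> u k j)) = (if i = j then f \<one>\<^bsub>P\<^esub> else 0)"
proof -
  interpret star_algebra P by fact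
  interpret T: complex_space "tensor_algebra P P" by (rule tensor_algebra_space[OF complex_space_axioms])
  show u: "u i j \<in> carrier P" if "i < n" "j < n" for i j
    using assms(1) that by (simp add: unitary_rep_def)
  show "comult P (u i j) \<beta> = (\<Sum>k<n. \<beta> (u i k) (u k j))"
    if "i < n" "j < n" "\<beta> \<in> bilinear_forms P P"
  proof -
    have "comult P (u i j) = (\<Oplus>\<^bsub>tensor_algebra P P\<^esub>k\<in>{..<n}. elem_tensor P P (u i k) (u k j))"
      using assms(1) that by (simp add: unitary_rep_def)
    then show ?thesis
      using T.linear_functional_finsum[OF tensor_eval_linear[OF that(3)], of "{..<n}"] u that
      by simp
  qed
  show "(\<Sum>k<n. f (u i k \<otimes>\<^bsub>P\<^esub> star P (u j k))) = (if i = j then f \<one>\<^bsub>P\<^esub> else 0)"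
    if "i < n" "j < n" "linear_functional P f"
  proof -
    have "(\<Oplus>\<^bsub>P\<^esub>k\<in>{..<n}. u i k \<otimes>\<^bsub>P\<^esub> star P (u j k)) = (if i = j then \<one>\<^bsub>P\<^esub> else \<zero>\<^bsub>P\<^esub>)"
      using assms(1) that by (simp add: unitary_rep_def)
    then show ?thesis
      using linear_functional_finsum[OF that(3), of "{..<n}" "\<lambda>k. u i k \<otimes>\<^bsub>P\<^esub> star P (u j k)"] u that
      by (simp add: star_closed linear_functional_zero[OF that(3)] split: if_splits)
  qed
  show "(\<Sum>k<n. f (star P (u k i) \<otimes>\<^bsub>P\<^esub> u k j)) = (if i = j then f \<one>\<^bsub>P\<^esub> else 0)"
    if "i < n" "j < n" "linear_functional P f"
  proof -
    have "(\<Oplus>\<^bsub>P\<^esub>k\<in>{..<n}. star P (u k i) \<otimes>\<^bsub>P\<^esub> u k j) = (if i = j then \<one>\<^bsub>P\<^esub> else \<zero>\<^bsub>P\<^esub>)"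
      using assms(1) that by (simp add: unitary_rep_def)
    then show ?thesis
      using linear_functional_finsum[OF that(3), of "{..<n}" "\<lambda>k. star P (u k i) \<otimes>\<^bsub>P\<^esub> u k j"] u that
      by (simp add: star_closed linear_functional_zero[OF that(3)] split: if_splits)
  qed
qed

definition convolve ::
  "('a, 'x) quantum_group_scheme \<Rightarrow> ('a \<Rightarrow> complex) \<Rightarrow> ('a \<Rightarrow> complex) \<Rightarrow> 'a \<Rightarrow> complex" where
  "convolve P \<sigma> \<tau> a = comult P a (\<lambda>x y. \<sigma> x * \<tau> y)"

context cqg
begin

lemma comult_closed [simp]: "a \<in> carrier P \<Longrightarrow> comult P a \<in> carrier (tensor_algebra P P)"
  using comult_star_hom by (auto simp: star_hom_def linear_map_def)

lemma comult_linear: "\<beta> \<in> bilinear_forms P P \<Longrightarrow> linear_functional P (\<lambda>a. comult P a \<beta>)"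
  using comult_star_hom by (auto simp: star_hom_def linear_map_def linear_functional_def)

lemma comult_one: "\<beta> \<in> bilinear_forms P P \<Longrightarrow> comult P \<one> \<beta> = \<beta> \<one> \<one>"
  using ring_hom_one[of "comult P" P "tensor_algebra P P"] comult_star_hom
  by (simp add: star_hom_def)

lemma comult_mult: "a \<in> carrier P \<Longrightarrow> b \<in> carrier P \<Longrightarrow>
    comult P (a \<otimes> b) = comult P a \<otimes>\<^bsub>tensor_algebra P P\<^esub> comult P b"
  using ring_hom_mult[of "comult P" P "tensor_algebra P P"] comult_star_hom
  by (simp add: star_hom_def)

lemma comult_star: "a \<in> carrier P \<Longrightarrow> comult P (star P a) = star (tensor_algebra P P) (comult P a)"
  using comult_star_hom by (simp add: star_hom_def)

lemma counit_one: "\<epsilon> \<one> = 1"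
  using ring_hom_one[OF counit_hom] by simp

lemma counit_mult: "a \<in> carrier P \<Longrightarrow> b \<in> carrier P \<Longrightarrow> \<epsilon> (a \<otimes> b) = \<epsilon> a * \<epsilon> b"
  using ring_hom_mult[OF counit_hom] by simp

lemma antipode_closed [simp]: "a \<in> carrier P \<Longrightarrow> S a \<in> carrier P"
  using antipode_linear by (auto simp: linear_map_def)

lemma linear_functional_antipode: "linear_functional P f \<Longrightarrow> linear_functional P (\<lambda>a. f (S a))"
  using antipode_linear by (rule linear_functional_comp[rotated])

lemma counit_left:
  assumes "a \<in> carrier P" "linear_functional P f"
  shows "comult P a (\<lambda>x y. \<epsilon> x * f y) = f a"
  using tensor_lift_scale_left[OF comult_closed[OF assms(1)] counit_linear assms(2)]
  by (simp add: counit_left_lift[OF assms(1)])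

lemma counit_right:
  assumes "a \<in> carrier P" "linear_functional P f"
  shows "comult P a (\<lambda>x y. f x * \<epsilon> y) = f a"
  using tensor_lift_scale_right[OF comult_closed[OF assms(1)] counit_linear assms(2)]
  by (simp add: counit_right_lift[OF assms(1)])

lemma antipode_left_bilinear: "bilinear_map P P P (\<lambda>x y. S x \<otimes> y)"
  using bilinear_map_comp[OF antipode_linear _ mult_bilinear, of P "\<lambda>y. y"] by (simp add: linear_map_def)

lemma antipode_right_bilinear: "bilinear_map P P P (\<lambda>x y. x \<otimes> S y)"
  using bilinear_map_comp[OF _ antipode_linear mult_bilinear, of P "\<lambda>x. x"] by (simp add: linear_map_def)

lemma antipode_left:
  assumes "a \<in> carrier P" "linear_functional P f"
  shows "comult P a (\<lambda>x y. f (S x \<otimes> y)) = \<epsilon> a * f \<one>"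
  using tensor_lift_functional[OF complex_space_axioms antipode_left_bilinear comult_closed[OF assms(1)] assms(2)]
  by (simp add: antipode_left_lift[OF assms(1)] linear_functional_scale[OF assms(2)])

lemma antipode_right:
  assumes "a \<in> carrier P" "linear_functional P f"
  shows "comult P a (\<lambda>x y. f (x \<otimes> S y)) = \<epsilon> a * f \<one>"
  using tensor_lift_functional[OF complex_space_axioms antipode_right_bilinear comult_closed[OF assms(1)] assms(2)]
  by (simp add: antipode_right_lift[OF assms(1)] linear_functional_scale[OF assms(2)])

lemmas unitary_closed [simp] = unitary_repD(1)[OF _ star_algebra_axioms]
lemmas comult_unitary = unitary_repD(2)[OF _ star_algebra_axioms]
lemmas unitary_right = unitary_repD(3)[OF _ star_algebra_axioms]
lemmas unitary_left = unitary_repD(4)[OF _ star_algebra_axioms]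

text \<open>
  Most facts about P reduce, by linearity, to entries of unitary representations.
\<close>

lemma coefficient_induct [consumes 1, case_names coefficient zero add scale]:
  assumes a: "a \<in> carrier P"
    and "\<And>n u i j. unitary_rep P n u \<Longrightarrow> i < n \<Longrightarrow> j < n \<Longrightarrow> Q (u i j)"
    and "Q \<zero>"
    and "\<And>a b. a \<in> carrier P \<Longrightarrow> b \<in> carrier P \<Longrightarrow> Q a \<Longrightarrow> Q b \<Longrightarrow> Q (a \<oplus> b)"
    and "\<And>k a. a \<in> carrier P \<Longrightarrow> Q a \<Longrightarrow> Q (k \<odot> a)"
  shows "Q a"
proof -
  obtain m :: nat and c x where x: "x \<in> {..<m} \<rightarrow> matrix_coeffs P" "a = (\<Oplus>l\<in>{..<m}. c l \<odot> x l)"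
    using coefficients_span[OF a] by blast
  have mem: "x l \<in> carrier P" "Q (x l)" if "l < m" for l
  proof -
    have "x l \<in> matrix_coeffs P" using x(1) that by auto
    then obtain u n i j where "unitary_rep P n u" "i < n" "j < n" "x l = u i j"
      by (auto simp: matrix_coeffs_def)
    then show "x l \<in> carrier P" "Q (x l)" using assms(2)[of n u i j] by simp_all
  qed
  have "(\<Oplus>l\<in>I. c l \<odot> x l) \<in> carrier P \<and> Q (\<Oplus>l\<in>I. c l \<odot> x l)" if "finite I" "I \<subseteq> {..<m}" for I
    using that
  proof (induction I)
    case empty
    then show ?case using assms(3) by simp
  next
    case (insert l I)
    then have "(\<lambda>l. c l \<odot> x l) \<in> I \<rightarrow> carrier P" "x l \<in> carrier P" "Q (x l)" using mem by auto
    then show ?case using insert assms(4,5) by simp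
  qed
  from this[of "{..<m}"] show ?thesis using x(2) by simp
qed

text \<open>
  Let E be the matrix of values of the counit on u. The counit law says that E times u is u, and u
  can be cancelled on the right by its adjoint.
\<close>

lemma counit_unitary:
  assumes u: "unitary_rep P n u" and i: "i < n" and l: "l < n"
  shows "\<epsilon> (u i l) = (if i = l then 1 else 0)"
proof -
  have lin: "linear_functional P (\<lambda>z. \<epsilon> (z \<otimes> star P (u l j)))" if "j < n" for j
    using linear_functional_mult_right[OF counit_linear] u l that by (simp add: star_closed)
  have "(\<Sum>k<n. \<epsilon> (u i k) * \<epsilon> (u k j \<otimes> star P (u l j))) = \<epsilon> (u i j \<otimes> star P (u l j))" if j: "j < n" for j
    using counit_left[OF unitary_closed[OF u i j] lin[OF j]]
    by (simp add: comult_unitary[OF u i j product_form[OF counit_linear lin[OF j]]])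
  then have "(\<Sum>j<n. \<epsilon> (u i j \<otimes> star P (u l j))) = (\<Sum>j<n. \<Sum>k<n. \<epsilon> (u i k) * \<epsilon> (u k j \<otimes> star P (u l j)))"
    by simp
  also have "\<dots> = (\<Sum>k<n. \<epsilon> (u i k) * (\<Sum>j<n. \<epsilon> (u k j \<otimes> star P (u l j))))"
    by (subst sum.swap) (simp add: sum_distrib_left)
  also have "\<dots> = \<epsilon> (u i l)"
    using unitary_right[OF u _ l counit_linear] l
    by (simp add: counit_one if_distrib[of "\<lambda>c. _ * c"] cong: if_cong)
  finally show ?thesis
    using unitary_right[OF u i l counit_linear] by (simp add: counit_one split: if_splits)
qed

text \<open>
  The antipode law makes the matrix S(u) a left inverse of u, while the adjoint of u is a right
  inverse.
\<close>

lemma antipode_unitary: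
  assumes u: "unitary_rep P n u" and i: "i < n" and l: "l < n"
  shows "S (u i l) = star P (u l i)"
proof (rule eqI_functional)
  show "S (u i l) \<in> carrier P" "star P (u l i) \<in> carrier P" using u i l by (simp_all add: star_closed)
  fix f assume f: "linear_functional P f"
  have lin: "linear_functional P (\<lambda>z. f (z \<otimes> star P (u l j)))" if "j < n" for j
    using linear_functional_mult_right[OF f] u l that by (simp add: star_closed)
  have "(\<Sum>k<n. f (S (u i k) \<otimes> u k j \<otimes> star P (u l j))) = \<epsilon> (u i j) * f (star P (u l j))" if j: "j < n" for j
    using antipode_left[OF unitary_closed[OF u i j] lin[OF j]] u l j
    by (simp add: comult_unitary[OF u i j linear_functional_comp_bilinear[OF lin[OF j] antipode_left_bilinear]]
        star_closed)
  then have "(\<Sum>j<n. \<Sum>k<n. f (S (u i k) \<otimes> u k j \<otimes> star P (u l j))) = (\<Sum>j<n. \<epsilon> (u i j) * f (star P (u l j)))"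
    by simp
  also have "\<dots> = f (star P (u l i))"
    using counit_unitary[OF u i] i by (simp add: if_distrib[of "\<lambda>c. c * _"] cong: if_cong)
  also have "(\<Sum>j<n. \<Sum>k<n. f (S (u i k) \<otimes> u k j \<otimes> star P (u l j))) =
      (\<Sum>k<n. \<Sum>j<n. f (S (u i k) \<otimes> (u k j \<otimes> star P (u l j))))"
    using u i l by (subst sum.swap) (simp add: m_assoc star_closed)
  also have "\<dots> = (\<Sum>k<n. if k = l then f (S (u i k)) else 0)"
  proof (rule sum.cong[OF refl])
    fix k assume k: "k \<in> {..<n}"
    have "linear_functional P (\<lambda>z. f (S (u i k) \<otimes> z))"
      using linear_functional_mult_left[OF f] u i k by simp
    from unitary_right[OF u _ l this] k u i
    show "(\<Sum>j<n. f (S (u i k) \<otimes> (u k j \<otimes> star P (u l j)))) = (if k = l then f (S (u i k)) else 0)"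
      by simp
  qed
  also have "\<dots> = f (S (u i l))" using l by simp
  finally show "f (S (u i l)) = f (star P (u l i))" .
qed

lemma counit_star: "a \<in> carrier P \<Longrightarrow> \<epsilon> (star P a) = cnj (\<epsilon> a)"
proof (induction rule: coefficient_induct)
  case (coefficient n u i j)
  note u = coefficient(1)
  have "(\<Sum>k<n. \<epsilon> (u j k) * \<epsilon> (star P (u i k))) = (if j = i then 1 else 0)"
    using unitary_right[OF u coefficient(3,2) counit_linear] u coefficient
    by (simp add: counit_mult star_closed counit_one)
  also have "(\<Sum>k<n. \<epsilon> (u j k) * \<epsilon> (star P (u i k))) = (\<Sum>k<n. if k = j then \<epsilon> (star P (u i k)) else 0)"
    by (intro sum.cong refl) (simp add: counit_unitary[OF u coefficient(3)])
  finally show ?case using coefficient(3) by (simp add: counit_unitary[OF u coefficient(2,3)] split: if_splits)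
next
  case zero
  then show ?case by (simp add: star_zero linear_functional_zero[OF counit_linear])
next
  case (add a b)
  then show ?case by (simp add: star_add star_closed linear_functional_add[OF counit_linear])
next
  case (scale k a)
  then show ?case by (simp add: star_smult star_closed linear_functional_scale[OF counit_linear])
qed

text \<open>
  In particular tracial states exist, and the counit factors through the quotient by the Kac ideal.
\<close>

lemma counit_tracial_state: "tracial_state P \<epsilon>"
proof -
  have "\<epsilon> (star P x \<otimes> x) \<in> \<real>\<^sub>\<ge>\<^sub>0" if "x \<in> carrier P" for x
    using that by (simp add: counit_mult counit_star star_closed complex_nonneg_Reals_iff)
  then show ?thesis
    using counit_linear by (simp add: tracial_state_def state_def tracial_def counit_one counit_mult)
qed

text \<open>
  The products of entries of u and w are the entries of a unitary representation, the tensor product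
  of u and w, so the argument for a single representation applies: S provides a left inverse and the
  adjoint a right inverse.
\<close>

lemma antipode_mult_unitary:
  assumes u: "unitary_rep P n u" and w: "unitary_rep P m w"
    and i: "i < n" and s: "s < n" and k: "k < m" and t: "t < m"
  shows "S (u i s \<otimes> w k t) = star P (w t k) \<otimes> star P (u s i)"
proof (rule eqI_functional)
  show "S (u i s \<otimes> w k t) \<in> carrier P" "star P (w t k) \<otimes> star P (u s i) \<in> carrier P"
    using u w i s k t by (simp_all add: star_closed)
  fix f assume f: "linear_functional P f"
  define g where "g j l z = f (z \<otimes> (star P (w t l) \<otimes> star P (u s j)))" for j l z
  have lin: "linear_functional P (g j l)" if "j < n" "l < m" for j l
    unfolding g_def[abs_def]
    using linear_functional_mult_right[OF f] u w s t that by (simp add: star_closed)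
  have "(\<Sum>p<n. \<Sum>q<m. g j l (S (u i p \<otimes> w k q) \<otimes> (u p j \<otimes> w q l))) = \<epsilon> (u i j) * \<epsilon> (w k l) * g j l \<one>"
    if j: "j < n" and l: "l < m" for j l
  proof -
    let ?\<beta> = "\<lambda>x y. g j l (S x \<otimes> y)"
    have \<beta>: "?\<beta> \<in> bilinear_forms P P"
      by (rule linear_functional_comp_bilinear[OF lin[OF j l] antipode_left_bilinear])
    have r1: "tensor_rep P P (comult P (u i j)) n (\<lambda>p. u i p) (\<lambda>p. u p j)"
      using u i j by (simp add: tensor_rep_def comult_unitary[OF u i j])
    have r2: "tensor_rep P P (comult P (w k l)) m (\<lambda>q. w k q) (\<lambda>q. w q l)"
      using w k l by (simp add: tensor_rep_def comult_unitary[OF w k l])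
    have "comult P (u i j \<otimes> w k l) ?\<beta> = (\<Sum>p<n. \<Sum>q<m. ?\<beta> (u i p \<otimes> w k q) (u p j \<otimes> w q l))"
      using u w i j k l
      by (simp add: comult_mult tensor_mult_rep[OF star_algebra_axioms star_algebra_axioms r1 r2 \<beta>])
    then show ?thesis
      using antipode_left[OF _ lin[OF j l], of "u i j \<otimes> w k l"] u w i j k l by (simp add: counit_mult)
  qed
  then have "(\<Sum>j<n. \<Sum>l<m. \<Sum>p<n. \<Sum>q<m. g j l (S (u i p \<otimes> w k q) \<otimes> (u p j \<otimes> w q l))) =
      (\<Sum>j<n. \<Sum>l<m. \<epsilon> (u i j) * \<epsilon> (w k l) * g j l \<one>)" by simp
  also have "\<dots> = (\<Sum>j<n. \<epsilon> (u i j) * (\<Sum>l<m. \<epsilon> (w k l) * g j l \<one>))"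
    by (simp add: sum_distrib_left mult.assoc)
  also have "\<dots> = g i k \<one>"
  proof -
    have "(\<Sum>l<m. \<epsilon> (w k l) * h l) = h k" for h :: "nat \<Rightarrow> complex"
      using counit_unitary[OF w k] k by (simp add: if_distrib[of "\<lambda>c. c * _"] cong: if_cong)
    moreover have "(\<Sum>j<n. \<epsilon> (u i j) * h j) = h i" for h :: "nat \<Rightarrow> complex"
      using counit_unitary[OF u i] i by (simp add: if_distrib[of "\<lambda>c. c * _"] cong: if_cong)
    ultimately show ?thesis by simp
  qed
  also have "(\<Sum>j<n. \<Sum>l<m. \<Sum>p<n. \<Sum>q<m. g j l (S (u i p \<otimes> w k q) \<otimes> (u p j \<otimes> w q l))) =
      (\<Sum>p<n. \<Sum>q<m. \<Sum>j<n. \<Sum>l<m. g j l (S (u i p \<otimes> w k q) \<otimes> (u p j \<otimes> w q l)))"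
  proof -
    have "(\<Sum>j<n. \<Sum>l<m. \<Sum>p<n. \<Sum>q<m. h j l p q) = (\<Sum>p<n. \<Sum>q<m. \<Sum>j<n. \<Sum>l<m. h j l p q)"
      for h :: "nat \<Rightarrow> nat \<Rightarrow> nat \<Rightarrow> nat \<Rightarrow> complex"
    proof -
      have "(\<Sum>j<n. \<Sum>l<m. \<Sum>p<n. \<Sum>q<m. h j l p q) = (\<Sum>j<n. \<Sum>p<n. \<Sum>l<m. \<Sum>q<m. h j l p q)"
        by (rule sum.cong[OF refl], rule sum.swap)
      also have "\<dots> = (\<Sum>j<n. \<Sum>p<n. \<Sum>q<m. \<Sum>l<m. h j l p q)"
        by (rule sum.cong[OF refl], rule sum.cong[OF refl], rule sum.swap)
      also have "\<dots> = (\<Sum>p<n. \<Sum>j<n. \<Sum>q<m. \<Sum>l<m. h j l p q)" by (rule sum.swap)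
      also have "\<dots> = (\<Sum>p<n. \<Sum>q<m. \<Sum>j<n. \<Sum>l<m. h j l p q)"
        by (rule sum.cong[OF refl], rule sum.swap)
      finally show ?thesis .
    qed
    then show ?thesis .
  qed
  also have "\<dots> = (\<Sum>p<n. if p = s then (\<Sum>q<m. if q = t then f (S (u i p \<otimes> w k q)) else 0) else 0)"
  proof (rule sum.cong[OF refl])
    fix p assume "p \<in> {..<n}" then have p: "p < n" by simp
    have "(\<Sum>j<n. \<Sum>l<m. g j l (S (u i p \<otimes> w k q) \<otimes> (u p j \<otimes> w q l))) =
        (if p = s then if q = t then f (S (u i p \<otimes> w k q)) else 0 else 0)" if q: "q < m" for q
    proof -
      let ?z = "S (u i p \<otimes> w k q)"
      have z: "?z \<in> carrier P" using u w i p k q by simp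
      have "(\<Sum>l<m. g j l (?z \<otimes> (u p j \<otimes> w q l))) = (if q = t then f (?z \<otimes> (u p j \<otimes> star P (u s j))) else 0)"
        if j: "j < n" for j
      proof -
        have "linear_functional P (\<lambda>y. f (?z \<otimes> u p j \<otimes> y \<otimes> star P (u s j)))"
          using linear_functional_mult_left[OF linear_functional_mult_right[OF f], of "star P (u s j)" "?z \<otimes> u p j"]
            z u p s j by (simp add: star_closed)
        from unitary_right[OF w q t this] show ?thesis
          using z u w p q s t j by (cases "q = t") (simp_all add: g_def m_assoc star_closed)
      qed
      then have "(\<Sum>j<n. \<Sum>l<m. g j l (?z \<otimes> (u p j \<otimes> w q l))) =
          (if q = t then \<Sum>j<n. f (?z \<otimes> (u p j \<otimes> star P (u s j))) else 0)" by simp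
      also have "(\<Sum>j<n. f (?z \<otimes> (u p j \<otimes> star P (u s j)))) = (if p = s then f ?z else 0)"
        using unitary_right[OF u p s linear_functional_mult_left[OF f z]] z
          by (cases "p = s") simp_all
      finally show ?thesis by simp
    qed
    then show "(\<Sum>q<m. \<Sum>j<n. \<Sum>l<m. g j l (S (u i p \<otimes> w k q) \<otimes> (u p j \<otimes> w q l))) =
        (if p = s then (\<Sum>q<m. if q = t then f (S (u i p \<otimes> w k q)) else 0) else 0)"
      by simp
  qed
  also have "\<dots> = f (S (u i s \<otimes> w k t))" using s t by simp
  finally show "f (S (u i s \<otimes> w k t)) = f (star P (w t k) \<otimes> star P (u s i))"
    using u w i s k t by (simp add: g_def star_closed)
qed

lemma antipode_add: "a \<in> carrier P \<Longrightarrow> b \<in> carrier P \<Longrightarrow> S (a \<oplus> b) = S a \<oplus> S b"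
  using antipode_linear by (simp add: linear_map_def)

lemma antipode_scale: "a \<in> carrier P \<Longrightarrow> S (k \<odot> a) = k \<odot> S a"
  using antipode_linear by (simp add: linear_map_def)

lemma antipode_zero: "S \<zero> = \<zero>"
  using antipode_scale[of \<zero> 0] by simp

lemma antipode_mult:
  assumes "a \<in> carrier P" "b \<in> carrier P"
  shows "S (a \<otimes> b) = S b \<otimes> S a"
  using assms(1)
proof (induction rule: coefficient_induct)
  case (coefficient n u i s)
  note u = coefficient
  show ?case using assms(2)
  proof (induction rule: coefficient_induct)
    case (coefficient m w k t)
    then show ?case
      using u by (simp add: antipode_mult_unitary antipode_unitary)
  qed (use u in \<open>simp_all add: antipode_zero r_distr l_distr antipode_add smult_mult_r smult_mult_l antipode_scale\<close>)
qed (use assms(2) in \<open>simp_all add: antipode_zero r_distr l_distr antipode_add smult_mult_r smult_mult_l antipode_scale\<close>)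

lemma state_unitary_le_1:
  assumes \<tau>: "state P \<tau>" and u: "unitary_rep P n u" and i: "i < n" and j: "j < n"
  shows "cmod (\<tau> (u i j)) \<le> 1"
proof -
  have lin: "linear_functional P \<tau>" and nn: "\<And>x. x \<in> carrier P \<Longrightarrow> \<tau> (star P x \<otimes> x) \<in> \<real>\<^sub>\<ge>\<^sub>0"
    using \<tau> by (auto simp: state_def)
  have "(cmod (\<tau> (u i j)))\<^sup>2 \<le> Re (\<tau> (star P (u i j) \<otimes> u i j))"
    by (rule state_norm_le[OF \<tau>]) (use u i j in simp)
  also have "\<dots> \<le> (\<Sum>k<n. Re (\<tau> (star P (u k j) \<otimes> u k j)))"
    using i nn u j by (intro member_le_sum) (auto simp: complex_nonneg_Reals_iff)
  also have "\<dots> = Re (\<Sum>k<n. \<tau> (star P (u k j) \<otimes> u k j))" by simp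
  also have "\<dots> = 1" using unitary_left[OF u j j lin] \<tau> by (simp add: state_def)
  finally show ?thesis by (simp add: power_le_one_iff abs_square_le_1)
qed

lemma state_bounded: "a \<in> carrier P \<Longrightarrow> \<exists>K. \<forall>\<tau>. state P \<tau> \<longrightarrow> cmod (\<tau> a) \<le> K"
proof (induction rule: coefficient_induct)
  case (coefficient n u i j)
  then show ?case using state_unitary_le_1 by blast
next
  case zero
  then show ?case by (auto simp: state_def linear_functional_zero intro: exI[of _ 0])
next
  case (add a b)
  then obtain K L where "\<forall>\<tau>. state P \<tau> \<longrightarrow> cmod (\<tau> a) \<le> K" "\<forall>\<tau>. state P \<tau> \<longrightarrow> cmod (\<tau> b) \<le> L" by blast
  then show ?case using add
    by (auto simp: state_def linear_functional_add intro!: exI[of _ "K + L"] norm_triangle_mono)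
next
  case (scale k a)
  then obtain K where "\<forall>\<tau>. state P \<tau> \<longrightarrow> cmod (\<tau> a) \<le> K" by blast
  then show ?case using scale
    by (auto simp: state_def linear_functional_scale norm_mult intro!: exI[of _ "cmod k * K"] mult_left_mono)
qed

text \<open>
  The comultiplication is a *-homomorphism, so it suffices that the product functional on the tensor
  square is positive on squares and tracial.
\<close>

lemma convolve_tracial_state:
  assumes \<sigma>: "tracial_state P \<sigma>" and \<tau>: "tracial_state P \<tau>"
  shows "tracial_state P (convolve P \<sigma> \<tau>)"
proof -
  let ?\<beta> = "\<lambda>x y. \<sigma> x * \<tau> y"
  note s = tracial_stateD[OF \<sigma>] and t = tracial_stateD[OF \<tau>]
  have \<beta>: "?\<beta> \<in> bilinear_forms P P" using s t by (intro product_form)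
  have "convolve P \<sigma> \<tau> (star P x \<otimes> x) \<in> \<real>\<^sub>\<ge>\<^sub>0" if "x \<in> carrier P" for x
    using product_functional_nonneg[OF star_algebra_axioms star_algebra_axioms comult_closed[OF that] s(3) t(3)]
    by (simp add: convolve_def comult_mult comult_star star_closed that)
  moreover have "convolve P \<sigma> \<tau> (a \<otimes> b) = convolve P \<sigma> \<tau> (b \<otimes> a)"
    if a: "a \<in> carrier P" and b: "b \<in> carrier P" for a b
  proof -
    obtain n x y where r: "tensor_rep P P (comult P a) n x y"
      using tensor_rep_exists[OF comult_closed[OF a]] by blast
    obtain m z w where q: "tensor_rep P P (comult P b) m z w"
      using tensor_rep_exists[OF comult_closed[OF b]] by blast
    have "(\<Sum>i<n. \<Sum>j<m. \<sigma> (x i \<otimes> z j) * \<tau> (y i \<otimes> w j)) = (\<Sum>i<n. \<Sum>j<m. \<sigma> (z j \<otimes> x i) * \<tau> (w j \<otimes> y i))"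
      using tensor_repD(1,2)[OF r] tensor_repD(1,2)[OF q]
      by (intro sum.cong refl arg_cong2[of _ _ _ _ "(*)"] s(6) t(6)) auto
    also have "\<dots> = (\<Sum>j<m. \<Sum>i<n. \<sigma> (z j \<otimes> x i) * \<tau> (w j \<otimes> y i))" by (rule sum.swap)
    finally show ?thesis
      by (simp add: convolve_def comult_mult[OF a b] comult_mult[OF b a] del: tensor_mult_eval
          add: tensor_mult_rep[OF star_algebra_axioms star_algebra_axioms r q \<beta>]
          tensor_mult_rep[OF star_algebra_axioms star_algebra_axioms q r \<beta>])
  qed
  moreover have "linear_functional P (convolve P \<sigma> \<tau>)"
    using comult_linear[OF \<beta>] by (simp add: convolve_def[abs_def])
  moreover have "convolve P \<sigma> \<tau> \<one> = 1"
    using comult_one[OF \<beta>] s t by (simp add: convolve_def)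
  ultimately show ?thesis by (simp add: tracial_state_def state_def tracial_def)
qed

lemma convolve_unitary:
  assumes "linear_functional P \<sigma>" "linear_functional P \<tau>" "unitary_rep P n u" "i < n" "j < n"
  shows "convolve P \<sigma> \<tau> (u i j) = (\<Sum>k<n. \<sigma> (u i k) * \<tau> (u k j))"
  using comult_unitary[OF assms(3-5) product_form[OF assms(1,2)]] by (simp add: convolve_def)

text \<open>The Kac ideal is a coideal because convolutions of tracial states are again tracial.\<close>

lemma comult_kac_ideal:
  assumes a: "a \<in> kac_ideal P" and \<beta>: "\<beta> \<in> bilinear_forms P P"
    "\<And>a b. a \<in> kac_ideal P \<Longrightarrow> b \<in> carrier P \<Longrightarrow> \<beta> a b = 0"
    "\<And>a b. a \<in> carrier P \<Longrightarrow> b \<in> kac_ideal P \<Longrightarrow> \<beta> a b = 0"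
  shows "comult P a \<beta> = 0"
proof (rule tensor_vanish_modulo_kac_ideal[OF star_algebra_axioms star_algebra_axioms _ _ \<beta>])
  have ac: "a \<in> carrier P" by (rule kac_ideal_closed[OF a])
  then show "comult P a \<in> carrier (tensor_algebra P P)" by simp
  fix \<sigma> \<tau> assume "tracial_state P \<sigma>" "tracial_state P \<tau>"
  then have "convolve P \<sigma> \<tau> (star P a \<otimes> a) = 0"
    using kac_idealD(4)[OF a] convolve_tracial_state by blast
  then show "(star (tensor_algebra P P) (comult P a) \<otimes>\<^bsub>tensor_algebra P P\<^esub> comult P a)
      (\<lambda>a b. \<sigma> a * \<tau> b) = 0"
    using ac by (simp add: convolve_def comult_mult comult_star star_closed)
qed

end


section \<open>A tracial Haar state modulo the Kac ideal\<close>

lemma closed_Collect_Ball: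
  "(\<And>x. x \<in> X \<Longrightarrow> closed {\<tau>. R x \<tau>}) \<Longrightarrow> closed {\<tau>. \<forall>x\<in>X. R x \<tau>}"
  by (simp add: Collect_ball_eq closed_INT)

context cqg
begin

text \<open>
  Functionals are taken to be 0 off the carrier, so that they lie in a product of discs and points,
  which is compact by Tychonoff's theorem. The conditions on a tracial state are closed in the
  product topology because each of them involves finitely many coordinates.
\<close>

lemma compact_tracial_states: "compact {\<tau>. tracial_state P \<tau> \<and> (\<forall>a. a \<notin> carrier P \<longrightarrow> \<tau> a = 0)}"
  (is "compact ?T")
proof -
  obtain K where K: "\<And>a \<tau>. a \<in> carrier P \<Longrightarrow> state P \<tau> \<Longrightarrow> cmod (\<tau> a) \<le> K a"
    using state_bounded by metis
  define D where "D a = (if a \<in> carrier P then cball (0::complex) (K a) else {0})" for a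
  have "compactin (product_topology (\<lambda>_. euclidean) UNIV) (PiE UNIV D)"
    unfolding compactin_PiE by (auto simp: D_def)
  then have comp: "compact (PiE UNIV D)" by (simp add: euclidean_product_topology)
  have ev: "continuous_on UNIV (\<lambda>\<tau>::'a \<Rightarrow> complex. \<tau> a)" for a by simp
  have "closed {\<tau>::'a \<Rightarrow> complex. (\<forall>x\<in>carrier P. \<forall>y\<in>carrier P. \<tau> (x \<oplus> y) = \<tau> x + \<tau> y) \<and>
      (\<forall>k. \<forall>x\<in>carrier P. \<tau> (k \<odot> x) = k * \<tau> x) \<and> \<tau> \<one> = 1 \<and>
      (\<forall>x\<in>carrier P. 0 \<le> Re (\<tau> (star P x \<otimes> x)) \<and> Im (\<tau> (star P x \<otimes> x)) = 0) \<and>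
      (\<forall>x\<in>carrier P. \<forall>y\<in>carrier P. \<tau> (x \<otimes> y) = \<tau> (y \<otimes> x)) \<and> (\<forall>a\<in>-carrier P. \<tau> a = 0)}"
    by (intro closed_Collect_conj closed_Collect_Ball closed_Collect_all closed_Collect_eq
        closed_Collect_le continuous_intros ev)
  also have "\<dots> = ?T"
    by (auto simp: tracial_state_def state_def tracial_def linear_functional_def complex_nonneg_Reals_iff)
  finally have "closed ?T" .
  moreover have "?T \<subseteq> PiE UNIV D"
    using K by (auto simp: D_def tracial_state_def)
  ultimately show ?thesis using compact_Int_closed[OF comp, of ?T] by (simp add: Int_absorb1)
qed

lemma tracial_state_midpoint:
  assumes "tracial_state P \<sigma>" "tracial_state P \<tau>"
  shows "tracial_state P (\<lambda>a. (1/2) * \<sigma> a + (1/2) * \<tau> a)"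
proof -
  note s = tracial_stateD[OF assms(1)] and t = tracial_stateD[OF assms(2)]
  have "(1/2) * \<sigma> (star P x \<otimes> x) + (1/2) * \<tau> (star P x \<otimes> x) \<in> \<real>\<^sub>\<ge>\<^sub>0" if "x \<in> carrier P" for x
    using s(5)[OF that] t(5)[OF that] by (simp add: complex_nonneg_Reals_iff)
  then show ?thesis
    using s(4,6) t(4,6) linear_functional_combine[OF s(2) t(2), of "1/2" "1/2"]
    by (simp add: tracial_state_def state_def tracial_def)
qed

text \<open>
  Applying the unitary matrix u to the vector z preserves its length, seen by \<tau>.
\<close>

lemma unitary_row_norm:
  assumes u: "unitary_rep P n u" and \<tau>: "linear_functional P \<tau>" "\<tau> \<one> = 1"
  shows "(\<Sum>i<n. \<tau> (star P (\<Oplus>k\<in>{..<n}. z k \<odot> u i k) \<otimes> (\<Oplus>k\<in>{..<n}. z k \<odot> u i k))) =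
    (\<Sum>k<n. cnj (z k) * z k)"
proof -
  have "(\<Sum>i<n. \<tau> (star P (\<Oplus>k\<in>{..<n}. z k \<odot> u i k) \<otimes> (\<Oplus>k\<in>{..<n}. z k \<odot> u i k))) =
      (\<Sum>i<n. \<Sum>k<n. \<Sum>l<n. cnj (z k) * z l * \<tau> (star P (u i k) \<otimes> u i l))"
    by (intro sum.cong refl functional_star_mult_combination[OF \<tau>(1)]) (use u in auto)
  also have "\<dots> = (\<Sum>k<n. \<Sum>i<n. \<Sum>l<n. cnj (z k) * z l * \<tau> (star P (u i k) \<otimes> u i l))"
    by (rule sum.swap)
  also have "\<dots> = (\<Sum>k<n. \<Sum>l<n. \<Sum>i<n. cnj (z k) * z l * \<tau> (star P (u i k) \<otimes> u i l))"
    by (rule sum.cong[OF refl], rule sum.swap)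
  also have "\<dots> = (\<Sum>k<n. \<Sum>l<n. if l = k then cnj (z k) * z l else 0)"
    using unitary_left[OF u _ _ \<tau>(1)] \<tau>(2) by (intro sum.cong refl) (simp flip: sum_distrib_left)
  finally show ?thesis by simp
qed

text \<open>
  The transpose of a unitary matrix over a noncommutative algebra need not be unitary. It still
  preserves the length of a vector when this is seen by a trace.
\<close>

lemma unitary_column_norm:
  assumes u: "unitary_rep P n u" and \<tau>: "tracial_state P \<tau>"
  shows "(\<Sum>j<n. \<tau> (star P (\<Oplus>k\<in>{..<n}. z k \<odot> u k j) \<otimes> (\<Oplus>k\<in>{..<n}. z k \<odot> u k j))) =
    (\<Sum>k<n. cnj (z k) * z k)"
proof -
  note t = tracial_stateD[OF \<tau>]
  have "(\<Sum>j<n. \<tau> (star P (\<Oplus>k\<in>{..<n}. z k \<odot> u k j) \<otimes> (\<Oplus>k\<in>{..<n}. z k \<odot> u k j))) =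
      (\<Sum>j<n. \<Sum>k<n. \<Sum>l<n. cnj (z k) * z l * \<tau> (star P (u k j) \<otimes> u l j))"
    by (intro sum.cong refl functional_star_mult_combination[OF t(2)]) (use u in auto)
  also have "\<dots> = (\<Sum>j<n. \<Sum>k<n. \<Sum>l<n. cnj (z k) * z l * \<tau> (u l j \<otimes> star P (u k j)))"
    using u by (intro sum.cong refl arg_cong2[of _ _ _ _ "(*)"] t(6)) (auto simp: star_closed)
  also have "\<dots> = (\<Sum>k<n. \<Sum>j<n. \<Sum>l<n. cnj (z k) * z l * \<tau> (u l j \<otimes> star P (u k j)))"
    by (rule sum.swap)
  also have "\<dots> = (\<Sum>k<n. \<Sum>l<n. \<Sum>j<n. cnj (z k) * z l * \<tau> (u l j \<otimes> star P (u k j)))"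
    by (rule sum.cong[OF refl], rule sum.swap)
  also have "\<dots> = (\<Sum>k<n. \<Sum>l<n. if l = k then cnj (z k) * z l else 0)"
    using unitary_right[OF u _ _ t(2)] t(4) by (intro sum.cong refl) (simp flip: sum_distrib_left)
  finally show ?thesis by simp
qed

lemma tracial_contraction:
  fixes n :: nat
  assumes \<tau>: "tracial_state P \<tau>" and b: "\<And>i. i < n \<Longrightarrow> b i \<in> carrier P"
    and norm: "(\<Sum>i<n. \<tau> (star P (b i) \<otimes> b i)) = (\<Sum>k<n. cnj (z k) * z k)"
  shows "(\<Sum>i<n. (cmod (\<tau> (b i)))\<^sup>2) \<le> (\<Sum>k<n. (cmod (z k))\<^sup>2)"
proof -
  have "(\<Sum>i<n. (cmod (\<tau> (b i)))\<^sup>2) \<le> (\<Sum>i<n. Re (\<tau> (star P (b i) \<otimes> b i)))"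
    using b by (intro sum_mono state_norm_le tracial_stateD(1)[OF \<tau>]) auto
  also have "\<dots> = Re (\<Sum>k<n. cnj (z k) * z k)" by (simp flip: norm Re_sum)
  also have "\<dots> = (\<Sum>k<n. (cmod (z k))\<^sup>2)"
    unfolding cmod_power2 by (simp add: power2_eq_square)
  finally show ?thesis .
qed

text \<open>
  The vector b and the vector z of its values have the same length, so their difference has length
  zero under every tracial state.
\<close>

lemma invariant_vector_modulo_kac_ideal:
  fixes n :: nat
  assumes b: "\<And>i. i < n \<Longrightarrow> b i \<in> carrier P"
    and norm: "\<And>\<tau>. tracial_state P \<tau> \<Longrightarrow> (\<Sum>i<n. \<tau> (star P (b i) \<otimes> b i)) = (\<Sum>k<n. cnj (z k) * z k)"
    and fixed: "\<And>\<tau> i. tracial_state P \<tau> \<Longrightarrow> i < n \<Longrightarrow> \<tau> (b i) = z i"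
    and i: "i < n"
  shows "b i \<oplus> (- z i) \<odot> \<one> \<in> kac_ideal P"
proof (rule kac_idealI)
  show "b i \<oplus> (- z i) \<odot> \<one> \<in> carrier P" using b i by simp
  fix \<tau> assume \<tau>: "tracial_state P \<tau>"
  note t = tracial_stateD[OF \<tau>]
  let ?d = "\<lambda>i. b i \<oplus> (- z i) \<odot> \<one>"
  have d: "?d i \<in> carrier P" if "i < n" for i using b that by simp
  have e: "\<tau> (star P (?d i) \<otimes> ?d i) = \<tau> (star P (b i) \<otimes> b i) - cnj (z i) * z i" if "i < n" for i
  proof -
    have "\<tau> (star P (b i)) = cnj (z i)" using state_star[OF t(1) b[OF that]] fixed[OF \<tau> that] by simp
    then show ?thesis
      using b[OF that] fixed[OF \<tau> that] t(4)
      by (simp add: star_add star_smult star_one star_closed l_distr r_distr smult_mult_l smult_mult_r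
          linear_functional_add[OF t(2)] linear_functional_scale[OF t(2)] algebra_simps)
  qed
  have "(\<Sum>i<n. \<tau> (star P (?d i) \<otimes> ?d i)) = 0"
    using norm[OF \<tau>] by (simp add: e sum_subtractf)
  then have "(\<Sum>i<n. Re (\<tau> (star P (?d i) \<otimes> ?d i))) = 0" by (simp flip: Re_sum)
  then have "Re (\<tau> (star P (?d i) \<otimes> ?d i)) = 0"
    using i t(5)[OF d] by (subst (asm) sum_nonneg_eq_0_iff) (auto simp: complex_nonneg_Reals_iff)
  then show "\<tau> (star P (?d i) \<otimes> ?d i) = 0"
    using t(5)[OF d[OF i]] by (simp add: complex_nonneg_Reals_iff complex_eq_iff)
qed

text \<open>
  Among the matrices of values of tracial states on finitely many unitary representations, there is
  one of least Hilbert-Schmidt norm. Multiplying it by the matrix of another tracial state is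
  convolution and does not increase the norm, so by strict convexity it absorbs all the others.
\<close>

lemma absorbing_tracial_state:
  assumes R: "finite R" "\<And>n u. (n, u) \<in> R \<Longrightarrow> unitary_rep P n u"
  shows "\<exists>h. tracial_state P h \<and> (\<forall>\<tau> n u i j. tracial_state P \<tau> \<longrightarrow> (n, u) \<in> R \<longrightarrow> i < n \<longrightarrow> j < n \<longrightarrow>
    convolve P \<tau> h (u i j) = h (u i j) \<and> convolve P h \<tau> (u i j) = h (u i j))"
proof -
  let ?T = "{\<tau>. tracial_state P \<tau> \<and> (\<forall>a. a \<notin> carrier P \<longrightarrow> \<tau> a = 0)}"
  define N where "N \<tau> = (\<Sum>(n, u)\<in>R. \<Sum>i<n. \<Sum>j<n. (cmod (\<tau> (u i j)))\<^sup>2)" for \<tau> :: "'a \<Rightarrow> complex"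
  define cut where "cut \<tau> a = (if a \<in> carrier P then \<tau> a else 0)" for \<tau> :: "'a \<Rightarrow> complex" and a
  have cut: "cut \<tau> \<in> ?T" if "tracial_state P \<tau>" for \<tau>
    using that linear_functional_cong[OF complex_space_axioms tracial_stateD(2)[OF that], of "cut \<tau>"]
    by (auto simp: cut_def tracial_state_def state_def tracial_def star_closed)
  have N_cut: "N (cut \<tau>) = N \<tau>" for \<tau>
    unfolding N_def by (intro sum.cong refl) (auto simp: cut_def unitary_closed[OF R(2)] intro!: sum.cong)
  have ev: "continuous_on ?T (\<lambda>\<tau>. \<tau> a)" for a
    by (rule continuous_on_subset[OF continuous_on_product_coordinates]) simp
  have "continuous_on ?T N"
    unfolding N_def case_prod_unfold by (intro continuous_intros ev)
  moreover have "?T \<noteq> {}" using cut[OF counit_tracial_state] by blast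
  ultimately obtain h where h: "h \<in> ?T" and "\<forall>\<tau>\<in>?T. N h \<le> N \<tau>"
    using continuous_attains_inf[OF compact_tracial_states, of N] by blast
  then have least: "N h \<le> N \<tau>" if "tracial_state P \<tau>" for \<tau>
    using cut[OF that] N_cut[of \<tau>] by force
  have hT: "tracial_state P h" using h by simp
  note h = tracial_stateD[OF hT]
  have absorb: "g (u i j) = h (u i j)"
    if g: "tracial_state P g" "N g \<le> N h" and u: "(n, u) \<in> R" "i < n" "j < n" for g n u i j
  proof -
    let ?m = "\<lambda>a. (1/2) * h a + (1/2) * g a" and ?d = "\<lambda>a. (1/2) * h a - (1/2) * g a"
    \<comment> \<open>The parallelogram identity gives the strict convexity of N.\<close>
    have par: "(cmod ((1/2) * x + (1/2) * y))\<^sup>2 + (cmod ((1/2) * x - (1/2) * y))\<^sup>2 =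
        (1/2) * (cmod x)\<^sup>2 + (1/2) * (cmod y)\<^sup>2" for x y :: complex
      unfolding cmod_power2 by (simp add: power2_eq_square field_simps)
    have "N ?m + N ?d = (1/2) * N h + (1/2) * N g"
      by (simp add: N_def case_prod_unfold sum.distrib[symmetric] sum_distrib_left par
          del: times_divide_eq_left divide_const_simps)
    then have "N ?d \<le> 0" using least[OF tracial_state_midpoint[OF hT g(1)]] g(2) by simp
    moreover have "(cmod (?d (u i j)))\<^sup>2 \<le> N ?d"
    proof -
      have "(cmod (?d (u i j)))\<^sup>2 \<le> (\<Sum>j<n. (cmod (?d (u i j)))\<^sup>2)"
        using u by (intro member_le_sum) auto
      also have "\<dots> \<le> (\<Sum>i<n. \<Sum>j<n. (cmod (?d (u i j)))\<^sup>2)"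
        using u by (intro member_le_sum[of i "{..<n}" "\<lambda>i. \<Sum>j<n. (cmod (?d (u i j)))\<^sup>2"]) (auto intro: sum_nonneg)
      also have "\<dots> \<le> N ?d"
      proof -
        define q where "q = (\<lambda>(n::nat, u). \<Sum>i<n. \<Sum>j<n. (cmod (?d (u i j)))\<^sup>2)"
        have "q (n, u) \<le> sum q R"
          by (rule member_le_sum[OF u(1) _ R(1)]) (auto simp: q_def intro!: sum_nonneg)
        then show ?thesis by (simp only: N_def q_def prod.case)
      qed
      finally show ?thesis .
    qed
    ultimately have "(cmod (?d (u i j)))\<^sup>2 \<le> 0" by linarith
    then show ?thesis by simp
  qed
  have "convolve P \<tau> h (u i j) = h (u i j) \<and> convolve P h \<tau> (u i j) = h (u i j)"
    if \<tau>: "tracial_state P \<tau>" and u: "(n, u) \<in> R" "i < n" "j < n" for \<tau> n u i j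
  proof -
    note t = tracial_stateD[OF \<tau>]
    have "(\<Sum>i<n. \<Sum>j<n. (cmod (convolve P \<tau> h (u i j)))\<^sup>2) \<le> (\<Sum>i<n. \<Sum>j<n. (cmod (h (u i j)))\<^sup>2)"
      if "(n, u) \<in> R" for n u
    proof -
      note u = R(2)[OF that]
      have "(\<Sum>i<n. (cmod (convolve P \<tau> h (u i j)))\<^sup>2) \<le> (\<Sum>k<n. (cmod (h (u k j)))\<^sup>2)" if j: "j < n" for j
      proof -
        have "convolve P \<tau> h (u i j) = \<tau> (\<Oplus>k\<in>{..<n}. h (u k j) \<odot> u i k)" if i: "i < n" for i
          using convolve_unitary[OF t(2) h(2) u i j] functional_combination[OF t(2), of n "u i" "\<lambda>k. h (u k j)"] u i
          by (simp add: mult.commute)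
        then show ?thesis
          using tracial_contraction[OF \<tau> _ unitary_row_norm[OF u t(2,4), of "\<lambda>k. h (u k j)"]] u by simp
      qed
      then have "(\<Sum>j<n. \<Sum>i<n. (cmod (convolve P \<tau> h (u i j)))\<^sup>2) \<le> (\<Sum>j<n. \<Sum>k<n. (cmod (h (u k j)))\<^sup>2)"
        by (rule sum_mono) simp
      then show ?thesis by (subst (1 2) sum.swap)
    qed
    then have 1: "N (convolve P \<tau> h) \<le> N h" unfolding N_def by (intro sum_mono[of R]) auto
    have "(\<Sum>i<n. \<Sum>j<n. (cmod (convolve P h \<tau> (u i j)))\<^sup>2) \<le> (\<Sum>i<n. \<Sum>j<n. (cmod (h (u i j)))\<^sup>2)"
      if "(n, u) \<in> R" for n u
    proof (rule sum_mono)
      note u = R(2)[OF that]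
      fix i assume "i \<in> {..<n}" then have i: "i < n" by simp
      have "convolve P h \<tau> (u i j) = \<tau> (\<Oplus>k\<in>{..<n}. h (u i k) \<odot> u k j)" if j: "j < n" for j
        using convolve_unitary[OF h(2) t(2) u i j] functional_combination[OF t(2), of n "\<lambda>k. u k j" "\<lambda>k. h (u i k)"] u j
        by simp
      then show "(\<Sum>j<n. (cmod (convolve P h \<tau> (u i j)))\<^sup>2) \<le> (\<Sum>j<n. (cmod (h (u i j)))\<^sup>2)"
        using tracial_contraction[OF \<tau> _ unitary_column_norm[OF u \<tau>, of "\<lambda>k. h (u i k)"]] u by simp
    qed
    then have 2: "N (convolve P h \<tau>) \<le> N h" unfolding N_def by (intro sum_mono[of R]) auto
    show ?thesis
      using absorb[OF convolve_tracial_state[OF \<tau> hT] 1 u] absorb[OF convolve_tracial_state[OF hT \<tau>] 2 u] by simp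
  qed
  then show ?thesis using hT by blast
qed

text \<open>
  The functionals that vanish on the Kac ideal are those of the quotient, so this is two-sided
  invariance of h in the quotient, at one element.
\<close>

definition invariant_at :: "('a \<Rightarrow> complex) \<Rightarrow> 'a \<Rightarrow> bool" where
  "invariant_at h a \<longleftrightarrow> (\<forall>f. linear_functional P f \<longrightarrow> (\<forall>x\<in>kac_ideal P. f x = 0) \<longrightarrow>
     convolve P f h a = h a * f \<one> \<and> convolve P h f a = h a * f \<one>)"

lemma invariant_atD:
  assumes "invariant_at h a" "linear_functional P f" "\<And>x. x \<in> kac_ideal P \<Longrightarrow> f x = 0"
  shows "convolve P f h a = h a * f \<one>" and "convolve P h f a = h a * f \<one>"
  using assms by (simp_all add: invariant_at_def)

text \<open>
  For a column z of the matrix of h, every tracial state maps the vector u z to z. Hence u z equals z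
  modulo the Kac ideal, and this is invariance on one side; the rows give the other side.
\<close>

lemma invariant_at_unitary:
  assumes h: "tracial_state P h" and u: "unitary_rep P n u" and i: "i < n" and j: "j < n"
    and absorb: "\<And>\<tau> i j. tracial_state P \<tau> \<Longrightarrow> i < n \<Longrightarrow> j < n \<Longrightarrow>
      convolve P \<tau> h (u i j) = h (u i j) \<and> convolve P h \<tau> (u i j) = h (u i j)"
  shows "invariant_at h (u i j)"
  unfolding invariant_at_def
proof (intro allI impI)
  note hl = tracial_stateD(2)[OF h]
  fix f assume f: "linear_functional P f" "\<forall>x\<in>kac_ideal P. f x = 0"
  let ?r = "\<lambda>i. \<Oplus>k\<in>{..<n}. h (u k j) \<odot> u i k" and ?c = "\<lambda>j. \<Oplus>k\<in>{..<n}. h (u i k) \<odot> u k j"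
  have r: "?r i \<in> carrier P" if "i < n" for i using u that by simp
  have c: "?c j \<in> carrier P" if "j < n" for j using u that by simp
  have er: "g (?r i) = convolve P g h (u i j)" if g: "linear_functional P g" and i: "i < n" for g i
    using convolve_unitary[OF g hl u i j] functional_combination[OF g, of n "u i" "\<lambda>k. h (u k j)"] u i
    by (simp add: mult.commute)
  have ec: "g (?c j) = convolve P h g (u i j)" if g: "linear_functional P g" and j: "j < n" for g j
    using convolve_unitary[OF hl g u i j] functional_combination[OF g, of n "\<lambda>k. u k j" "\<lambda>k. h (u i k)"] u j
    by simp
  have "?r i \<oplus> (- h (u i j)) \<odot> \<one> \<in> kac_ideal P"
  proof (rule invariant_vector_modulo_kac_ideal[of n ?r "\<lambda>i. h (u i j)", OF r _ _ i])
    fix \<tau> assume \<tau>: "tracial_state P \<tau>"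
    show "(\<Sum>i<n. \<tau> (star P (?r i) \<otimes> ?r i)) = (\<Sum>k<n. cnj (h (u k j)) * h (u k j))"
      by (rule unitary_row_norm[OF u tracial_stateD(2,4)[OF \<tau>]])
    show "\<tau> (?r i) = h (u i j)" if "i < n" for i
      using er[OF tracial_stateD(2)[OF \<tau>] that] absorb[OF \<tau> that j] by simp
  qed
  then have "f (?r i) = h (u i j) * f \<one>"
    using f r[OF i] by (force simp: linear_functional_add[OF f(1)] linear_functional_scale[OF f(1)])
  moreover have "?c j \<oplus> (- h (u i j)) \<odot> \<one> \<in> kac_ideal P"
  proof (rule invariant_vector_modulo_kac_ideal[of n ?c "\<lambda>j. h (u i j)", OF c _ _ j])
    fix \<tau> assume \<tau>: "tracial_state P \<tau>"
    show "(\<Sum>j<n. \<tau> (star P (?c j) \<otimes> ?c j)) = (\<Sum>k<n. cnj (h (u i k)) * h (u i k))"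
      by (rule unitary_column_norm[OF u \<tau>])
    show "\<tau> (?c j) = h (u i j)" if "j < n" for j
      using ec[OF tracial_stateD(2)[OF \<tau>] that] absorb[OF \<tau> i that] by simp
  qed
  then have "f (?c j) = h (u i j) * f \<one>"
    using f c[OF j] by (force simp: linear_functional_add[OF f(1)] linear_functional_scale[OF f(1)])
  ultimately show "convolve P f h (u i j) = h (u i j) * f \<one> \<and> convolve P h f (u i j) = h (u i j) * f \<one>"
    using er[OF f(1) i] ec[OF f(1) j] by simp
qed

lemma convolve_linear:
  "linear_functional P \<sigma> \<Longrightarrow> linear_functional P \<tau> \<Longrightarrow> linear_functional P (convolve P \<sigma> \<tau>)"
  using comult_linear[OF product_form] by (simp add: convolve_def[abs_def])

lemma invariant_at_zero:
  assumes "linear_functional P h" shows "invariant_at h \<zero>"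
  using assms convolve_linear by (simp add: invariant_at_def linear_functional_zero)

lemma invariant_at_add:
  assumes "linear_functional P h" "a \<in> carrier P" "b \<in> carrier P" "invariant_at h a" "invariant_at h b"
  shows "invariant_at h (a \<oplus> b)"
  using assms convolve_linear by (simp add: invariant_at_def linear_functional_add algebra_simps)

lemma invariant_at_scale:
  assumes "linear_functional P h" "a \<in> carrier P" "invariant_at h a"
  shows "invariant_at h (k \<odot> a)"
  using assms convolve_linear by (simp add: invariant_at_def linear_functional_scale algebra_simps)

lemma invariant_at_finite:
  assumes "finite X" "X \<subseteq> carrier P"
  shows "\<exists>h. tracial_state P h \<and> (\<forall>a\<in>X. invariant_at h a)"
proof -
  let ?inv = "\<lambda>R h. \<forall>(n, u)\<in>R. \<forall>i<n. \<forall>j<n. invariant_at h (u i j)"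
  let ?good = "\<lambda>a R. finite R \<and> (\<forall>(n, u)\<in>R. unitary_rep P n u) \<and>
      (\<forall>h. tracial_state P h \<longrightarrow> ?inv R h \<longrightarrow> invariant_at h a)"
  have "\<exists>R. ?good a R" if "a \<in> carrier P" for a
    using that
  proof (induction rule: coefficient_induct)
    case (coefficient n u i j)
    then show ?case by (intro exI[of _ "{(n, u)}"]) auto
  next
    case zero
    show ?case using invariant_at_zero tracial_stateD(2) by (intro exI[of _ "{}"]) auto
  next
    case (add a b)
    then obtain R1 R2 where "?good a R1" "?good b R2" by blast
    then show ?case
      using invariant_at_add[OF tracial_stateD(2) add(1,2)] by (intro exI[of _ "R1 \<union> R2"]) blast
  next
    case (scale k a)
    then obtain R where "?good a R" by blast
    then show ?case
      using invariant_at_scale[OF tracial_stateD(2) scale(1)] by (intro exI[of _ R]) blast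
  qed
  then have "\<forall>a\<in>carrier P. \<exists>R. ?good a R" by blast
  from bchoice[OF this] obtain R where R: "\<forall>a\<in>carrier P. ?good a (R a)" ..
  have fin: "finite (R a)" and rep: "\<And>n u. (n, u) \<in> R a \<Longrightarrow> unitary_rep P n u"
    and good: "\<And>h. tracial_state P h \<Longrightarrow> ?inv (R a) h \<Longrightarrow> invariant_at h a" if "a \<in> X" for a
  proof -
    have "?good a (R a)" using R that assms(2) by blast
    then show "finite (R a)" "\<And>n u. (n, u) \<in> R a \<Longrightarrow> unitary_rep P n u"
      "\<And>h. tracial_state P h \<Longrightarrow> ?inv (R a) h \<Longrightarrow> invariant_at h a" by blast+
  qed
  have "finite (\<Union>a\<in>X. R a)" using assms(1) fin by blast
  moreover have "unitary_rep P n u" if "(n, u) \<in> (\<Union>a\<in>X. R a)" for n u using that rep by blast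
  ultimately obtain h where h: "tracial_state P h"
    and absorb: "\<forall>\<tau> n u i j. tracial_state P \<tau> \<longrightarrow> (n, u) \<in> (\<Union>a\<in>X. R a) \<longrightarrow> i < n \<longrightarrow> j < n \<longrightarrow>
      convolve P \<tau> h (u i j) = h (u i j) \<and> convolve P h \<tau> (u i j) = h (u i j)"
    using absorbing_tracial_state[of "\<Union>a\<in>X. R a"] by blast
  have "invariant_at h a" if a: "a \<in> X" for a
  proof (rule good[OF a h], clarify)
    fix n u i j assume u: "(n, u) \<in> R a" and ij: "i < n" "j < n"
    show "invariant_at h (u i j)"
      by (rule invariant_at_unitary[OF h rep[OF a u] ij]) (use absorb a u in blast)
  qed
  then show ?thesis using h by blast
qed

lemma invariant_at_unique:
  assumes "tracial_state P h" "tracial_state P h'" "invariant_at h a" "invariant_at h' a"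
  shows "h a = h' a"
proof -
  note t = tracial_stateD[OF assms(1)] and t' = tracial_stateD[OF assms(2)]
  have "convolve P h' h a = h a * h' \<one>"
    using assms(3) t'(2) kac_ideal_vanish[OF _ assms(2)] by (auto simp: invariant_at_def)
  moreover have "convolve P h' h a = h' a * h \<one>"
    using assms(4) t(2) kac_ideal_vanish[OF _ assms(1)] by (auto simp: invariant_at_def)
  ultimately show ?thesis using t(4) t'(4) by simp
qed

text \<open>
  By uniqueness the value at a of a tracial state that is invariant at a depends on a alone. These
  values form the Haar functional. Each property asked of it involves finitely many elements, and on
  these it agrees with a single tracial state.
\<close>

lemma tracial_haar_modulo_kac_ideal: "\<exists>h. tracial_state P h \<and> (\<forall>a\<in>carrier P. invariant_at h a)"
proof -
  define H where "H a = (THE v. \<exists>h. tracial_state P h \<and> invariant_at h a \<and> v = h a)" for a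
  have H: "H a = h a" if "tracial_state P h" "invariant_at h a" for h a
    unfolding H_def by (rule the_equality) (use that invariant_at_unique in blast)+
  have local: "\<exists>h. tracial_state P h \<and> (\<forall>a\<in>X. invariant_at h a \<and> H a = h a)"
    if "finite X" "X \<subseteq> carrier P" for X
    using invariant_at_finite[OF that] H by blast
  have "tracial_state P H"
    unfolding tracial_state_def state_def tracial_def linear_functional_def
  proof (intro conjI ballI allI)
    fix x y assume xy: "x \<in> carrier P" "y \<in> carrier P"
    then obtain h where "tracial_state P h" "\<forall>a\<in>{x, y, x \<oplus> y}. H a = h a"
      using local[of "{x, y, x \<oplus> y}"] by auto
    then show "H (x \<oplus> y) = H x + H y" using xy linear_functional_add[OF tracial_stateD(2)] by simp
    from xy obtain h where "tracial_state P h" "\<forall>a\<in>{x \<otimes> y, y \<otimes> x}. H a = h a"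
      using local[of "{x \<otimes> y, y \<otimes> x}"] by auto
    then show "H (x \<otimes> y) = H (y \<otimes> x)" using xy tracial_stateD(6) by simp
  next
    fix k x assume x: "x \<in> carrier P"
    then obtain h where "tracial_state P h" "\<forall>a\<in>{x, k \<odot> x}. H a = h a"
      using local[of "{x, k \<odot> x}"] by auto
    then show "H (k \<odot> x) = k * H x" using x linear_functional_scale[OF tracial_stateD(2)] by simp
  next
    fix x assume x: "x \<in> carrier P"
    then obtain h where "tracial_state P h" "\<forall>a\<in>{star P x \<otimes> x}. H a = h a"
      using local[of "{star P x \<otimes> x}"] by (auto simp: star_closed)
    then show "H (star P x \<otimes> x) \<in> \<real>\<^sub>\<ge>\<^sub>0" using x tracial_stateD(5) by simp
  next
    obtain h where "tracial_state P h" "\<forall>a\<in>{\<one>}. H a = h a" using local[of "{\<one>}"] by auto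
    then show "H \<one> = 1" using tracial_stateD(4) by simp
  qed
  moreover have "convolve P f H a = H a * f \<one> \<and> convolve P H f a = H a * f \<one>"
    if f: "linear_functional P f" "\<And>x. x \<in> kac_ideal P \<Longrightarrow> f x = 0" and a: "a \<in> carrier P" for f a
  proof -
    obtain n x y where r: "tensor_rep P P (comult P a) n x y"
      using tensor_rep_exists[OF comult_closed[OF a]] by blast
    note xy = tensor_repD[OF r]
    obtain h where h: "tracial_state P h" "\<forall>b\<in>insert a (x ` {..<n} \<union> y ` {..<n}). invariant_at h b \<and> H b = h b"
      using local[of "insert a (x ` {..<n} \<union> y ` {..<n})"] a xy(1,2) by auto
    note lin = tracial_stateD(2)[OF h(1)] tracial_stateD(2)[OF \<open>tracial_state P H\<close>]
    have "convolve P f H a = convolve P f h a" "convolve P H f a = convolve P h f a"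
      using h(2) unfolding convolve_def
      by (simp_all add: xy(3)[OF product_form[OF f(1) lin(1)]] xy(3)[OF product_form[OF f(1) lin(2)]]
          xy(3)[OF product_form[OF lin(1) f(1)]] xy(3)[OF product_form[OF lin(2) f(1)]])
    moreover have "invariant_at h a" "H a = h a" using h(2) by auto
    ultimately show ?thesis using f by (simp add: invariant_at_def)
  qed
  ultimately show ?thesis by (auto simp: invariant_at_def)
qed

end


section \<open>The antipode and the Kac ideal\<close>

context cqg
begin

text \<open>
  The conjugate of a unitary representation is unitary modulo the Kac ideal. Consider the matrix
  whose entries are the sums over k of star (u i k) times u j k. Averaging it with h gives the identity
  matrix, because h is tracial; but right translation by h leaves it unchanged by the same
  computation.
\<close>

lemma conjugate_unitary_modulo_kac_ideal:
  assumes h: "tracial_state P h" "\<And>a. a \<in> carrier P \<Longrightarrow> invariant_at h a"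
    and u: "unitary_rep P n u" and i: "i < n" and j: "j < n"
    and f: "linear_functional P f" "\<And>x. x \<in> kac_ideal P \<Longrightarrow> f x = 0"
  shows "(\<Sum>k<n. f (star P (u i k) \<otimes> u j k)) = (if i = j then f \<one> else 0)"
proof -
  note t = tracial_stateD[OF h(1)]
  have avg: "(\<Sum>k<n. h (star P (u p k) \<otimes> u q k)) = (if p = q then 1 else 0)" if "p < n" "q < n" for p q
  proof -
    have "(\<Sum>k<n. h (star P (u p k) \<otimes> u q k)) = (\<Sum>k<n. h (u q k \<otimes> star P (u p k)))"
      using u that by (intro sum.cong refl t(6)) (auto simp: star_closed)
    then show ?thesis using unitary_right[OF u that(2,1) t(2)] t(4) by auto
  qed
  have "convolve P f h (star P (u i k) \<otimes> u j k) =
      (\<Sum>p<n. \<Sum>q<n. f (star P (u i p) \<otimes> u j q) * h (star P (u p k) \<otimes> u q k))" if k: "k < n" for k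
  proof -
    have r: "tensor_rep P P (comult P (u l k)) n (\<lambda>p. u l p) (\<lambda>p. u p k)" if "l < n" for l
      using u that k by (simp add: tensor_rep_def comult_unitary[OF u that k])
    show ?thesis
      unfolding convolve_def
      using u i j k by (simp add: comult_mult comult_star star_closed del: tensor_mult_eval tensor_star_eval
          add: tensor_mult_rep[OF star_algebra_axioms star_algebra_axioms
            tensor_star_rep[OF star_algebra_axioms star_algebra_axioms r[OF i]] r[OF j] product_form[OF f(1) t(2)]])
  qed
  then have "(\<Sum>k<n. convolve P f h (star P (u i k) \<otimes> u j k)) =
      (\<Sum>k<n. \<Sum>p<n. \<Sum>q<n. f (star P (u i p) \<otimes> u j q) * h (star P (u p k) \<otimes> u q k))" by simp
  also have "\<dots> = (\<Sum>p<n. \<Sum>k<n. \<Sum>q<n. f (star P (u i p) \<otimes> u j q) * h (star P (u p k) \<otimes> u q k))"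
    by (rule sum.swap)
  also have "\<dots> = (\<Sum>p<n. \<Sum>q<n. \<Sum>k<n. f (star P (u i p) \<otimes> u j q) * h (star P (u p k) \<otimes> u q k))"
    by (rule sum.cong[OF refl], rule sum.swap)
  also have "\<dots> = (\<Sum>p<n. \<Sum>q<n. if q = p then f (star P (u i p) \<otimes> u j q) else 0)"
    using avg by (intro sum.cong refl) (simp flip: sum_distrib_left)
  also have "\<dots> = (\<Sum>p<n. f (star P (u i p) \<otimes> u j p))" by simp
  also have "(\<Sum>k<n. convolve P f h (star P (u i k) \<otimes> u j k)) =
      (\<Sum>k<n. h (star P (u i k) \<otimes> u j k)) * f \<one>"
    using invariant_atD(1)[OF h(2) f] u i j by (simp add: sum_distrib_right star_closed)
  finally show ?thesis using avg[OF i j] by (simp split: if_splits)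
qed

text \<open>
  The conjugate of a unitary representation u has S as a left inverse and, modulo the Kac ideal, its
  adjoint as a right inverse. So S maps star (u i l) to u l i, the adjoint of the image of u i l.
\<close>

lemma antipode_star_modulo_kac_ideal:
  assumes h: "tracial_state P h" "\<And>a. a \<in> carrier P \<Longrightarrow> invariant_at h a"
    and f: "linear_functional P f" "\<And>x. x \<in> kac_ideal P \<Longrightarrow> f x = 0"
    and a: "a \<in> carrier P"
  shows "f (S (star P a)) = f (star P (S a))"
  using a
proof (induction rule: coefficient_induct)
  case (coefficient n u i l)
  note u = coefficient(1) and i = coefficient(2) and l = coefficient(3)
  have lin: "linear_functional P (\<lambda>z. f (z \<otimes> u l j))" if "j < n" for j
    using linear_functional_mult_right[OF f(1)] u l that by simp
  have "(\<Sum>k<n. f (S (star P (u i k)) \<otimes> star P (u k j) \<otimes> u l j)) = (if j = i then f (u l j) else 0)"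
    if j: "j < n" for j
  proof -
    have r: "tensor_rep P P (comult P (u i j)) n (\<lambda>p. u i p) (\<lambda>p. u p j)"
      using u i j by (simp add: tensor_rep_def comult_unitary[OF u i j])
    have "comult P (star P (u i j)) (\<lambda>x y. f (S x \<otimes> y \<otimes> u l j)) =
        (\<Sum>k<n. f (S (star P (u i k)) \<otimes> star P (u k j) \<otimes> u l j))"
      using u i j linear_functional_comp_bilinear[OF lin[OF j] antipode_left_bilinear]
      by (simp add: comult_star del: tensor_star_eval
          add: tensor_repD(3)[OF tensor_star_rep[OF star_algebra_axioms star_algebra_axioms r]])
    then show ?thesis
      using antipode_left[OF _ lin[OF j], of "star P (u i j)"] u i j l
      by (cases "j = i") (simp_all add: star_closed counit_star counit_unitary)
  qed
  then have "(\<Sum>j<n. \<Sum>k<n. f (S (star P (u i k)) \<otimes> star P (u k j) \<otimes> u l j)) = f (u l i)"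
    using i by simp
  also have "(\<Sum>j<n. \<Sum>k<n. f (S (star P (u i k)) \<otimes> star P (u k j) \<otimes> u l j)) =
      (\<Sum>k<n. \<Sum>j<n. f (S (star P (u i k)) \<otimes> (star P (u k j) \<otimes> u l j)))"
    using u i l by (subst sum.swap) (simp add: m_assoc star_closed)
  also have "\<dots> = (\<Sum>k<n. if k = l then f (S (star P (u i k))) else 0)"
  proof (rule sum.cong[OF refl])
    fix k assume "k \<in> {..<n}" then have k: "k < n" by simp
    let ?z = "S (star P (u i k))"
    have z: "?z \<in> carrier P" using u i k by (simp add: star_closed)
    have "f (?z \<otimes> x) = 0" if "x \<in> kac_ideal P" for x
      using f(2)[OF kac_ideal_mult_left[OF that z]] .
    from conjugate_unitary_modulo_kac_ideal[OF h u k l linear_functional_mult_left[OF f(1) z] this]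
    show "(\<Sum>j<n. f (?z \<otimes> (star P (u k j) \<otimes> u l j))) = (if k = l then f ?z else 0)"
      using z by (cases "k = l") simp_all
  qed
  finally show ?case using u i l by (simp add: antipode_unitary star_star)
next
  case zero
  then show ?case by (simp add: star_zero antipode_zero)
next
  case (add a b)
  then show ?case by (simp add: star_add star_closed antipode_add linear_functional_add[OF f(1)])
next
  case (scale k a)
  then show ?case by (simp add: star_smult star_closed antipode_scale linear_functional_scale[OF f(1)])
qed

lemma antipode_one: "S \<one> = \<one>"
proof (rule eqI_functional)
  fix f assume f: "linear_functional P f"
  have "comult P \<one> (\<lambda>x y. f (S x \<otimes> y)) = f (S \<one> \<otimes> \<one>)"
    by (rule comult_one[OF linear_functional_comp_bilinear[OF f antipode_left_bilinear]])
  then show "f (S \<one>) = f \<one>" using antipode_left[OF one_closed f] by (simp add: counit_one)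
qed simp_all

text \<open>
  Modulo the Kac ideal the antipode is an antihomomorphism that commutes with the involution, so
  composing a tracial state with it gives a tracial state.
\<close>

lemma antipode_kac_ideal:
  assumes a: "a \<in> kac_ideal P" shows "S a \<in> kac_ideal P"
proof (rule kac_idealI)
  have ac: "a \<in> carrier P" by (rule kac_ideal_closed[OF a])
  then show "S a \<in> carrier P" by simp
  fix \<tau> assume \<tau>: "tracial_state P \<tau>"
  note t = tracial_stateD[OF \<tau>]
  obtain h where h: "tracial_state P h" "\<And>a. a \<in> carrier P \<Longrightarrow> invariant_at h a"
    using tracial_haar_modulo_kac_ideal by blast
  have sq: "\<tau> (S (star P x \<otimes> x)) = \<tau> (star P (S x) \<otimes> S x)" if x: "x \<in> carrier P" for x
  proof -
    have lin: "linear_functional P (\<lambda>z. \<tau> (S x \<otimes> z))"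
      using linear_functional_mult_left[OF t(2)] x by simp
    have "\<tau> (S x \<otimes> y) = 0" if "y \<in> kac_ideal P" for y
      using kac_ideal_vanish[OF kac_ideal_mult_left[OF that] \<tau>] x by simp
    from antipode_star_modulo_kac_ideal[OF h lin this x]
    show ?thesis using x t(6) by (simp add: antipode_mult star_closed)
  qed
  have "tracial_state P (\<lambda>x. \<tau> (S x))"
    unfolding tracial_state_def state_def tracial_def
    using linear_functional_antipode[OF t(2)] sq t by (simp add: antipode_one antipode_mult)
  then have "\<tau> (S (star P a \<otimes> a)) = 0" by (rule kac_idealD(4)[OF a])
  then show "\<tau> (star P (S a) \<otimes> S a) = 0" using sq[OF ac] by simp
qed

end

section \<open>Quotients of compact quantum groups by the Kac ideal\<close>

lemma linear_map_tensor_map: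
  assumes C: "complex_space C" and D: "complex_space D" and fg: "linear_map A C f" "linear_map B D g"
    and A: "complex_space A"
  shows "linear_map (tensor_algebra A B) (tensor_algebra C D) (tensor_map A B C D f g)"
proof -
  interpret T: complex_space "tensor_algebra A B" by (rule tensor_algebra_space[OF A])
  interpret U: complex_space "tensor_algebra C D" by (rule tensor_algebra_space[OF C])
  note cl = tensor_map_closed[OF C D fg] and ev = tensor_map_eval[OF C D fg]
  show ?thesis
    unfolding linear_map_def
    by (intro conjI ballI allI funcsetI tensor_eqI[of _ C D])
       (simp_all add: cl ev bilinear_forms_comp[OF fg])
qed

lemma tensor_map_elem:
  assumes "complex_space C" "complex_space D" "linear_map A C f" "linear_map B D g"
    "a \<in> carrier A" "b \<in> carrier B"
  shows "tensor_map A B C D f g (elem_tensor A B a b) = elem_tensor C D (f a) (g b)"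
proof (rule tensor_eqI[of _ C D])
  show "tensor_map A B C D f g (elem_tensor A B a b) \<in> carrier (tensor_algebra C D)"
    using assms by (intro tensor_map_closed) simp_all
  show "elem_tensor C D (f a) (g b) \<in> carrier (tensor_algebra C D)"
    using assms by (intro elem_tensor_closed) (auto simp: linear_map_def)
  fix \<beta> assume "\<beta> \<in> bilinear_forms C D"
  then show "tensor_map A B C D f g (elem_tensor A B a b) \<beta> = elem_tensor C D (f a) (g b) \<beta>"
    using assms by (simp add: tensor_map_eval bilinear_forms_comp)
qed

lemma linear_map_zero:
  assumes "complex_space A" "complex_space B" "linear_map A B f"
  shows "f \<zero>\<^bsub>A\<^esub> = \<zero>\<^bsub>B\<^esub>"
proof -
  interpret A: complex_space A by fact
  interpret B: complex_space B by fact
  have "f (0 \<odot>\<^bsub>A\<^esub> \<zero>\<^bsub>A\<^esub>) = 0 \<odot>\<^bsub>B\<^esub> f \<zero>\<^bsub>A\<^esub>" using assms(3) A.M.zero_closed unfolding linear_map_def by blast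
  moreover have "f \<zero>\<^bsub>A\<^esub> \<in> carrier B" using assms(3) A.M.zero_closed unfolding linear_map_def by blast
  ultimately show ?thesis by simp
qed

lemma linear_map_finsum:
  assumes A: "complex_space A" and B: "complex_space B" and f: "linear_map A B f"
    and "finite I" "g \<in> I \<rightarrow> carrier A"
  shows "f (\<Oplus>\<^bsub>A\<^esub>i\<in>I. g i) = (\<Oplus>\<^bsub>B\<^esub>i\<in>I. f (g i))"
  using assms(4,5)
proof (induction I)
  interpret A: complex_space A by fact
  interpret B: complex_space B by fact
  case empty
  then show ?case by (simp add: linear_map_zero[OF A B f])
next
  interpret A: complex_space A by fact
  interpret B: complex_space B by fact
  case (insert i I)
  then have "g \<in> I \<rightarrow> carrier A" "g i \<in> carrier A" by auto
  moreover from this have "(\<lambda>i. f (g i)) \<in> I \<rightarrow> carrier B" "f (g i) \<in> carrier B"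
    using f unfolding linear_map_def by blast+
  ultimately show ?case using insert f by (simp add: linear_map_def)
qed

lemma linear_map_id: "linear_map A A id" "linear_map A A (\<lambda>x. x)"
  by (simp_all add: linear_map_def)

lemma
  fixes A :: "('a, 'x) star_algebra_scheme" and B :: "('b, 'y) star_algebra_scheme"
    and C :: "('c, 'z) star_algebra_scheme"
  assumes A: "complex_space A" and B: "complex_space B" and C: "complex_space C"
  shows tensor_assoc_form: "\<beta> \<in> bilinear_forms A (tensor_algebra B C) \<Longrightarrow>
      (\<lambda>s c. s (\<lambda>a b. \<beta> a (elem_tensor B C b c))) \<in> bilinear_forms (tensor_algebra A B) C"
    and tensor_assoc_closed: "T \<in> carrier (tensor_algebra (tensor_algebra A B) C) \<Longrightarrow>
      tensor_assoc A B C T \<in> carrier (tensor_algebra A (tensor_algebra B C))"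
    and tensor_assoc_eval: "T \<in> carrier (tensor_algebra (tensor_algebra A B) C) \<Longrightarrow>
      \<beta> \<in> bilinear_forms A (tensor_algebra B C) \<Longrightarrow>
      tensor_assoc A B C T \<beta> = T (\<lambda>s c. s (\<lambda>a b. \<beta> a (elem_tensor B C b c)))"
proof -
  let ?V = "tensor_algebra A (tensor_algebra B C)"
  let ?\<phi> = "\<lambda>c a b. elem_tensor A (tensor_algebra B C) a (elem_tensor B C b c)"
  let ?\<psi> = "\<lambda>t c. tensor_lift A B ?V (?\<phi> c) t"
  have BC: "complex_space (tensor_algebra B C)" by (rule tensor_algebra_space[OF B])
  have AB: "complex_space (tensor_algebra A B)" by (rule tensor_algebra_space[OF A])
  have V: "complex_space ?V" by (rule tensor_algebra_space[OF A])
  interpret AB: complex_space "tensor_algebra A B" by (rule AB)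
  interpret C: complex_space C by (rule C)
  interpret V: complex_space ?V by (rule V)
  have elem: "linear_map B (tensor_algebra B C) (\<lambda>b. elem_tensor B C b c)" if "c \<in> carrier C" for c
    using elem_tensor_bilinear[OF B C] that by (simp add: bilinear_map_def)
  have \<phi>: "bilinear_map A B ?V (?\<phi> c)" if "c \<in> carrier C" for c
    by (rule bilinear_map_comp[OF linear_map_id(2) elem[OF that] elem_tensor_bilinear[OF A BC]])
  have \<gamma>: "(\<lambda>a b. \<beta> a (elem_tensor B C b c)) \<in> bilinear_forms A B"
    if "\<beta> \<in> bilinear_forms A (tensor_algebra B C)" "c \<in> carrier C" for \<beta> c
    by (rule bilinear_forms_comp[OF linear_map_id(2) elem[OF that(2)] that(1)])
  have cl: "?\<psi> t c \<in> carrier ?V" if "t \<in> carrier (tensor_algebra A B)" "c \<in> carrier C" for t c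
    by (rule tensor_lift_closed[OF V \<phi>[OF that(2)] that(1)])
  have ev: "?\<psi> t c \<beta> = t (\<lambda>a b. \<beta> a (elem_tensor B C b c))"
    if "t \<in> carrier (tensor_algebra A B)" "c \<in> carrier C" "\<beta> \<in> bilinear_forms A (tensor_algebra B C)" for t c \<beta>
    using tensor_lift_tensor_eval[OF A \<phi>[OF that(2)] that(1,3)] that(3) by simp
  have form: "(\<lambda>s c. s (\<lambda>a b. \<beta> a (elem_tensor B C b c))) \<in> bilinear_forms (tensor_algebra A B) C"
    if \<beta>: "\<beta> \<in> bilinear_forms A (tensor_algebra B C)" for \<beta>
    unfolding bilinear_forms_def
  proof (intro CollectI conjI ballI)
    show "linear_functional (tensor_algebra A B) (\<lambda>s. s (\<lambda>a b. \<beta> a (elem_tensor B C b c)))"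
      if "c \<in> carrier C" for c by (rule tensor_eval_linear[OF \<gamma>[OF \<beta> that]])
  next
    fix s assume s: "s \<in> carrier (tensor_algebra A B)"
    have add: "\<beta> a (elem_tensor B C b (c \<oplus>\<^bsub>C\<^esub> d)) =
        1 * \<beta> a (elem_tensor B C b c) + 1 * \<beta> a (elem_tensor B C b d)"
      if "a \<in> carrier A" "b \<in> carrier B" "c \<in> carrier C" "d \<in> carrier C" for a b c d
    proof -
      have "elem_tensor B C b (c \<oplus>\<^bsub>C\<^esub> d) =
          elem_tensor B C b c \<oplus>\<^bsub>tensor_algebra B C\<^esub> elem_tensor B C b d"
        using elem_tensor_bilinear[OF B C] that by (simp add: bilinear_map_def linear_map_def)
      then show ?thesis using bilinear_forms_simps(2)[OF \<beta>] that by simp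
    qed
    have scale: "\<beta> a (elem_tensor B C b (k \<odot>\<^bsub>C\<^esub> c)) =
        k * \<beta> a (elem_tensor B C b c) + 0 * \<beta> a (elem_tensor B C b c)"
      if "a \<in> carrier A" "b \<in> carrier B" "c \<in> carrier C" for a b c k
    proof -
      have "elem_tensor B C b (k \<odot>\<^bsub>C\<^esub> c) = k \<odot>\<^bsub>tensor_algebra B C\<^esub> elem_tensor B C b c"
        using elem_tensor_bilinear[OF B C] that by (simp add: bilinear_map_def linear_map_def)
      then show ?thesis using bilinear_forms_simps(4)[OF \<beta>] that by simp
    qed
    show "linear_functional C (\<lambda>c. s (\<lambda>a b. \<beta> a (elem_tensor B C b c)))"
      unfolding linear_functional_def
    proof (intro conjI ballI allI)
      fix c d assume cd: "c \<in> carrier C" "d \<in> carrier C"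
      show "s (\<lambda>a b. \<beta> a (elem_tensor B C b (c \<oplus>\<^bsub>C\<^esub> d))) =
          s (\<lambda>a b. \<beta> a (elem_tensor B C b c)) + s (\<lambda>a b. \<beta> a (elem_tensor B C b d))"
        using tensor_eval_cong[OF s \<gamma>[OF \<beta> C.M.a_closed[OF cd]]
            bilinear_forms_combine[OF \<gamma>[OF \<beta> cd(1)] \<gamma>[OF \<beta> cd(2)], of 1 1] add[OF _ _ cd]]
          tensor_eval_combine[OF s \<gamma>[OF \<beta> cd(1)] \<gamma>[OF \<beta> cd(2)], of 1 1] by simp
    next
      fix k c assume c: "c \<in> carrier C"
      show "s (\<lambda>a b. \<beta> a (elem_tensor B C b (k \<odot>\<^bsub>C\<^esub> c))) = k * s (\<lambda>a b. \<beta> a (elem_tensor B C b c))"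
        using tensor_eval_cong[OF s \<gamma>[OF \<beta> C.scale_closed[OF c]]
            bilinear_forms_combine[OF \<gamma>[OF \<beta> c] \<gamma>[OF \<beta> c], of k 0] scale[OF _ _ c]]
          tensor_eval_combine[OF s \<gamma>[OF \<beta> c] \<gamma>[OF \<beta> c], of k 0] by simp
    qed
  qed
  then show "\<beta> \<in> bilinear_forms A (tensor_algebra B C) \<Longrightarrow>
      (\<lambda>s c. s (\<lambda>a b. \<beta> a (elem_tensor B C b c))) \<in> bilinear_forms (tensor_algebra A B) C" .
  have \<psi>: "bilinear_map (tensor_algebra A B) C ?V ?\<psi>"
    unfolding bilinear_map_def linear_map_def
  proof (intro conjI ballI allI funcsetI tensor_eqI[of _ A "tensor_algebra B C"])
    fix t c d \<beta> assume t: "t \<in> carrier (tensor_algebra A B)" and cd: "c \<in> carrier C" "d \<in> carrier C"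
      and \<beta>: "\<beta> \<in> bilinear_forms A (tensor_algebra B C)"
    show "?\<psi> t (c \<oplus>\<^bsub>C\<^esub> d) \<beta> = (?\<psi> t c \<oplus>\<^bsub>?V\<^esub> ?\<psi> t d) \<beta>"
      using bilinear_forms_simps(2)[OF form[OF \<beta>] t cd] by (simp add: ev t cd \<beta>)
  next
    fix t c k \<beta> assume t: "t \<in> carrier (tensor_algebra A B)" and c: "c \<in> carrier C"
      and \<beta>: "\<beta> \<in> bilinear_forms A (tensor_algebra B C)"
    show "?\<psi> t (k \<odot>\<^bsub>C\<^esub> c) \<beta> = (k \<odot>\<^bsub>?V\<^esub> ?\<psi> t c) \<beta>"
      using bilinear_forms_simps(4)[OF form[OF \<beta>] t c] by (simp add: ev t c \<beta>)
  qed (simp_all add: cl ev \<gamma>)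
  show "T \<in> carrier (tensor_algebra (tensor_algebra A B) C) \<Longrightarrow>
      tensor_assoc A B C T \<in> carrier ?V"
    unfolding tensor_assoc_def by (rule tensor_lift_closed[OF V \<psi>])
  show "tensor_assoc A B C T \<beta> = T (\<lambda>s c. s (\<lambda>a b. \<beta> a (elem_tensor B C b c)))"
    if T: "T \<in> carrier (tensor_algebra (tensor_algebra A B) C)"
      and \<beta>: "\<beta> \<in> bilinear_forms A (tensor_algebra B C)"
  proof -
    have "tensor_assoc A B C T \<beta> = T (\<lambda>t c. ?\<psi> t c \<beta>)"
      unfolding tensor_assoc_def by (rule tensor_lift_tensor_eval[OF A \<psi> T \<beta>])
    also have "\<dots> = T (\<lambda>s c. s (\<lambda>a b. \<beta> a (elem_tensor B C b c)))"
      by (rule tensor_eval_cong[OF T linear_functional_comp_bilinear[OF tensor_eval_linear[OF \<beta>] \<psi>] form[OF \<beta>]])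
         (simp add: ev \<beta>)
    finally show ?thesis .
  qed
qed

text \<open>
  In this form coassociativity passes to a quotient by substituting the quotient map into \<beta>.
\<close>

lemma coassociative_iff:
  assumes P: "complex_space P" and \<Delta>: "linear_map P (tensor_algebra P P) (comult P)"
    and a: "a \<in> carrier P"
  shows "tensor_assoc P P P (tensor_map P P (tensor_algebra P P) P (comult P) id (comult P a)) =
      tensor_map P P P (tensor_algebra P P) id (comult P) (comult P a) \<longleftrightarrow>
    (\<forall>\<beta>\<in>bilinear_forms P (tensor_algebra P P).
      comult P a (\<lambda>x y. comult P x (\<lambda>v w. \<beta> v (elem_tensor P P w y))) = comult P a (\<lambda>x y. \<beta> x (comult P y)))"
    (is "?L = ?R \<longleftrightarrow> _")
proof -
  note PP = tensor_algebra_space[OF P, of P]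
  have \<Delta>a: "comult P a \<in> carrier (tensor_algebra P P)" using \<Delta> a by (auto simp: linear_map_def)
  note m1 = tensor_map_closed[OF PP P \<Delta> linear_map_id(1) \<Delta>a]
  have L: "?L \<beta> = comult P a (\<lambda>x y. comult P x (\<lambda>v w. \<beta> v (elem_tensor P P w y)))"
    if \<beta>: "\<beta> \<in> bilinear_forms P (tensor_algebra P P)" for \<beta>
    using tensor_map_eval[OF PP P \<Delta> linear_map_id(1) \<Delta>a tensor_assoc_form[OF P P P \<beta>]]
    by (simp add: tensor_assoc_eval[OF P P P m1 \<beta>])
  have R: "?R \<beta> = comult P a (\<lambda>x y. \<beta> x (comult P y))"
    if \<beta>: "\<beta> \<in> bilinear_forms P (tensor_algebra P P)" for \<beta>
    using tensor_map_eval[OF P PP linear_map_id(1) \<Delta> \<Delta>a \<beta>] by simp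
  show ?thesis
  proof
    assume eq: "?L = ?R"
    show "\<forall>\<beta>\<in>bilinear_forms P (tensor_algebra P P).
      comult P a (\<lambda>x y. comult P x (\<lambda>v w. \<beta> v (elem_tensor P P w y))) = comult P a (\<lambda>x y. \<beta> x (comult P y))"
    proof
      fix \<beta> assume \<beta>: "\<beta> \<in> bilinear_forms P (tensor_algebra P P)"
      show "comult P a (\<lambda>x y. comult P x (\<lambda>v w. \<beta> v (elem_tensor P P w y))) = comult P a (\<lambda>x y. \<beta> x (comult P y))"
        by (rule L[OF \<beta>, unfolded eq R[OF \<beta>], symmetric])
    qed
  next
    assume eq: "\<forall>\<beta>\<in>bilinear_forms P (tensor_algebra P P).
      comult P a (\<lambda>x y. comult P x (\<lambda>v w. \<beta> v (elem_tensor P P w y))) = comult P a (\<lambda>x y. \<beta> x (comult P y))"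
    show "?L = ?R"
    proof (rule tensor_eqI[OF tensor_assoc_closed[OF P P P m1] tensor_map_closed[OF P PP linear_map_id(1) \<Delta> \<Delta>a]])
      fix \<beta> assume \<beta>: "\<beta> \<in> bilinear_forms P (tensor_algebra P P)"
      show "?L \<beta> = ?R \<beta>" by (rule trans[OF L[OF \<beta>] trans[OF bspec[OF eq \<beta>] R[OF \<beta>, symmetric]]])
    qed
  qed
qed


text \<open>
  A quotient is described by its projection q alone, so that different realizations of it are covered.
\<close>

locale quotient_by_kac_ideal = cqg P \<epsilon> S + K: star_algebra K
  for P :: "('a, 'x) quantum_group_scheme" (structure) and \<epsilon> S and K :: "('b, 'y) quantum_group_scheme" +
  fixes q :: "'a \<Rightarrow> 'b"
  assumes q_hom: "star_hom P K q"
    and q_surj: "q ` carrier P = carrier K"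
    and q_kernel: "\<And>a. a \<in> carrier P \<Longrightarrow> q a = \<zero>\<^bsub>K\<^esub> \<longleftrightarrow> a \<in> kac_ideal P"
    and q_comult: "\<And>a. a \<in> carrier P \<Longrightarrow> comult K (q a) = tensor_map P P K K q q (comult P a)"
begin

lemma q_linear: "linear_map P K q"
  using q_hom by (simp add: star_hom_def)

lemma q_closed [simp]: "a \<in> carrier P \<Longrightarrow> q a \<in> carrier K"
  using q_linear by (auto simp: linear_map_def)

lemma q_add: "a \<in> carrier P \<Longrightarrow> b \<in> carrier P \<Longrightarrow> q (a \<oplus> b) = q a \<oplus>\<^bsub>K\<^esub> q b"
  using q_linear by (simp add: linear_map_def)

lemma q_scale: "a \<in> carrier P \<Longrightarrow> q (k \<odot> a) = k \<odot>\<^bsub>K\<^esub> q a"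
  using q_linear by (simp add: linear_map_def)

lemma q_mult: "a \<in> carrier P \<Longrightarrow> b \<in> carrier P \<Longrightarrow> q (a \<otimes> b) = q a \<otimes>\<^bsub>K\<^esub> q b"
  using q_hom ring_hom_mult[of q P K] by (simp add: star_hom_def)

lemma q_one: "q \<one> = \<one>\<^bsub>K\<^esub>"
  using q_hom ring_hom_one[of q P K] by (simp add: star_hom_def)

lemma q_star: "a \<in> carrier P \<Longrightarrow> q (star P a) = star K (q a)"
  using q_hom by (simp add: star_hom_def)

lemma q_zero: "q \<zero> = \<zero>\<^bsub>K\<^esub>"
  by (rule linear_map_zero[OF complex_space_axioms K.complex_space_axioms q_linear])

lemma q_eq_iff:
  assumes "a \<in> carrier P" "b \<in> carrier P"
  shows "q a = q b \<longleftrightarrow> a \<oplus> (-1) \<odot> b \<in> kac_ideal P"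
proof -
  have "q (a \<oplus> (-1) \<odot> b) = q a \<ominus>\<^bsub>K\<^esub> q b"
    using assms by (simp add: q_add q_scale a_minus_def K.minus_eq_scale)
  then show ?thesis
    using q_kernel[of "a \<oplus> (-1) \<odot> b"] assms K.diff_eq_zero_iff by simp
qed

text \<open>
  Maps descend to K by composition with this section of q; the choice is irrelevant for maps that
  respect the Kac ideal.
\<close>

definition section_of :: "'b \<Rightarrow> 'a" where
  "section_of X = (SOME a. a \<in> carrier P \<and> q a = X)"

lemma section_of:
  assumes "X \<in> carrier K" shows "section_of X \<in> carrier P" "q (section_of X) = X"
proof -
  have "X \<in> q ` carrier P" using assms by (simp add: q_surj)
  then have "\<exists>a. a \<in> carrier P \<and> q a = X" by blast
  then have "section_of X \<in> carrier P \<and> q (section_of X) = X" unfolding section_of_def by (rule someI_ex)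
  then show "section_of X \<in> carrier P" "q (section_of X) = X" by auto
qed

lemma quotient_cases:
  assumes "X \<in> carrier K" obtains a where "a \<in> carrier P" "X = q a"
  using section_of[OF assms] by metis

lemma descend:
  assumes g: "linear_functional P g" "\<And>x. x \<in> kac_ideal P \<Longrightarrow> g x = 0" and a: "a \<in> carrier P"
  shows "g (section_of (q a)) = g a"
proof -
  have s: "section_of (q a) \<in> carrier P" "q (section_of (q a)) = q a" using section_of a by auto
  then have "g (section_of (q a) \<oplus> (-1) \<odot> a) = 0" using q_eq_iff[OF s(1) a] g(2) by simp
  then show ?thesis using s(1) a by (simp add: linear_functional_add[OF g(1)] linear_functional_scale[OF g(1)])
qed

lemma descend_linear:
  assumes g: "linear_functional P g" "\<And>x. x \<in> kac_ideal P \<Longrightarrow> g x = 0"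
  shows "linear_functional K (\<lambda>X. g (section_of X))"
  unfolding linear_functional_def
proof (intro conjI ballI allI)
  fix X Y assume "X \<in> carrier K" "Y \<in> carrier K"
  then obtain a b where "a \<in> carrier P" "b \<in> carrier P" "X = q a" "Y = q b" by (metis quotient_cases)
  then show "g (section_of (X \<oplus>\<^bsub>K\<^esub> Y)) = g (section_of X) + g (section_of Y)"
    by (simp add: q_add[symmetric] descend[OF g] linear_functional_add[OF g(1)])
next
  fix k X assume "X \<in> carrier K"
  then obtain a where "a \<in> carrier P" "X = q a" by (metis quotient_cases)
  then show "g (section_of (k \<odot>\<^bsub>K\<^esub> X)) = k * g (section_of X)"
    by (simp add: q_scale[symmetric] descend[OF g] linear_functional_scale[OF g(1)])
qed

definition counitK :: "'b \<Rightarrow> complex" where "counitK X = \<epsilon> (section_of X)"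
definition antipodeK :: "'b \<Rightarrow> 'b" where "antipodeK X = q (S (section_of X))"

lemma counit_vanish: "x \<in> kac_ideal P \<Longrightarrow> \<epsilon> x = 0"
  by (rule kac_ideal_vanish[OF _ counit_tracial_state])

lemma counitK_q: "a \<in> carrier P \<Longrightarrow> counitK (q a) = \<epsilon> a"
  unfolding counitK_def by (rule descend[OF counit_linear counit_vanish])

lemma counitK_linear: "linear_functional K counitK"
  using descend_linear[OF counit_linear counit_vanish] by (simp add: counitK_def[abs_def])

lemma antipodeK_q:
  assumes a: "a \<in> carrier P" shows "antipodeK (q a) = q (S a)"
proof -
  have s: "section_of (q a) \<in> carrier P" "q (section_of (q a)) = q a" using section_of a by auto
  have "S (section_of (q a) \<oplus> (-1) \<odot> a) \<in> kac_ideal P"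
    using q_eq_iff[OF s(1) a] s(2) antipode_kac_ideal by simp
  then show ?thesis
    using s(1) a by (simp add: antipodeK_def q_eq_iff antipode_add antipode_scale)
qed

lemma antipodeK_linear: "linear_map K K antipodeK"
  unfolding linear_map_def
proof (intro conjI ballI allI funcsetI)
  show "antipodeK X \<in> carrier K" if "X \<in> carrier K" for X
    using section_of[OF that] by (simp add: antipodeK_def)
next
  fix X Y assume "X \<in> carrier K" "Y \<in> carrier K"
  then obtain a b where "a \<in> carrier P" "b \<in> carrier P" "X = q a" "Y = q b" by (metis quotient_cases)
  then show "antipodeK (X \<oplus>\<^bsub>K\<^esub> Y) = antipodeK X \<oplus>\<^bsub>K\<^esub> antipodeK Y"
    by (simp add: q_add[symmetric] antipodeK_q antipode_add)
next
  fix k X assume "X \<in> carrier K"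
  then obtain a where "a \<in> carrier P" "X = q a" by (metis quotient_cases)
  then show "antipodeK (k \<odot>\<^bsub>K\<^esub> X) = k \<odot>\<^bsub>K\<^esub> antipodeK X"
    by (simp add: q_scale[symmetric] antipodeK_q antipode_scale)
qed

lemma bilinear_forms_q: "\<beta> \<in> bilinear_forms K K \<Longrightarrow> (\<lambda>x y. \<beta> (q x) (q y)) \<in> bilinear_forms P P"
  by (rule bilinear_forms_comp[OF q_linear q_linear])

lemma comult_q_closed: "a \<in> carrier P \<Longrightarrow> comult K (q a) \<in> carrier (tensor_algebra K K)"
  using tensor_map_closed[OF K.complex_space_axioms K.complex_space_axioms q_linear q_linear comult_closed]
  by (simp add: q_comult)

lemma comult_q: "a \<in> carrier P \<Longrightarrow> \<beta> \<in> bilinear_forms K K \<Longrightarrow>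
    comult K (q a) \<beta> = comult P a (\<lambda>x y. \<beta> (q x) (q y))"
  using tensor_map_eval[OF K.complex_space_axioms K.complex_space_axioms q_linear q_linear comult_closed]
  by (simp add: q_comult)

lemma comult_q_rep:
  assumes "a \<in> carrier P" "tensor_rep P P (comult P a) n x y"
  shows "tensor_rep K K (comult K (q a)) n (\<lambda>i. q (x i)) (\<lambda>i. q (y i))"
  using tensor_repD[OF assms(2)] by (simp add: tensor_rep_def comult_q[OF assms(1)] bilinear_forms_q)

lemma comultK_closed: "X \<in> carrier K \<Longrightarrow> comult K X \<in> carrier (tensor_algebra K K)"
  using comult_q_closed by (metis quotient_cases)

lemma comultK_linear: "linear_map K (tensor_algebra K K) (comult K)"
  unfolding linear_map_def
proof (intro conjI ballI allI funcsetI)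
  interpret T: complex_space "tensor_algebra K K" by (rule tensor_algebra_space[OF K.complex_space_axioms])
  show "comult K X \<in> carrier (tensor_algebra K K)" if "X \<in> carrier K" for X by (rule comultK_closed[OF that])
  fix X Y assume "X \<in> carrier K" "Y \<in> carrier K"
  then obtain a b where ab: "a \<in> carrier P" "b \<in> carrier P" "X = q a" "Y = q b" by (metis quotient_cases)
  show "comult K (X \<oplus>\<^bsub>K\<^esub> Y) = comult K X \<oplus>\<^bsub>tensor_algebra K K\<^esub> comult K Y"
  proof (rule tensor_eqI[of _ K K])
    fix \<beta> assume \<beta>: "\<beta> \<in> bilinear_forms K K"
    show "comult K (X \<oplus>\<^bsub>K\<^esub> Y) \<beta> = (comult K X \<oplus>\<^bsub>tensor_algebra K K\<^esub> comult K Y) \<beta>"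
      using ab linear_functional_add[OF comult_linear[OF bilinear_forms_q[OF \<beta>]]]
      by (simp add: q_add[symmetric] comult_q \<beta>)
  qed (use ab comultK_closed in auto)
next
  interpret T: complex_space "tensor_algebra K K" by (rule tensor_algebra_space[OF K.complex_space_axioms])
  fix k X assume "X \<in> carrier K"
  then obtain a where a: "a \<in> carrier P" "X = q a" by (metis quotient_cases)
  show "comult K (k \<odot>\<^bsub>K\<^esub> X) = k \<odot>\<^bsub>tensor_algebra K K\<^esub> comult K X"
  proof (rule tensor_eqI[of _ K K])
    fix \<beta> assume \<beta>: "\<beta> \<in> bilinear_forms K K"
    show "comult K (k \<odot>\<^bsub>K\<^esub> X) \<beta> = (k \<odot>\<^bsub>tensor_algebra K K\<^esub> comult K X) \<beta>"
      using a linear_functional_scale[OF comult_linear[OF bilinear_forms_q[OF \<beta>]]]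
      by (simp add: q_scale[symmetric] comult_q \<beta>)
  qed (use a comultK_closed in auto)
qed

lemma comultK_mult:
  assumes "X \<in> carrier K" "Y \<in> carrier K"
  shows "comult K (X \<otimes>\<^bsub>K\<^esub> Y) = comult K X \<otimes>\<^bsub>tensor_algebra K K\<^esub> comult K Y"
proof -
  obtain a b where ab: "a \<in> carrier P" "b \<in> carrier P" "X = q a" "Y = q b" using assms by (metis quotient_cases)
  obtain n x y where r: "tensor_rep P P (comult P a) n x y"
    using tensor_rep_exists[OF comult_closed[OF ab(1)]] by blast
  obtain m z w where s: "tensor_rep P P (comult P b) m z w"
    using tensor_rep_exists[OF comult_closed[OF ab(2)]] by blast
  have "comult K (X \<otimes>\<^bsub>K\<^esub> Y) \<beta> = (comult K X \<otimes>\<^bsub>tensor_algebra K K\<^esub> comult K Y) \<beta>"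
    if \<beta>: "\<beta> \<in> bilinear_forms K K" for \<beta>
  proof -
    have "comult K (X \<otimes>\<^bsub>K\<^esub> Y) \<beta> = (\<Sum>i<n. \<Sum>j<m. \<beta> (q (x i \<otimes> z j)) (q (y i \<otimes> w j)))"
      using ab by (simp add: q_mult[symmetric] comult_q[OF _ \<beta>] comult_mult del: tensor_mult_eval
          add: tensor_mult_rep[OF star_algebra_axioms star_algebra_axioms r s bilinear_forms_q[OF \<beta>]])
    also have "\<dots> = (\<Sum>i<n. \<Sum>j<m. \<beta> (q (x i) \<otimes>\<^bsub>K\<^esub> q (z j)) (q (y i) \<otimes>\<^bsub>K\<^esub> q (w j)))"
      using tensor_repD(1,2)[OF r] tensor_repD(1,2)[OF s] by (intro sum.cong refl) (simp add: q_mult)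
    also have "\<dots> = (comult K X \<otimes>\<^bsub>tensor_algebra K K\<^esub> comult K Y) \<beta>"
      unfolding ab(3,4)
      by (rule tensor_mult_rep[OF K.star_algebra_axioms K.star_algebra_axioms comult_q_rep[OF ab(1) r]
            comult_q_rep[OF ab(2) s] \<beta>, symmetric])
    finally show ?thesis .
  qed
  moreover have "comult K (X \<otimes>\<^bsub>K\<^esub> Y) \<in> extensional (bilinear_forms K K)"
    using tensor_extensional[OF comultK_closed[OF K.m_closed[OF assms]]] .
  moreover have "comult K X \<otimes>\<^bsub>tensor_algebra K K\<^esub> comult K Y \<in> extensional (bilinear_forms K K)"
    by (simp add: tensor_algebra_def)
  ultimately show ?thesis by (metis extensionalityI)
qed

lemma comultK_one: "comult K \<one>\<^bsub>K\<^esub> = \<one>\<^bsub>tensor_algebra K K\<^esub>"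
proof -
  have "\<one>\<^bsub>tensor_algebra K K\<^esub> = elem_tensor K K \<one>\<^bsub>K\<^esub> \<one>\<^bsub>K\<^esub>" by (simp add: tensor_algebra_def)
  then have 1: "\<one>\<^bsub>tensor_algebra K K\<^esub> \<in> carrier (tensor_algebra K K)" by simp
  show ?thesis
  proof (rule tensor_eqI[OF comultK_closed[OF K.one_closed] 1])
    fix \<beta> assume \<beta>: "\<beta> \<in> bilinear_forms K K"
    then show "comult K \<one>\<^bsub>K\<^esub> \<beta> = \<one>\<^bsub>tensor_algebra K K\<^esub> \<beta>"
      using comult_q[OF one_closed \<beta>] comult_one[OF bilinear_forms_q[OF \<beta>]] by (simp add: q_one)
  qed
qed

lemma comultK_star:
  assumes "X \<in> carrier K"
  shows "comult K (star K X) = star (tensor_algebra K K) (comult K X)"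
proof -
  obtain a where a: "a \<in> carrier P" "X = q a" using assms by (metis quotient_cases)
  obtain n x y where r: "tensor_rep P P (comult P a) n x y"
    using tensor_rep_exists[OF comult_closed[OF a(1)]] by blast
  note sr = tensor_star_rep[OF star_algebra_axioms star_algebra_axioms r]
    and sk = tensor_star_rep[OF K.star_algebra_axioms K.star_algebra_axioms comult_q_rep[OF a(1) r]]
  have "comult K (star K X) \<beta> = star (tensor_algebra K K) (comult K X) \<beta>"
    if \<beta>: "\<beta> \<in> bilinear_forms K K" for \<beta>
  proof -
    have "comult K (star K X) \<beta> = (\<Sum>i<n. \<beta> (q (star P (x i))) (q (star P (y i))))"
      using a by (simp add: q_star[symmetric] comult_q[OF _ \<beta>] comult_star star_closed del: tensor_star_eval
          add: tensor_repD(3)[OF sr bilinear_forms_q[OF \<beta>]])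
    also have "\<dots> = (\<Sum>i<n. \<beta> (star K (q (x i))) (star K (q (y i))))"
      using tensor_repD(1,2)[OF r] by (intro sum.cong refl) (simp add: q_star)
    also have "\<dots> = star (tensor_algebra K K) (comult K X) \<beta>"
      unfolding a(2) by (rule tensor_repD(3)[OF sk \<beta>, symmetric])
    finally show ?thesis .
  qed
  moreover have "comult K (star K X) \<in> extensional (bilinear_forms K K)"
    using tensor_extensional[OF comultK_closed[OF K.star_closed[OF assms]]] .
  moreover have "star (tensor_algebra K K) (comult K X) \<in> extensional (bilinear_forms K K)"
    by (simp add: tensor_algebra_def)
  ultimately show ?thesis by (metis extensionalityI)
qed

lemma comultK_star_hom: "star_hom K (tensor_algebra K K) (comult K)"
  unfolding star_hom_def
proof (intro conjI ballI)
  show "comult K \<in> ring_hom K (tensor_algebra K K)"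
    using comultK_linear
    by (intro ring_hom_memI) (simp_all add: comultK_closed comultK_mult comultK_one linear_map_def)
qed (simp_all add: comultK_linear comultK_star)

lemma comultK_coassociative:
  assumes "X \<in> carrier K"
  shows "tensor_assoc K K K (tensor_map K K (tensor_algebra K K) K (comult K) id (comult K X)) =
    tensor_map K K K (tensor_algebra K K) id (comult K) (comult K X)"
proof -
  obtain a where a: "a \<in> carrier P" "X = q a" using assms by (metis quotient_cases)
  note Ps = complex_space_axioms and Ks = K.complex_space_axioms
  let ?qq = "tensor_map P P K K q q"
  have \<Delta>: "linear_map P (tensor_algebra P P) (comult P)" using comult_star_hom by (simp add: star_hom_def)
  have qq: "linear_map (tensor_algebra P P) (tensor_algebra K K) ?qq"
    by (rule linear_map_tensor_map[OF Ks Ks q_linear q_linear Ps])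
  have elem: "linear_map K (tensor_algebra K K) (\<lambda>b. elem_tensor K K b c)" if "c \<in> carrier K" for c
    using elem_tensor_bilinear[OF Ks Ks] that by (simp add: bilinear_map_def)
  have "comult K X (\<lambda>x y. comult K x (\<lambda>v w. \<beta> v (elem_tensor K K w y))) = comult K X (\<lambda>x y. \<beta> x (comult K y))"
    if \<beta>: "\<beta> \<in> bilinear_forms K (tensor_algebra K K)" for \<beta>
  proof -
    \<comment> \<open>The form on P to which coassociativity is applied is the pullback of \<beta>.\<close>
    let ?\<beta> = "\<lambda>x t. \<beta> (q x) (?qq t)"
    have \<beta>': "?\<beta> \<in> bilinear_forms P (tensor_algebra P P)"
      by (rule bilinear_forms_comp[OF q_linear qq \<beta>])
    have m1: "(\<lambda>x y. comult K x (\<lambda>v w. \<beta> v (elem_tensor K K w y))) \<in> bilinear_forms K K"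
      using bilinear_forms_comp[OF comultK_linear linear_map_id(2) tensor_assoc_form[OF Ks Ks Ks \<beta>]] .
    have m1P: "(\<lambda>x y. comult P x (\<lambda>v w. ?\<beta> v (elem_tensor P P w y))) \<in> bilinear_forms P P"
      using bilinear_forms_comp[OF \<Delta> linear_map_id(2) tensor_assoc_form[OF Ps Ps Ps \<beta>']] .
    have m2: "(\<lambda>x y. \<beta> x (comult K y)) \<in> bilinear_forms K K"
      by (rule bilinear_forms_comp[OF linear_map_id(2) comultK_linear \<beta>])
    have m3: "(\<lambda>v w. \<beta> v (elem_tensor K K w Y)) \<in> bilinear_forms K K" if "Y \<in> carrier K" for Y
      by (rule bilinear_forms_comp[OF linear_map_id(2) elem[OF that] \<beta>])
    have m3P: "(\<lambda>v w. ?\<beta> v (elem_tensor P P w y)) \<in> bilinear_forms P P" if "y \<in> carrier P" for y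
    proof -
      have "linear_map P (tensor_algebra P P) (\<lambda>b. elem_tensor P P b y)"
        using elem_tensor_bilinear[OF Ps Ps] that by (simp add: bilinear_map_def)
      from bilinear_forms_comp[OF linear_map_id(2) this \<beta>'] show ?thesis .
    qed
    have "comult K X (\<lambda>x y. comult K x (\<lambda>v w. \<beta> v (elem_tensor K K w y))) =
        comult P a (\<lambda>x y. comult K (q x) (\<lambda>v w. \<beta> v (elem_tensor K K w (q y))))"
      unfolding a(2) by (rule comult_q[OF a(1) m1])
    also have "\<dots> = comult P a (\<lambda>x y. comult P x (\<lambda>v w. ?\<beta> v (elem_tensor P P w y)))"
    proof (rule tensor_eval_cong[OF comult_closed[OF a(1)] bilinear_forms_q[OF m1] m1P])
      fix x y assume x: "x \<in> carrier P" and y: "y \<in> carrier P"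
      have "comult K (q x) (\<lambda>v w. \<beta> v (elem_tensor K K w (q y))) =
          comult P x (\<lambda>v w. \<beta> (q v) (elem_tensor K K (q w) (q y)))"
        by (rule comult_q[OF x m3[OF q_closed[OF y]]])
      also have "\<dots> = comult P x (\<lambda>v w. ?\<beta> v (elem_tensor P P w y))"
        by (rule tensor_eval_cong[OF comult_closed[OF x] bilinear_forms_q[OF m3[OF q_closed[OF y]]] m3P[OF y]])
           (simp add: tensor_map_elem[OF Ks Ks q_linear q_linear _ y])
      finally show "comult K (q x) (\<lambda>v w. \<beta> v (elem_tensor K K w (q y))) =
          comult P x (\<lambda>v w. ?\<beta> v (elem_tensor P P w y))" .
    qed
    also have "\<dots> = comult P a (\<lambda>x y. ?\<beta> x (comult P y))"
      by (rule bspec[OF iffD1[OF coassociative_iff[OF Ps \<Delta> a(1)] coassociative[OF a(1)]] \<beta>'])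
    also have "\<dots> = comult P a (\<lambda>x y. \<beta> (q x) (comult K (q y)))"
      by (rule tensor_eval_cong[OF comult_closed[OF a(1)]
            bilinear_forms_comp[OF linear_map_id(2) \<Delta> \<beta>'] bilinear_forms_q[OF m2]])
         (simp add: q_comult)
    also have "\<dots> = comult K X (\<lambda>x y. \<beta> x (comult K y))"
      unfolding a(2) by (rule comult_q[OF a(1) m2, symmetric])
    finally show ?thesis .
  qed
  then show ?thesis using coassociative_iff[OF Ks comultK_linear assms] by blast
qed

lemma lift_q:
  assumes \<phi>: "bilinear_map K K K \<phi>" and a: "a \<in> carrier P" and v: "v \<in> carrier K"
    and eq: "\<And>f. linear_functional K f \<Longrightarrow> comult P a (\<lambda>x y. f (\<phi> (q x) (q y))) = f v"
  shows "tensor_lift K K K \<phi> (comult K (q a)) = v"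
proof (rule tensor_lift_eqI[OF K.complex_space_axioms \<phi> comult_q_closed[OF a] v])
  fix f assume f: "linear_functional K f"
  show "comult K (q a) (\<lambda>a b. f (\<phi> a b)) = f v"
    by (rule trans[OF comult_q[OF a linear_functional_comp_bilinear[OF f \<phi>]] eq[OF f]])
qed

lemma functional_comp_q:
  assumes f: "linear_functional K f"
  shows "linear_functional P (\<lambda>a. f (q a))" and "x \<in> kac_ideal P \<Longrightarrow> f (q x) = 0"
  using linear_functional_comp[OF f q_linear] q_kernel[of x] kac_ideal_closed[of x]
    K.linear_functional_zero[OF f] by simp_all

lemma lift_scale_left:
  assumes g: "linear_functional K g" and a: "a \<in> carrier P" and w: "w \<in> carrier P"
    and eq: "\<And>f. linear_functional P f \<Longrightarrow> (\<And>x. x \<in> kac_ideal P \<Longrightarrow> f x = 0) \<Longrightarrow>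
      comult P a (\<lambda>x y. g (q x) * f y) = f w"
  shows "tensor_lift K K K (\<lambda>x y. g x \<odot>\<^bsub>K\<^esub> y) (comult K (q a)) = q w"
proof (rule K.eqI_functional[OF tensor_lift_closed[OF K.complex_space_axioms K.scale_left_bilinear[OF g]
        comult_q_closed[OF a]] q_closed[OF w]])
  fix f assume f: "linear_functional K f"
  show "f (tensor_lift K K K (\<lambda>x y. g x \<odot>\<^bsub>K\<^esub> y) (comult K (q a))) = f (q w)"
    using K.tensor_lift_scale_left[OF comult_q_closed[OF a] g f] comult_q[OF a product_form[OF g f]]
      eq[OF functional_comp_q[OF f]] by simp
qed

lemma lift_scale_right:
  assumes g: "linear_functional K g" and a: "a \<in> carrier P" and w: "w \<in> carrier P"
    and eq: "\<And>f. linear_functional P f \<Longrightarrow> (\<And>x. x \<in> kac_ideal P \<Longrightarrow> f x = 0) \<Longrightarrow>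
      comult P a (\<lambda>x y. f x * g (q y)) = f w"
  shows "tensor_lift K K K (\<lambda>x y. g y \<odot>\<^bsub>K\<^esub> x) (comult K (q a)) = q w"
proof (rule K.eqI_functional[OF tensor_lift_closed[OF K.complex_space_axioms K.scale_right_bilinear[OF g]
        comult_q_closed[OF a]] q_closed[OF w]])
  fix f assume f: "linear_functional K f"
  show "f (tensor_lift K K K (\<lambda>x y. g y \<odot>\<^bsub>K\<^esub> x) (comult K (q a))) = f (q w)"
    using K.tensor_lift_scale_right[OF comult_q_closed[OF a] g f] comult_q[OF a product_form[OF f g]]
      eq[OF functional_comp_q[OF f]] by simp
qed

lemma counitK_hom: "counitK \<in> ring_hom K complex_ring"
proof (rule ring_hom_memI)
  fix X Y assume "X \<in> carrier K" "Y \<in> carrier K"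
  then obtain a b where ab: "a \<in> carrier P" "b \<in> carrier P" "X = q a" "Y = q b" by (metis quotient_cases)
  show "counitK (X \<otimes>\<^bsub>K\<^esub> Y) = counitK X \<otimes>\<^bsub>complex_ring\<^esub> counitK Y"
    using ab by (simp add: q_mult[symmetric] counitK_q counit_mult)
  show "counitK (X \<oplus>\<^bsub>K\<^esub> Y) = counitK X \<oplus>\<^bsub>complex_ring\<^esub> counitK Y"
    using ab by (simp add: q_add[symmetric] counitK_q linear_functional_add[OF counit_linear])
qed (use counitK_q[OF one_closed] in \<open>simp_all add: q_one counit_one\<close>)

lemma counitK_left: "X \<in> carrier K \<Longrightarrow> tensor_lift K K K (\<lambda>x y. counitK x \<odot>\<^bsub>K\<^esub> y) (comult K X) = X"
proof (elim quotient_cases)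
  fix a assume a: "a \<in> carrier P" "X = q a"
  have "comult P a (\<lambda>x y. counitK (q x) * f y) = f a" if f: "linear_functional P f" for f
    using tensor_eval_cong[OF comult_closed[OF a(1)]
        product_form[OF linear_functional_comp[OF counitK_linear q_linear] f] product_form[OF counit_linear f]]
      counit_left[OF a(1) f] by (simp add: counitK_q)
  then show ?thesis
    unfolding a(2) by (intro lift_scale_left[OF counitK_linear a(1) a(1)])
qed

lemma counitK_right: "X \<in> carrier K \<Longrightarrow> tensor_lift K K K (\<lambda>x y. counitK y \<odot>\<^bsub>K\<^esub> x) (comult K X) = X"
proof (elim quotient_cases)
  fix a assume a: "a \<in> carrier P" "X = q a"
  have "comult P a (\<lambda>x y. f x * counitK (q y)) = f a" if f: "linear_functional P f" for f
    using tensor_eval_cong[OF comult_closed[OF a(1)]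
        product_form[OF f linear_functional_comp[OF counitK_linear q_linear]] product_form[OF f counit_linear]]
      counit_right[OF a(1) f] by (simp add: counitK_q)
  then show ?thesis
    unfolding a(2) by (intro lift_scale_right[OF counitK_linear a(1) a(1)])
qed

lemma antipodeK_left:
  "X \<in> carrier K \<Longrightarrow> tensor_lift K K K (\<lambda>x y. antipodeK x \<otimes>\<^bsub>K\<^esub> y) (comult K X) = counitK X \<odot>\<^bsub>K\<^esub> \<one>\<^bsub>K\<^esub>"
proof (elim quotient_cases)
  fix a assume a: "a \<in> carrier P" "X = q a"
  have b: "bilinear_map K K K (\<lambda>x y. antipodeK x \<otimes>\<^bsub>K\<^esub> y)"
    by (rule bilinear_map_comp[OF antipodeK_linear linear_map_id(2) K.mult_bilinear])
  show ?thesis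
    unfolding a(2)
  proof (rule lift_q[OF b a(1)])
    fix f assume f: "linear_functional K f"
    note fq = linear_functional_comp[OF f q_linear]
    have "comult P a (\<lambda>x y. f (antipodeK (q x) \<otimes>\<^bsub>K\<^esub> q y)) = comult P a (\<lambda>x y. f (q (S x \<otimes> y)))"
      by (rule tensor_eval_cong[OF comult_closed[OF a(1)]
            bilinear_forms_q[OF linear_functional_comp_bilinear[OF f b]]
            linear_functional_comp_bilinear[OF fq antipode_left_bilinear]])
         (simp add: antipodeK_q q_mult)
    also have "\<dots> = \<epsilon> a * f (q \<one>)" by (rule antipode_left[OF a(1) fq])
    finally show "comult P a (\<lambda>x y. f (antipodeK (q x) \<otimes>\<^bsub>K\<^esub> q y)) = f (counitK (q a) \<odot>\<^bsub>K\<^esub> \<one>\<^bsub>K\<^esub>)"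
      by (simp add: counitK_q a q_one linear_functional_scale[OF f])
  qed simp
qed

lemma antipodeK_right:
  "X \<in> carrier K \<Longrightarrow> tensor_lift K K K (\<lambda>x y. x \<otimes>\<^bsub>K\<^esub> antipodeK y) (comult K X) = counitK X \<odot>\<^bsub>K\<^esub> \<one>\<^bsub>K\<^esub>"
proof (elim quotient_cases)
  fix a assume a: "a \<in> carrier P" "X = q a"
  have b: "bilinear_map K K K (\<lambda>x y. x \<otimes>\<^bsub>K\<^esub> antipodeK y)"
    by (rule bilinear_map_comp[OF linear_map_id(2) antipodeK_linear K.mult_bilinear])
  show ?thesis
    unfolding a(2)
  proof (rule lift_q[OF b a(1)])
    fix f assume f: "linear_functional K f"
    note fq = linear_functional_comp[OF f q_linear]
    have "comult P a (\<lambda>x y. f (q x \<otimes>\<^bsub>K\<^esub> antipodeK (q y))) = comult P a (\<lambda>x y. f (q (x \<otimes> S y)))"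
      by (rule tensor_eval_cong[OF comult_closed[OF a(1)]
            bilinear_forms_q[OF linear_functional_comp_bilinear[OF f b]]
            linear_functional_comp_bilinear[OF fq antipode_right_bilinear]])
         (simp add: antipodeK_q q_mult)
    also have "\<dots> = \<epsilon> a * f (q \<one>)" by (rule antipode_right[OF a(1) fq])
    finally show "comult P a (\<lambda>x y. f (q x \<otimes>\<^bsub>K\<^esub> antipodeK (q y))) = f (counitK (q a) \<odot>\<^bsub>K\<^esub> \<one>\<^bsub>K\<^esub>)"
      by (simp add: counitK_q a q_one linear_functional_scale[OF f])
  qed simp
qed

lemma unitary_rep_q:
  assumes u: "unitary_rep P n u" shows "unitary_rep K n (\<lambda>i j. q (u i j))"
  unfolding unitary_rep_def
proof (intro allI impI conjI)
  note Ps = complex_space_axioms and Ks = K.complex_space_axioms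
  fix i j assume ij: "i < n" "j < n"
  note u' = u[unfolded unitary_rep_def, rule_format, OF ij]
  show "q (u i j) \<in> carrier K" using u' by simp
  have "comult K (q (u i j)) = tensor_map P P K K q q (\<Oplus>\<^bsub>tensor_algebra P P\<^esub>k\<in>{..<n}. elem_tensor P P (u i k) (u k j))"
    using u' q_comult by simp
  also have "\<dots> = (\<Oplus>\<^bsub>tensor_algebra K K\<^esub>k\<in>{..<n}. tensor_map P P K K q q (elem_tensor P P (u i k) (u k j)))"
    by (rule linear_map_finsum[OF tensor_algebra_space[OF Ps] tensor_algebra_space[OF Ks]
          linear_map_tensor_map[OF Ks Ks q_linear q_linear Ps]]) (use u ij in auto)
  also have "\<dots> = (\<Oplus>\<^bsub>tensor_algebra K K\<^esub>k\<in>{..<n}. elem_tensor K K (q (u i k)) (q (u k j)))"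
  proof -
    interpret T: complex_space "tensor_algebra K K" by (rule tensor_algebra_space[OF Ks])
    show ?thesis
      by (rule T.M.finsum_cong') (use u ij in \<open>auto simp: tensor_map_elem[OF Ks Ks q_linear q_linear]\<close>)
  qed
  finally show "comult K (q (u i j)) = (\<Oplus>\<^bsub>tensor_algebra K K\<^esub>k\<in>{..<n}. elem_tensor K K (q (u i k)) (q (u k j)))" .
  have "(\<Oplus>\<^bsub>K\<^esub>k\<in>{..<n}. q (u i k) \<otimes>\<^bsub>K\<^esub> star K (q (u j k))) = (\<Oplus>\<^bsub>K\<^esub>k\<in>{..<n}. q (u i k \<otimes> star P (u j k)))"
    by (rule K.finsum_cong') (use u ij in \<open>auto simp: q_mult q_star star_closed K.star_closed\<close>)
  also have "\<dots> = q (\<Oplus>k\<in>{..<n}. u i k \<otimes> star P (u j k))"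
    by (rule linear_map_finsum[OF Ps Ks q_linear, symmetric]) (use u ij in \<open>auto simp: star_closed\<close>)
  finally show "(\<Oplus>\<^bsub>K\<^esub>k\<in>{..<n}. q (u i k) \<otimes>\<^bsub>K\<^esub> star K (q (u j k))) = (if i = j then \<one>\<^bsub>K\<^esub> else \<zero>\<^bsub>K\<^esub>)"
    using u' by (simp add: q_one q_zero)
  have "(\<Oplus>\<^bsub>K\<^esub>k\<in>{..<n}. star K (q (u k i)) \<otimes>\<^bsub>K\<^esub> q (u k j)) = (\<Oplus>\<^bsub>K\<^esub>k\<in>{..<n}. q (star P (u k i) \<otimes> u k j))"
    by (rule K.finsum_cong') (use u ij in \<open>auto simp: q_mult q_star star_closed K.star_closed\<close>)
  also have "\<dots> = q (\<Oplus>k\<in>{..<n}. star P (u k i) \<otimes> u k j)"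
    by (rule linear_map_finsum[OF Ps Ks q_linear, symmetric]) (use u ij in \<open>auto simp: star_closed\<close>)
  finally show "(\<Oplus>\<^bsub>K\<^esub>k\<in>{..<n}. star K (q (u k i)) \<otimes>\<^bsub>K\<^esub> q (u k j)) = (if i = j then \<one>\<^bsub>K\<^esub> else \<zero>\<^bsub>K\<^esub>)"
    using u' by (simp add: q_one q_zero)
qed

lemma coefficientsK_span:
  assumes "X \<in> carrier K"
  shows "\<exists>(m::nat) c x. x \<in> {..<m} \<rightarrow> matrix_coeffs K \<and> X = (\<Oplus>\<^bsub>K\<^esub>l\<in>{..<m}. c l \<odot>\<^bsub>K\<^esub> x l)"
proof -
  obtain a where a: "a \<in> carrier P" "X = q a" using assms by (metis quotient_cases)
  obtain m :: nat and c x where x: "x \<in> {..<m} \<rightarrow> matrix_coeffs P" "a = (\<Oplus>l\<in>{..<m}. c l \<odot> x l)"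
    using coefficients_span[OF a(1)] by blast
  have mc: "q y \<in> matrix_coeffs K" "y \<in> carrier P" if y: "y \<in> matrix_coeffs P" for y
  proof -
    obtain u n i j where u: "unitary_rep P n u" "i < n" "j < n" "y = u i j"
      using y by (auto simp: matrix_coeffs_def)
    then show "y \<in> carrier P" by simp
    show "q y \<in> matrix_coeffs K"
      unfolding matrix_coeffs_def
      by (rule CollectI, rule exI[of _ "\<lambda>i j. q (u i j)"], rule exI[of _ n], rule exI[of _ i], rule exI[of _ j])
         (simp add: u unitary_rep_q)
  qed
  have xc: "x l \<in> carrier P" if "l < m" for l using x(1) mc(2) that by auto
  have "X = (\<Oplus>\<^bsub>K\<^esub>l\<in>{..<m}. q (c l \<odot> x l))"
    unfolding a(2) x(2)
    by (rule linear_map_finsum[OF complex_space_axioms K.complex_space_axioms q_linear]) (use xc in auto)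
  also have "\<dots> = (\<Oplus>\<^bsub>K\<^esub>l\<in>{..<m}. c l \<odot>\<^bsub>K\<^esub> q (x l))"
    by (rule K.finsum_cong') (use xc in \<open>auto simp: q_scale\<close>)
  finally have "X = (\<Oplus>\<^bsub>K\<^esub>l\<in>{..<m}. c l \<odot>\<^bsub>K\<^esub> q (x l))" .
  moreover have "(\<lambda>l. q (x l)) \<in> {..<m} \<rightarrow> matrix_coeffs K" using x(1) mc(1) by (simp add: Pi_iff)
  ultimately show ?thesis by (intro exI[of _ m] exI[of _ c] exI[of _ "\<lambda>l. q (x l)"]) simp
qed

lemma quotient_cqg: "cqg K counitK antipodeK"
  by unfold_locales
     (simp_all add: comultK_star_hom comultK_coassociative counitK_hom counitK_linear antipodeK_linear
        counitK_left counitK_right antipodeK_left antipodeK_right coefficientsK_span)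

lemma quotient_closed_qsubgroup: "closed_qsubgroup P K q"
  unfolding closed_qsubgroup_def cqg_algebra_iff
  using cqg_axioms quotient_cqg q_hom q_surj q_comult by blast

lemma quotient_kac_type: "kac_type K"
proof -
  obtain h where h: "tracial_state P h" and inv: "\<And>a. a \<in> carrier P \<Longrightarrow> invariant_at h a"
    using tracial_haar_modulo_kac_ideal by blast
  note t = tracial_stateD[OF h] and van = kac_ideal_vanish[OF _ h]
  define hK where "hK X = h (section_of X)" for X
  have hq: "hK (q a) = h a" if "a \<in> carrier P" for a
    unfolding hK_def by (rule descend[OF t(2) van that])
  have lin: "linear_functional K hK"
    using descend_linear[OF t(2) van] by (simp add: hK_def[abs_def])
  have "state K hK"
    unfolding state_def
  proof (intro conjI ballI lin)
    show "hK \<one>\<^bsub>K\<^esub> = 1" using hq[OF one_closed] t(4) by (simp add: q_one)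
    fix X assume "X \<in> carrier K"
    then obtain a where "a \<in> carrier P" "X = q a" by (metis quotient_cases)
    then show "hK (star K X \<otimes>\<^bsub>K\<^esub> X) \<in> \<real>\<^sub>\<ge>\<^sub>0"
      using t(5) by (simp add: q_star[symmetric] q_mult[symmetric] hq star_closed)
  qed
  moreover have "tracial K hK"
    unfolding tracial_def
  proof (intro ballI)
    fix X Y assume "X \<in> carrier K" "Y \<in> carrier K"
    then obtain a b where "a \<in> carrier P" "b \<in> carrier P" "X = q a" "Y = q b" by (metis quotient_cases)
    then show "hK (X \<otimes>\<^bsub>K\<^esub> Y) = hK (Y \<otimes>\<^bsub>K\<^esub> X)" using t(6) by (simp add: q_mult[symmetric] hq)
  qed
  moreover have "tensor_lift K K K (\<lambda>x y. hK y \<odot>\<^bsub>K\<^esub> x) (comult K X) = hK X \<odot>\<^bsub>K\<^esub> \<one>\<^bsub>K\<^esub> \<and>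
      tensor_lift K K K (\<lambda>x y. hK x \<odot>\<^bsub>K\<^esub> y) (comult K X) = hK X \<odot>\<^bsub>K\<^esub> \<one>\<^bsub>K\<^esub>"
    if X: "X \<in> carrier K" for X
  proof -
    obtain a where a: "a \<in> carrier P" "X = q a" using X by (metis quotient_cases)
    have v: "hK X \<odot>\<^bsub>K\<^esub> \<one>\<^bsub>K\<^esub> = q (h a \<odot> \<one>)" "h a \<odot> \<one> \<in> carrier P"
      using a by (simp_all add: hq q_scale q_one)
    have 1: "comult P a (\<lambda>x y. f x * hK (q y)) = f (h a \<odot> \<one>)"
      if f: "linear_functional P f" "\<And>x. x \<in> kac_ideal P \<Longrightarrow> f x = 0" for f
    proof -
      have "comult P a (\<lambda>x y. f x * hK (q y)) = convolve P f h a"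
        unfolding convolve_def
        by (rule tensor_eval_cong[OF comult_closed[OF a(1)]
              product_form[OF f(1) linear_functional_comp[OF lin q_linear]] product_form[OF f(1) t(2)]])
           (simp add: hq)
      then show ?thesis using invariant_atD(1)[OF inv[OF a(1)] f] linear_functional_scale[OF f(1) one_closed] by simp
    qed
    have 2: "comult P a (\<lambda>x y. hK (q x) * f y) = f (h a \<odot> \<one>)"
      if f: "linear_functional P f" "\<And>x. x \<in> kac_ideal P \<Longrightarrow> f x = 0" for f
    proof -
      have "comult P a (\<lambda>x y. hK (q x) * f y) = convolve P h f a"
        unfolding convolve_def
        by (rule tensor_eval_cong[OF comult_closed[OF a(1)]
              product_form[OF linear_functional_comp[OF lin q_linear] f(1)] product_form[OF t(2) f(1)]])
           (simp add: hq)
      then show ?thesis using invariant_atD(2)[OF inv[OF a(1)] f] linear_functional_scale[OF f(1) one_closed] by simp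
    qed
    show ?thesis
      unfolding v(1) unfolding a(2)
      by (intro conjI lift_scale_right[OF lin a(1) v(2) 1] lift_scale_left[OF lin a(1) v(2) 2])
  qed
  ultimately have "haar_state K hK" by (simp add: haar_state_def)
  then show ?thesis
    using \<open>tracial K hK\<close> quotient_cqg unfolding kac_type_def cqg_algebra_iff by blast
qed

end


section \<open>Faithfulness of the Haar state\<close>

lemma (in cqg) haar_state_right_invariant:
  assumes h: "haar_state P h" and f: "linear_functional P f" and a: "a \<in> carrier P"
  shows "convolve P f h a = h a * f \<one>"
proof -
  have lin: "linear_functional P h" using h by (simp add: haar_state_def state_def)
  show ?thesis
    using tensor_lift_scale_right[OF comult_closed[OF a] lin f] h a
    by (simp add: convolve_def haar_state_def linear_functional_scale[OF f])
qed

text \<open>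
  Invariance of h at the products of w m l with a contains the factors w m p next to the first
  tensor factors of a; multiplying by the adjoint of w and summing removes them.
\<close>

lemma (in cqg) strong_invariance:
  assumes h: "haar_state P h" and f: "linear_functional P f" and a: "a \<in> carrier P"
    and w: "unitary_rep P n w" and k: "k < n" and l: "l < n"
  shows "comult P a (\<lambda>x y. f x * h (w k l \<otimes> y)) = (\<Sum>m<n. h (w m l \<otimes> a) * f (star P (w m k)))"
proof -
  have lin: "linear_functional P h" using h by (simp add: haar_state_def state_def)
  obtain N x y where r: "tensor_rep P P (comult P a) N x y"
    using tensor_rep_exists[OF comult_closed[OF a]] by blast
  note xy = tensor_repD[OF r]
  have "(\<Sum>p<n. \<Sum>i<N. f (star P (w m k) \<otimes> (w m p \<otimes> x i)) * h (w p l \<otimes> y i)) =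
      h (w m l \<otimes> a) * f (star P (w m k))" if m: "m < n" for m
  proof -
    have g: "linear_functional P (\<lambda>z. f (star P (w m k) \<otimes> z))"
      using linear_functional_mult_left[OF f] w m k by (simp add: star_closed)
    have s: "tensor_rep P P (comult P (w m l)) n (\<lambda>p. w m p) (\<lambda>p. w p l)"
      using w m l by (simp add: tensor_rep_def comult_unitary[OF w m l])
    have "convolve P (\<lambda>z. f (star P (w m k) \<otimes> z)) h (w m l \<otimes> a) =
        (\<Sum>p<n. \<Sum>i<N. f (star P (w m k) \<otimes> (w m p \<otimes> x i)) * h (w p l \<otimes> y i))"
      unfolding convolve_def comult_mult[OF unitary_closed[OF w m l] a]
      by (rule tensor_mult_rep[OF star_algebra_axioms star_algebra_axioms s r product_form[OF g lin]])
    then show ?thesis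
      using haar_state_right_invariant[OF h g, of "w m l \<otimes> a"] w m k l a by (simp add: star_closed)
  qed
  then have "(\<Sum>m<n. h (w m l \<otimes> a) * f (star P (w m k))) =
      (\<Sum>m<n. \<Sum>p<n. \<Sum>i<N. f (star P (w m k) \<otimes> (w m p \<otimes> x i)) * h (w p l \<otimes> y i))" by simp
  also have "\<dots> = (\<Sum>p<n. \<Sum>m<n. \<Sum>i<N. f (star P (w m k) \<otimes> (w m p \<otimes> x i)) * h (w p l \<otimes> y i))"
    by (rule sum.swap)
  also have "\<dots> = (\<Sum>p<n. \<Sum>i<N. \<Sum>m<n. f (star P (w m k) \<otimes> (w m p \<otimes> x i)) * h (w p l \<otimes> y i))"
    by (rule sum.cong[OF refl], rule sum.swap)
  also have "\<dots> = (\<Sum>p<n. if p = k then \<Sum>i<N. f (x i) * h (w p l \<otimes> y i) else 0)"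
  proof (rule sum.cong[OF refl])
    fix p assume "p \<in> {..<n}" then have p: "p < n" by simp
    have "(\<Sum>m<n. f (star P (w m k) \<otimes> (w m p \<otimes> x i))) = (if p = k then f (x i) else 0)" if i: "i < N" for i
    proof -
      have "(\<Sum>m<n. f (star P (w m k) \<otimes> (w m p \<otimes> x i))) = (\<Sum>m<n. f (star P (w m k) \<otimes> w m p \<otimes> x i))"
        using w k p xy(1)[OF i] by (intro sum.cong refl) (simp add: m_assoc star_closed)
      also have "\<dots> = (if p = k then f (x i) else 0)"
        using unitary_left[OF w k p linear_functional_mult_right[OF f xy(1)[OF i]]] xy(1)[OF i]
        by (cases "p = k") simp_all
      finally show ?thesis .
    qed
    then show "(\<Sum>i<N. \<Sum>m<n. f (star P (w m k) \<otimes> (w m p \<otimes> x i)) * h (w p l \<otimes> y i)) =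
        (if p = k then \<Sum>i<N. f (x i) * h (w p l \<otimes> y i) else 0)"
      by (simp flip: sum_distrib_right)
  qed
  also have "\<dots> = (\<Sum>i<N. f (x i) * h (w k l \<otimes> y i))" using k by simp
  also have "\<dots> = comult P a (\<lambda>x y. f x * h (w k l \<otimes> y))"
    using xy(3)[OF product_form[OF f linear_functional_mult_left[OF lin unitary_closed[OF w k l]]]] by simp
  finally show ?thesis by simp
qed

text \<open>
  Let N be the left kernel of h, the set of all b with h (z b) = 0 for every z. It is a left ideal, and
  by strong invariance the comultiplication maps N into the tensor product of P and N. By the antipode
  law the number \<epsilon> b times 1 then lies in N for b in N, so that \<epsilon> vanishes on N. By the counit
  law every functional vanishes on N.
\<close>

lemma (in cqg) haar_state_faithful:
  assumes h: "haar_state P h" and a: "a \<in> carrier P" and null: "h (star P a \<otimes> a) = 0"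
  shows "a = \<zero>"
proof -
  have st: "state P h" using h by (simp add: haar_state_def)
  have lin: "linear_functional P h" and h1: "h \<one> = 1" using st by (simp_all add: state_def)
  define N where "N = {b \<in> carrier P. \<forall>z\<in>carrier P. h (z \<otimes> b) = 0}"
  have N: "linear_subspace P N"
    unfolding linear_subspace_def N_def
    by (auto simp: r_distr smult_mult_r linear_functional_add[OF lin] linear_functional_scale[OF lin]
        linear_functional_zero[OF lin])
  have aN: "a \<in> N"
  proof -
    have "h (z \<otimes> a) = 0" if z: "z \<in> carrier P" for z
      using Cauchy_Schwarz(2)[OF positive_functional_state[OF st], of "star P z" a] null z a
      by (simp add: star_closed star_star)
    then show ?thesis using a by (simp add: N_def)
  qed
  have slices: "comult P b (\<lambda>x y. f x * g y) = 0"
    if b: "b \<in> N" and f: "linear_functional P f"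
      and g: "linear_functional P g" "\<And>y. y \<in> N \<Longrightarrow> g y = 0" for b f g
  proof -
    have bc: "b \<in> carrier P" using b by (simp add: N_def)
    obtain n x y where r: "tensor_rep P P (comult P b) n x y"
      using tensor_rep_exists[OF comult_closed[OF bc]] by blast
    note xy = tensor_repD[OF r]
    have *: "(\<Sum>i<n. f (x i) * h (z \<otimes> y i)) = 0" if "z \<in> carrier P" for z
      using that
    proof (induction rule: coefficient_induct)
      case (coefficient m w k l)
      have "(\<Sum>i<n. f (x i) * h (w k l \<otimes> y i)) = comult P b (\<lambda>x y. f x * h (w k l \<otimes> y))"
        using xy(3)[OF product_form[OF f linear_functional_mult_left[OF lin unitary_closed[OF coefficient]]]] by simp
      then show ?case
        using strong_invariance[OF h f bc coefficient] b coefficient by (simp add: N_def)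
    next
      case zero
      then show ?case using xy(2) by (simp add: linear_functional_zero[OF lin])
    next
      case (add c d)
      then show ?case using xy(2)
        by (simp add: l_distr linear_functional_add[OF lin] algebra_simps sum.distrib)
    next
      case (scale k c)
      then show ?case using xy(2)
        by (simp add: smult_mult_l linear_functional_scale[OF lin] mult.left_commute flip: sum_distrib_left)
    qed
    let ?w = "\<Oplus>i\<in>{..<n}. f (x i) \<odot> y i"
    have "h (z \<otimes> ?w) = 0" if "z \<in> carrier P" for z
      using *[OF that] functional_combination[OF linear_functional_mult_left[OF lin that], of n y] xy(2) by simp
    then have "?w \<in> N" using xy(2) by (simp add: N_def)
    then have "(\<Sum>i<n. f (x i) * g (y i)) = 0"
      using g(2) functional_combination[OF g(1), of n y "\<lambda>i. f (x i)"] xy(2) by simp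
    then show ?thesis by (simp add: xy(3)[OF product_form[OF f g(1)]])
  qed
  have vanish: "comult P b \<beta> = 0"
    if b: "b \<in> N" and \<beta>: "\<beta> \<in> bilinear_forms P P" "\<And>x y. x \<in> carrier P \<Longrightarrow> y \<in> N \<Longrightarrow> \<beta> x y = 0" for b \<beta>
  proof (rule tensor_slices_vanish[OF complex_space_axioms complex_space_axioms linear_subspace_zero N _ \<beta>(1) _ \<beta>(2)])
    show "comult P b \<in> carrier (tensor_algebra P P)" using b by (simp add: N_def)
    show "\<beta> x y = 0" if "x \<in> {\<zero>}" "y \<in> carrier P" for x y
      using that bilinear_forms_simps(3)[OF \<beta>(1), of \<zero> y 0] by simp
    show "comult P b (\<lambda>x y. f x * g y) = 0"
      if "linear_functional P f" "linear_functional P g" "\<And>y. y \<in> N \<Longrightarrow> g y = 0" for f g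
      by (rule slices[OF b that])
  qed
  have counit: "\<epsilon> b = 0" if b: "b \<in> N" for b
  proof -
    have bc: "b \<in> carrier P" using b by (simp add: N_def)
    have "comult P b (\<lambda>x y. h (S x \<otimes> y)) = 0"
      by (rule vanish[OF b linear_functional_comp_bilinear[OF lin antipode_left_bilinear]]) (simp add: N_def)
    then show ?thesis using antipode_left[OF bc lin] h1 by simp
  qed
  show ?thesis
  proof (rule eqI_functional[OF a zero_closed])
    fix g assume g: "linear_functional P g"
    have "comult P a (\<lambda>x y. g x * \<epsilon> y) = 0"
      by (rule vanish[OF aN product_form[OF g counit_linear]]) (simp add: counit)
    then show "g a = g \<zero>" using counit_right[OF a g] linear_functional_zero[OF g] by simp
  qed
qed

lemma tracial_state_comp:
  assumes A: "star_algebra A" and \<pi>: "star_hom A B \<pi>" and \<tau>: "tracial_state B \<tau>"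
  shows "tracial_state A (\<lambda>a. \<tau> (\<pi> a))"
proof -
  interpret A: star_algebra A by fact
  have hom: "\<pi> \<in> ring_hom A B" and lin: "linear_map A B \<pi>"
    and st: "\<And>x. x \<in> carrier A \<Longrightarrow> \<pi> (star A x) = star B (\<pi> x)"
    using \<pi> by (auto simp: star_hom_def)
  have cl: "\<pi> x \<in> carrier B" if "x \<in> carrier A" for x using ring_hom_closed[OF hom that] .
  show ?thesis
    using linear_functional_comp[OF tracial_stateD(2)[OF \<tau>] lin] tracial_stateD(4-6)[OF \<tau>]
    by (simp add: tracial_state_def state_def tracial_def ring_hom_one[OF hom] ring_hom_mult[OF hom]
        A.star_closed st cl)
qed

text \<open>
  The Haar state of H pulls back to a tracial state of G, and it is faithful on H.
\<close>

lemma kac_ideal_kac_type_quotient: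
  assumes H: "closed_qsubgroup G H \<pi>" "kac_type H" and a: "a \<in> kac_ideal G"
  shows "\<pi> a = \<zero>\<^bsub>H\<^esub>"
proof -
  obtain \<epsilon> S where "cqg G \<epsilon> S" using H(1) by (auto simp: closed_qsubgroup_def cqg_algebra_iff)
  then interpret G: cqg G \<epsilon> S .
  obtain \<epsilon>' S' where "cqg H \<epsilon>' S'" using H(1) by (auto simp: closed_qsubgroup_def cqg_algebra_iff)
  then interpret H: cqg H \<epsilon>' S' .
  obtain h where h: "haar_state H h" "tracial H h" using H(2) by (auto simp: kac_type_def)
  have \<pi>: "star_hom G H \<pi>" using H(1) by (simp add: closed_qsubgroup_def)
  have ac: "a \<in> carrier G" by (rule G.kac_ideal_closed[OF a])
  have hom: "\<pi> \<in> ring_hom G H" using \<pi> by (simp add: star_hom_def)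
  have "tracial_state H h" using h by (simp add: tracial_state_def haar_state_def)
  from G.kac_idealD(4)[OF a tracial_state_comp[OF G.star_algebra_axioms \<pi> this]]
  have "h (star H (\<pi> a) \<otimes>\<^bsub>H\<^esub> \<pi> a) = 0"
    using \<pi> ac by (simp add: ring_hom_mult[OF hom] G.star_closed star_hom_def)
  then show ?thesis using H.haar_state_faithful[OF h(1) ring_hom_closed[OF hom ac]] by simp
qed

section \<open>Tracial states extend to the universal completion\<close>

definition state_seminorm :: "('a, 'x) star_algebra_scheme \<Rightarrow> ('a \<Rightarrow> complex) \<Rightarrow> 'a \<Rightarrow> real" where
  "state_seminorm A \<tau> x = sqrt (Re (\<tau> (star A x \<otimes>\<^bsub>A\<^esub> x)))"

text \<open>
  The operator seminorm of the GNS representation of \<tau>, as the least bound for left multiplication.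
\<close>

definition GNS_seminorm :: "('a, 'x) star_algebra_scheme \<Rightarrow> ('a \<Rightarrow> complex) \<Rightarrow> 'a \<Rightarrow> real" where
  "GNS_seminorm A \<tau> a = Inf {K. 0 \<le> K \<and>
     (\<forall>x\<in>carrier A. state_seminorm A \<tau> (a \<otimes>\<^bsub>A\<^esub> x) \<le> K * state_seminorm A \<tau> x)}"

context star_algebra
begin

lemma state_seminorm_square:
  assumes "state A \<tau>" "x \<in> carrier A"
  shows "complex_of_real ((state_seminorm A \<tau> x)\<^sup>2) = \<tau> (star A x \<otimes> x)"
  using assms by (simp add: state_seminorm_def state_def complex_nonneg_Reals_iff complex_eq_iff)

lemma state_seminorm_nonneg: "state A \<tau> \<Longrightarrow> x \<in> carrier A \<Longrightarrow> 0 \<le> state_seminorm A \<tau> x"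
  by (simp add: state_seminorm_def state_def complex_nonneg_Reals_iff)

lemma state_Cauchy_Schwarz:
  assumes "state A \<tau>" "x \<in> carrier A" "y \<in> carrier A"
  shows "cmod (\<tau> (star A x \<otimes> y)) \<le> state_seminorm A \<tau> x * state_seminorm A \<tau> y"
proof (rule power2_le_imp_le)
  have "(cmod (\<tau> (star A x \<otimes> y)))\<^sup>2 \<le> Re (\<tau> (star A x \<otimes> x)) * Re (\<tau> (star A y \<otimes> y))"
    by (rule Cauchy_Schwarz(2)[OF positive_functional_state[OF assms(1)] assms(2,3)])
  also have "\<dots> = (state_seminorm A \<tau> x * state_seminorm A \<tau> y)\<^sup>2"
    using assms by (simp add: power_mult_distrib flip: state_seminorm_square)
  finally show "(cmod (\<tau> (star A x \<otimes> y)))\<^sup>2 \<le> (state_seminorm A \<tau> x * state_seminorm A \<tau> y)\<^sup>2" .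
qed (use assms state_seminorm_nonneg in simp)

lemma state_seminorm_scale:
  assumes "state A \<tau>" "x \<in> carrier A"
  shows "state_seminorm A \<tau> (k \<odot> x) = cmod k * state_seminorm A \<tau> x"
proof -
  have lin: "linear_functional A \<tau>" using assms by (simp add: state_def)
  have "\<tau> (star A (k \<odot> x) \<otimes> (k \<odot> x)) = complex_of_real ((cmod k)\<^sup>2) * \<tau> (star A x \<otimes> x)"
    using assms(2) complex_norm_square[of k]
    by (simp add: star_smult star_closed smult_mult_l smult_mult_r linear_functional_scale[OF lin] mult_ac)
  then show ?thesis by (simp add: state_seminorm_def real_sqrt_mult)
qed

lemma state_seminorm_triangle:
  assumes \<tau>: "state A \<tau>" and x: "x \<in> carrier A" and y: "y \<in> carrier A"
  shows "state_seminorm A \<tau> (x \<oplus> y) \<le> state_seminorm A \<tau> x + state_seminorm A \<tau> y"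
proof (rule power2_le_imp_le)
  let ?n = "state_seminorm A \<tau>"
  have lin: "linear_functional A \<tau>" using \<tau> by (simp add: state_def)
  have "complex_of_real ((?n (x \<oplus> y))\<^sup>2) =
      complex_of_real ((?n x)\<^sup>2) + \<tau> (star A x \<otimes> y) + \<tau> (star A y \<otimes> x) + complex_of_real ((?n y)\<^sup>2)"
    using \<tau> x y by (simp only: state_seminorm_square a_closed)
      (simp add: star_add star_closed l_distr r_distr linear_functional_add[OF lin])
  from arg_cong[OF this, of Re]
  have "(?n (x \<oplus> y))\<^sup>2 = (?n x)\<^sup>2 + Re (\<tau> (star A x \<otimes> y)) + Re (\<tau> (star A y \<otimes> x)) + (?n y)\<^sup>2" by simp
  also have "\<dots> \<le> (?n x)\<^sup>2 + ?n x * ?n y + ?n y * ?n x + (?n y)\<^sup>2"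
    by (intro add_mono order_refl order_trans[OF complex_Re_le_cmod] state_Cauchy_Schwarz \<tau> x y)
  also have "\<dots> = (?n x + ?n y)\<^sup>2" by (simp add: power2_sum)
  finally show "(?n (x \<oplus> y))\<^sup>2 \<le> (?n x + ?n y)\<^sup>2" .
qed (use assms state_seminorm_nonneg in simp)

end

context cqg
begin

text \<open>
  For an entry u i j of a unitary matrix the bound is 1, because star (u i j) times u i j is one of
  the positive terms in the sum over a column, which is 1.
\<close>

lemma left_mult_bounded:
  assumes \<tau>: "state P \<tau>" and a: "a \<in> carrier P"
  shows "\<exists>K\<ge>0. \<forall>x\<in>carrier P. state_seminorm P \<tau> (a \<otimes> x) \<le> K * state_seminorm P \<tau> x"
  using a
proof (induction rule: coefficient_induct)
  case (coefficient n u i j)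
  note u = coefficient(1) and i = coefficient(2) and j = coefficient(3)
  have lin: "linear_functional P \<tau>" using \<tau> by (simp add: state_def)
  have "state_seminorm P \<tau> (u i j \<otimes> x) \<le> state_seminorm P \<tau> x" if x: "x \<in> carrier P" for x
  proof -
    have uc: "u k j \<in> carrier P" if "k < n" for k using u j that by simp
    have nn: "0 \<le> Re (\<tau> (star P x \<otimes> (star P (u k j) \<otimes> u k j) \<otimes> x))" if k: "k < n" for k
    proof -
      have "\<tau> (star P (u k j \<otimes> x) \<otimes> (u k j \<otimes> x)) \<in> \<real>\<^sub>\<ge>\<^sub>0"
        using \<tau> uc[OF k] x by (simp add: state_def)
      then show ?thesis
        using uc[OF k] x by (simp add: star_mult star_closed m_assoc complex_nonneg_Reals_iff)
    qed
    have "Re (\<tau> (star P x \<otimes> (star P (u i j) \<otimes> u i j) \<otimes> x)) \<le>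
        (\<Sum>k<n. Re (\<tau> (star P x \<otimes> (star P (u k j) \<otimes> u k j) \<otimes> x)))"
      using i nn by (intro member_le_sum) auto
    also have "\<dots> = Re (\<Sum>k<n. \<tau> (star P x \<otimes> (star P (u k j) \<otimes> u k j) \<otimes> x))" by simp
    also have "(\<Sum>k<n. \<tau> (star P x \<otimes> (star P (u k j) \<otimes> u k j) \<otimes> x)) = \<tau> (star P x \<otimes> x)"
      using unitary_left[OF u j j linear_functional_mult_left[OF linear_functional_mult_right[OF lin x]
            star_closed[OF x]]] x by (simp add: star_closed)
    finally show ?thesis
      using uc[OF i] x by (simp add: state_seminorm_def star_mult star_closed m_assoc)
  qed
  then show ?case by (intro exI[of _ 1]) simp
next
  case zero
  have "state_seminorm P \<tau> \<zero> = 0" using state_seminorm_scale[OF \<tau> zero_closed, of 0] by simp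
  then show ?case by (intro exI[of _ 0]) simp
next
  case (add a b)
  then obtain K L where KL: "K \<ge> 0" "L \<ge> 0"
    "\<And>x. x \<in> carrier P \<Longrightarrow> state_seminorm P \<tau> (a \<otimes> x) \<le> K * state_seminorm P \<tau> x"
    "\<And>x. x \<in> carrier P \<Longrightarrow> state_seminorm P \<tau> (b \<otimes> x) \<le> L * state_seminorm P \<tau> x" by blast
  have "state_seminorm P \<tau> ((a \<oplus> b) \<otimes> x) \<le> (K + L) * state_seminorm P \<tau> x" if x: "x \<in> carrier P" for x
    using state_seminorm_triangle[OF \<tau>, of "a \<otimes> x" "b \<otimes> x"] KL(3,4)[OF x] add(1,2) x
    by (simp add: l_distr algebra_simps)
  then show ?case using KL by (intro exI[of _ "K + L"]) simp
next
  case (scale k a)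
  then obtain K where K: "K \<ge> 0"
    "\<And>x. x \<in> carrier P \<Longrightarrow> state_seminorm P \<tau> (a \<otimes> x) \<le> K * state_seminorm P \<tau> x" by blast
  have "state_seminorm P \<tau> ((k \<odot> a) \<otimes> x) \<le> (cmod k * K) * state_seminorm P \<tau> x" if x: "x \<in> carrier P" for x
    using K(2)[OF x] scale(1) x
    by (simp add: smult_mult_l state_seminorm_scale[OF \<tau>] mult.assoc mult_left_mono)
  then show ?case using K by (intro exI[of _ "cmod k * K"]) simp
qed

lemma GNS_seminorm_props:
  assumes \<tau>: "state P \<tau>" and a: "a \<in> carrier P"
  shows GNS_seminorm_nonneg: "0 \<le> GNS_seminorm P \<tau> a"
    and GNS_seminorm_bound: "x \<in> carrier P \<Longrightarrow>
      state_seminorm P \<tau> (a \<otimes> x) \<le> GNS_seminorm P \<tau> a * state_seminorm P \<tau> x"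
    and GNS_seminorm_least: "0 \<le> K \<Longrightarrow>
      (\<And>x. x \<in> carrier P \<Longrightarrow> state_seminorm P \<tau> (a \<otimes> x) \<le> K * state_seminorm P \<tau> x) \<Longrightarrow>
      GNS_seminorm P \<tau> a \<le> K"
proof -
  let ?B = "{K. 0 \<le> K \<and> (\<forall>x\<in>carrier P. state_seminorm P \<tau> (a \<otimes> x) \<le> K * state_seminorm P \<tau> x)}"
  have ne: "?B \<noteq> {}" using left_mult_bounded[OF assms] by blast
  have bdd: "bdd_below ?B" by (rule bdd_belowI[of _ 0]) simp
  show "0 \<le> GNS_seminorm P \<tau> a"
    unfolding GNS_seminorm_def by (rule cInf_greatest[OF ne]) simp
  show "GNS_seminorm P \<tau> a \<le> K"
    if "0 \<le> K" "\<And>x. x \<in> carrier P \<Longrightarrow> state_seminorm P \<tau> (a \<otimes> x) \<le> K * state_seminorm P \<tau> x"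
    unfolding GNS_seminorm_def by (rule cInf_lower[OF _ bdd]) (use that in simp)
  show "state_seminorm P \<tau> (a \<otimes> x) \<le> GNS_seminorm P \<tau> a * state_seminorm P \<tau> x"
    if x: "x \<in> carrier P"
  proof (cases "state_seminorm P \<tau> x = 0")
    case True
    then show ?thesis using left_mult_bounded[OF assms] x by force
  next
    case False
    then have pos: "0 < state_seminorm P \<tau> x" using state_seminorm_nonneg[OF \<tau> x] by simp
    have "state_seminorm P \<tau> (a \<otimes> x) / state_seminorm P \<tau> x \<le> GNS_seminorm P \<tau> a"
      unfolding GNS_seminorm_def
      by (rule cInf_greatest[OF ne]) (use x pos in \<open>auto simp: divide_le_eq\<close>)
    then show ?thesis using pos by (simp add: divide_le_eq)
  qed
qed

lemma GNS_cstar_seminorm: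
  assumes \<tau>: "state P \<tau>"
  shows "cstar_seminorm P (GNS_seminorm P \<tau>)"
proof -
  let ?n = "state_seminorm P \<tau>" and ?p = "GNS_seminorm P \<tau>"
  note nonneg = GNS_seminorm_nonneg[OF \<tau>] and bound = GNS_seminorm_bound[OF \<tau>]
    and least = GNS_seminorm_least[OF \<tau>] and n_nonneg = state_seminorm_nonneg[OF \<tau>]
  have add: "?p (a \<oplus> b) \<le> ?p a + ?p b" if a: "a \<in> carrier P" and b: "b \<in> carrier P" for a b
  proof (rule least)
    fix x assume x: "x \<in> carrier P"
    have "?n ((a \<oplus> b) \<otimes> x) \<le> ?n (a \<otimes> x) + ?n (b \<otimes> x)"
      using state_seminorm_triangle[OF \<tau>, of "a \<otimes> x" "b \<otimes> x"] a b x by (simp add: l_distr)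
    then show "?n ((a \<oplus> b) \<otimes> x) \<le> (?p a + ?p b) * ?n x"
      using bound[OF a x] bound[OF b x] by (simp add: algebra_simps)
  qed (use a b nonneg in simp_all)
  have mult: "?p (a \<otimes> b) \<le> ?p a * ?p b" if a: "a \<in> carrier P" and b: "b \<in> carrier P" for a b
  proof (rule least)
    fix x assume x: "x \<in> carrier P"
    have "?n (a \<otimes> (b \<otimes> x)) \<le> ?p a * ?n (b \<otimes> x)" using bound[OF a, of "b \<otimes> x"] b x by simp
    also have "\<dots> \<le> ?p a * (?p b * ?n x)" using bound[OF b x] nonneg[OF a] by (rule mult_left_mono)
    finally show "?n ((a \<otimes> b) \<otimes> x) \<le> (?p a * ?p b) * ?n x" using a b x by (simp add: m_assoc mult.assoc)
  qed (use a b nonneg in simp_all)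
  have scale_le: "?p (k \<odot> a) \<le> cmod k * ?p a" if a: "a \<in> carrier P" for a k
  proof (rule least)
    fix x assume x: "x \<in> carrier P"
    show "?n ((k \<odot> a) \<otimes> x) \<le> (cmod k * ?p a) * ?n x"
      using bound[OF a x] a x by (simp add: smult_mult_l state_seminorm_scale[OF \<tau>] mult.assoc mult_left_mono)
  qed (use a nonneg in simp_all)
  have scale: "?p (k \<odot> a) = cmod k * ?p a" if a: "a \<in> carrier P" for a k
  proof (cases "k = 0")
    case True
    then show ?thesis using scale_le[OF a, of 0] nonneg[of "k \<odot> a"] a by simp
  next
    case False
    have "?p a \<le> cmod (1 / k) * ?p (k \<odot> a)"
      using scale_le[of "k \<odot> a" "1 / k"] a False by (simp add: scale_scale)
    then have "cmod k * ?p a \<le> ?p (k \<odot> a)" using False by (simp add: norm_divide field_simps)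
    then show ?thesis using scale_le[OF a, of k] by simp
  qed
  have square_le: "(?p a)\<^sup>2 \<le> ?p (star P a \<otimes> a)" if a: "a \<in> carrier P" for a
  proof -
    have "?p a \<le> sqrt (?p (star P a \<otimes> a))"
    proof (rule least)
      fix x assume x: "x \<in> carrier P"
      show "?n (a \<otimes> x) \<le> sqrt (?p (star P a \<otimes> a)) * ?n x"
      proof (rule power2_le_imp_le)
        have "complex_of_real ((?n (a \<otimes> x))\<^sup>2) = \<tau> (star P x \<otimes> (star P a \<otimes> a \<otimes> x))"
          using a x by (simp only: state_seminorm_square[OF \<tau>] m_closed) (simp add: star_mult star_closed m_assoc)
        then have "(?n (a \<otimes> x))\<^sup>2 = Re (\<tau> (star P x \<otimes> (star P a \<otimes> a \<otimes> x)))" by (metis Re_complex_of_real)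
        also have "\<dots> \<le> ?n x * ?n (star P a \<otimes> a \<otimes> x)"
          using state_Cauchy_Schwarz[OF \<tau> x, of "star P a \<otimes> a \<otimes> x"] a x
            complex_Re_le_cmod[of "\<tau> (star P x \<otimes> (star P a \<otimes> a \<otimes> x))"] by (simp add: star_closed)
        also have "\<dots> \<le> ?n x * (?p (star P a \<otimes> a) * ?n x)"
          using bound[of "star P a \<otimes> a" x] a x n_nonneg[OF x] by (intro mult_left_mono) (simp_all add: star_closed)
        also have "\<dots> = (sqrt (?p (star P a \<otimes> a)) * ?n x)\<^sup>2"
          using nonneg[of "star P a \<otimes> a"] a by (simp add: power_mult_distrib power2_eq_square star_closed)
        finally show "(?n (a \<otimes> x))\<^sup>2 \<le> (sqrt (?p (star P a \<otimes> a)) * ?n x)\<^sup>2" .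
      qed (use a x nonneg n_nonneg in \<open>simp add: star_closed\<close>)
    qed (use a nonneg in \<open>simp_all add: star_closed\<close>)
    then have "(?p a)\<^sup>2 \<le> (sqrt (?p (star P a \<otimes> a)))\<^sup>2" using nonneg[OF a] by (rule power_mono)
    then show ?thesis using nonneg[of "star P a \<otimes> a"] a by (simp add: star_closed)
  qed
  have star_le: "?p a \<le> ?p (star P a)" if a: "a \<in> carrier P" for a
  proof (cases "?p a = 0")
    case True
    then show ?thesis using nonneg[of "star P a"] a by (simp add: star_closed)
  next
    case False
    have "?p a * ?p a \<le> ?p (star P a) * ?p a"
      using square_le[OF a] mult[of "star P a" a] a by (simp add: power2_eq_square star_closed)
    then show ?thesis using False nonneg[OF a] by simp
  qed
  have "?p (star P a \<otimes> a) = (?p a)\<^sup>2" if a: "a \<in> carrier P" for a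
  proof (rule antisym)
    have "?p (star P a) \<le> ?p a" using star_le[of "star P a"] a by (simp add: star_closed star_star)
    then have "?p (star P a) * ?p a \<le> ?p a * ?p a" using nonneg[OF a] by (rule mult_right_mono)
    then show "?p (star P a \<otimes> a) \<le> (?p a)\<^sup>2"
      using mult[of "star P a" a] a by (simp add: power2_eq_square star_closed)
  qed (rule square_le[OF a])
  then show ?thesis using nonneg scale add mult by (simp add: cstar_seminorm_def)
qed

lemma state_le_GNS_seminorm:
  assumes \<tau>: "state P \<tau>" and a: "a \<in> carrier P"
  shows "cmod (\<tau> a) \<le> GNS_seminorm P \<tau> a"
proof -
  have "state_seminorm P \<tau> \<one> = 1" using \<tau> by (simp add: state_seminorm_def star_one state_def)
  then show ?thesis
    using state_Cauchy_Schwarz[OF \<tau> one_closed a] GNS_seminorm_bound[OF \<tau> a one_closed] a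
    by (simp add: star_one)
qed

end


locale cstar_seminormed = star_algebra A for A :: "('a, 'x) star_algebra_scheme" (structure) +
  fixes p :: "'a \<Rightarrow> real"
  assumes seminorm: "cstar_seminorm A p"
begin

lemma nonneg: "x \<in> carrier A \<Longrightarrow> 0 \<le> p x"
  and square: "x \<in> carrier A \<Longrightarrow> p (star A x \<otimes> x) = (p x)\<^sup>2"
  and scale: "x \<in> carrier A \<Longrightarrow> p (k \<odot> x) = cmod k * p x"
  and triangle: "x \<in> carrier A \<Longrightarrow> y \<in> carrier A \<Longrightarrow> p (x \<oplus> y) \<le> p x + p y"
  and submult: "x \<in> carrier A \<Longrightarrow> y \<in> carrier A \<Longrightarrow> p (x \<otimes> y) \<le> p x * p y"
  using seminorm by (simp_all add: cstar_seminorm_def)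

lemma star_isometric:
  assumes x: "x \<in> carrier A" shows "p (star A x) = p x"
proof -
  have le: "p x \<le> p (star A x)" if x: "x \<in> carrier A" for x
  proof (cases "p x = 0")
    case True
    then show ?thesis using nonneg[OF star_closed[OF x]] by simp
  next
    case False
    have "p x * p x \<le> p (star A x) * p x"
      using submult[OF star_closed[OF x] x] square[OF x] by (simp add: power2_eq_square)
    then show ?thesis using False nonneg[OF x] by simp
  qed
  show ?thesis using le[OF x] le[OF star_closed[OF x]] x by (simp add: star_star)
qed

lemma diff_commute:
  assumes "x \<in> carrier A" "y \<in> carrier A" shows "p (x \<ominus> y) = p (y \<ominus> x)"
proof -
  have "x \<ominus> y = (-1) \<odot> (y \<ominus> x)"
    using assms by (simp add: a_minus_def minus_eq_scale scale_add_right scale_scale a_comm)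
  then show ?thesis using assms scale[of "y \<ominus> x" "-1"] by simp
qed

lemma diff_triangle:
  assumes "x \<in> carrier A" "y \<in> carrier A" "z \<in> carrier A"
  shows "p (x \<ominus> z) \<le> p (x \<ominus> y) + p (y \<ominus> z)"
proof -
  have "x \<ominus> z = (x \<ominus> y) \<oplus> (y \<ominus> z)"
    using assms by (simp add: a_minus_def a_assoc[symmetric]) (simp add: a_assoc l_neg)
  then show ?thesis using assms triangle[of "x \<ominus> y" "y \<ominus> z"] by simp
qed

definition converges :: "(nat \<Rightarrow> 'a) \<Rightarrow> 'a \<Rightarrow> bool" where
  "converges s x \<longleftrightarrow> (\<forall>n. s n \<in> carrier A) \<and> x \<in> carrier A \<and> (\<lambda>n. p (x \<ominus> s n)) \<longlonglongrightarrow> 0"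

lemma converges_dominated:
  assumes "\<And>n. s n \<in> carrier A" "x \<in> carrier A" "b \<longlonglongrightarrow> 0" "\<And>n. p (x \<ominus> s n) \<le> b n"
  shows "converges s x"
  unfolding converges_def
  using assms tendsto_sandwich[of "\<lambda>_. 0" "\<lambda>n. p (x \<ominus> s n)" sequentially b 0]
  by (simp add: nonneg)

lemma converges_const: "x \<in> carrier A \<Longrightarrow> converges (\<lambda>_. x) x"
  using scale[of \<zero> 0] by (simp add: converges_def a_minus_def r_neg)

lemma converges_add:
  assumes "converges s x" "converges t y" shows "converges (\<lambda>n. s n \<oplus> t n) (x \<oplus> y)"
proof (rule converges_dominated)
  have c: "\<And>n. s n \<in> carrier A" "x \<in> carrier A" "\<And>n. t n \<in> carrier A" "y \<in> carrier A"
    using assms by (simp_all add: converges_def)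
  then show "s n \<oplus> t n \<in> carrier A" "x \<oplus> y \<in> carrier A" for n by simp_all
  show "(\<lambda>n. p (x \<ominus> s n) + p (y \<ominus> t n)) \<longlonglongrightarrow> 0"
    using assms by (auto simp: converges_def intro: tendsto_add_zero)
  show "p (x \<oplus> y \<ominus> (s n \<oplus> t n)) \<le> p (x \<ominus> s n) + p (y \<ominus> t n)" for n
  proof -
    have "x \<oplus> y \<ominus> (s n \<oplus> t n) = (x \<ominus> s n) \<oplus> (y \<ominus> t n)"
      using c by (simp add: a_minus_def minus_add a_ac)
    then show ?thesis using triangle[of "x \<ominus> s n" "y \<ominus> t n"] c by simp
  qed
qed

lemma converges_scale:
  assumes "converges s x" shows "converges (\<lambda>n. k \<odot> s n) (k \<odot> x)"
proof (rule converges_dominated)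
  have c: "\<And>n. s n \<in> carrier A" "x \<in> carrier A" using assms by (simp_all add: converges_def)
  then show "k \<odot> s n \<in> carrier A" "k \<odot> x \<in> carrier A" for n by simp_all
  show "(\<lambda>n. cmod k * p (x \<ominus> s n)) \<longlonglongrightarrow> 0"
    using assms by (auto simp: converges_def intro: tendsto_mult_right_zero)
  show "p (k \<odot> x \<ominus> k \<odot> s n) \<le> cmod k * p (x \<ominus> s n)" for n
  proof -
    have "k \<odot> x \<ominus> k \<odot> s n = k \<odot> (x \<ominus> s n)"
      using c by (simp add: a_minus_def minus_eq_scale scale_add_right scale_scale)
    then show ?thesis using scale[of "x \<ominus> s n" k] c by simp
  qed
qed

lemma converges_star:
  assumes "converges s x" shows "converges (\<lambda>n. star A (s n)) (star A x)"
proof (rule converges_dominated)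
  have c: "\<And>n. s n \<in> carrier A" "x \<in> carrier A" using assms by (simp_all add: converges_def)
  then show "star A (s n) \<in> carrier A" "star A x \<in> carrier A" for n by (simp_all add: star_closed)
  show "(\<lambda>n. p (x \<ominus> s n)) \<longlonglongrightarrow> 0" using assms by (simp add: converges_def)
  show "p (star A x \<ominus> star A (s n)) \<le> p (x \<ominus> s n)" for n
  proof -
    have "star A x \<ominus> star A (s n) = star A (x \<ominus> s n)"
      using c by (simp add: a_minus_def minus_eq_scale star_add star_smult star_closed)
    then show ?thesis using star_isometric[of "x \<ominus> s n"] c by simp
  qed
qed

lemma converges_mult:
  assumes "converges s x" "converges t y" shows "converges (\<lambda>n. s n \<otimes> t n) (x \<otimes> y)"
proof (rule converges_dominated)
  have c: "\<And>n. s n \<in> carrier A" "x \<in> carrier A" "\<And>n. t n \<in> carrier A" "y \<in> carrier A"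
    using assms by (simp_all add: converges_def)
  have l: "(\<lambda>n. p (x \<ominus> s n)) \<longlonglongrightarrow> 0" "(\<lambda>n. p (y \<ominus> t n)) \<longlonglongrightarrow> 0"
    using assms by (simp_all add: converges_def)
  from c show "s n \<otimes> t n \<in> carrier A" "x \<otimes> y \<in> carrier A" for n by simp_all
  have "(\<lambda>n. p (x \<ominus> s n) * p y + (p x + p (x \<ominus> s n)) * p (y \<ominus> t n)) \<longlonglongrightarrow> 0 * p y + (p x + 0) * 0"
    by (intro tendsto_intros l)
  then show "(\<lambda>n. p (x \<ominus> s n) * p y + (p x + p (x \<ominus> s n)) * p (y \<ominus> t n)) \<longlonglongrightarrow> 0" by simp
  show "p (x \<otimes> y \<ominus> s n \<otimes> t n) \<le> p (x \<ominus> s n) * p y + (p x + p (x \<ominus> s n)) * p (y \<ominus> t n)" for n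
  proof -
    have "x \<otimes> y \<ominus> s n \<otimes> t n = (x \<ominus> s n) \<otimes> y \<oplus> s n \<otimes> (y \<ominus> t n)"
    proof -
      have "(x \<ominus> s n) \<otimes> y \<oplus> s n \<otimes> (y \<ominus> t n) =
          (x \<otimes> y \<oplus> (\<ominus> (s n \<otimes> y) \<oplus> s n \<otimes> y)) \<oplus> \<ominus> (s n \<otimes> t n)"
        using c by (simp add: a_minus_def l_distr r_distr l_minus r_minus a_assoc)
      then show ?thesis using c by (simp add: l_neg a_minus_def)
    qed
    then have "p (x \<otimes> y \<ominus> s n \<otimes> t n) \<le> p (x \<ominus> s n) * p y + p (s n) * p (y \<ominus> t n)"
      using triangle[of "(x \<ominus> s n) \<otimes> y" "s n \<otimes> (y \<ominus> t n)"] submult[of "x \<ominus> s n" y]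
        submult[of "s n" "y \<ominus> t n"] c by simp
    moreover have "p (s n) \<le> p x + p (x \<ominus> s n)"
    proof -
      have "s n = x \<oplus> (-1) \<odot> (x \<ominus> s n)"
        using c by (simp add: a_minus_def minus_eq_scale scale_add_right scale_scale flip: a_assoc)
          (simp add: minus_eq_scale[symmetric] r_neg)
      then have "p (s n) \<le> p x + p ((-1) \<odot> (x \<ominus> s n))"
        using triangle[of x "(-1) \<odot> (x \<ominus> s n)"] c by simp
      then show ?thesis using scale[of "x \<ominus> s n" "-1"] c by simp
    qed
    then have "p (s n) * p (y \<ominus> t n) \<le> (p x + p (x \<ominus> s n)) * p (y \<ominus> t n)"
      using c by (intro mult_right_mono nonneg) simp_all
    ultimately show ?thesis by simp
  qed
qed

end

text \<open>
  The state \<tau> is bounded by its GNS seminorm, hence by the norm of the completion, and so extends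
  by continuity. The extension is again a tracial state because the operations are continuous.
\<close>

lemma tracial_state_extends:
  assumes G: "cqg_algebra G" and C: "universal_completion G C \<iota>" and \<tau>: "tracial_state G \<tau>"
  shows "\<exists>\<sigma>. tracial_state C \<sigma> \<and> (\<forall>a\<in>carrier G. \<sigma> (\<iota> a) = \<tau> a)"
proof -
  obtain \<epsilon> S where "cqg G \<epsilon> S" using G by (auto simp: cqg_algebra_iff)
  then interpret G: cqg G \<epsilon> S .
  have Ca: "star_algebra C" "cstar_seminorm C (cnorm C)" and \<iota>: "star_hom G C \<iota>"
    and dense: "\<And>c e. c \<in> carrier C \<Longrightarrow> 0 < e \<Longrightarrow> \<exists>a\<in>carrier G. cnorm C (c \<ominus>\<^bsub>C\<^esub> \<iota> a) < e"
    and largest: "\<And>p a. cstar_seminorm G p \<Longrightarrow> a \<in> carrier G \<Longrightarrow> p a \<le> cnorm C (\<iota> a)"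
    using C by (auto simp: universal_completion_def cstar_algebra_def)
  interpret C: cstar_seminormed C "cnorm C"
    using Ca by (simp add: cstar_seminormed_def cstar_seminormed_axioms_def)
  note t = tracial_stateD[OF \<tau>]
  have hom: "\<iota> \<in> ring_hom G C" and lin: "linear_map G C \<iota>"
    and star: "\<And>a. a \<in> carrier G \<Longrightarrow> \<iota> (star G a) = star C (\<iota> a)"
    using \<iota> by (auto simp: star_hom_def)
  have cl: "\<iota> a \<in> carrier C" if "a \<in> carrier G" for a using ring_hom_closed[OF hom that] .
  have bound: "cmod (\<tau> a) \<le> cnorm C (\<iota> a)" if "a \<in> carrier G" for a
    using G.state_le_GNS_seminorm[OF t(1) that] largest[OF G.GNS_cstar_seminorm[OF t(1)] that] by simp
  have diff: "cmod (\<tau> a - \<tau> b) \<le> cnorm C (\<iota> a \<ominus>\<^bsub>C\<^esub> \<iota> b)" if "a \<in> carrier G" "b \<in> carrier G" for a b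
  proof -
    have "\<iota> (a \<ominus>\<^bsub>G\<^esub> b) = \<iota> a \<ominus>\<^bsub>C\<^esub> \<iota> b"
      using that lin by (simp add: a_minus_def G.minus_eq_scale C.minus_eq_scale cl linear_map_def)
    then show ?thesis using bound[of "a \<ominus>\<^bsub>G\<^esub> b"] that by (simp add: G.linear_functional_diff[OF t(2)])
  qed
  have "\<exists>s. (\<forall>n. s n \<in> carrier G) \<and> C.converges (\<lambda>n. \<iota> (s n)) c" if c: "c \<in> carrier C" for c
  proof -
    have "\<forall>n::nat. \<exists>a. a \<in> carrier G \<and> cnorm C (c \<ominus>\<^bsub>C\<^esub> \<iota> a) < inverse (Suc n)"
      using dense[OF c] by (meson inverse_positive_iff_positive of_nat_0_less_iff zero_less_Suc)
    then obtain s where s: "\<And>n. s n \<in> carrier G" "\<And>n. cnorm C (c \<ominus>\<^bsub>C\<^esub> \<iota> (s n)) < inverse (Suc n)"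
      by metis
    have "C.converges (\<lambda>n. \<iota> (s n)) c"
      by (rule C.converges_dominated[OF _ c LIMSEQ_inverse_real_of_nat]) (use s cl in \<open>auto intro: less_imp_le\<close>)
    then show ?thesis using s(1) by blast
  qed
  then obtain s where s: "\<And>c n. c \<in> carrier C \<Longrightarrow> s c n \<in> carrier G"
    "\<And>c. c \<in> carrier C \<Longrightarrow> C.converges (\<lambda>n. \<iota> (s c n)) c" by metis
  have Cauchy_diff: "cmod (\<tau> a - \<tau> b) \<le> cnorm C (c \<ominus>\<^bsub>C\<^esub> \<iota> a) + cnorm C (c \<ominus>\<^bsub>C\<^esub> \<iota> b)"
    if "a \<in> carrier G" "b \<in> carrier G" "c \<in> carrier C" for a b c
    using diff[OF that(1,2)] C.diff_triangle[OF cl[OF that(1)] that(3) cl[OF that(2)]]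
      C.diff_commute[OF cl[OF that(1)] that(3)] by simp
  define \<sigma> where "\<sigma> c = lim (\<lambda>n. \<tau> (s c n))" for c
  have lim_s: "(\<lambda>n. \<tau> (s c n)) \<longlonglongrightarrow> \<sigma> c" if c: "c \<in> carrier C" for c
  proof -
    have z: "(\<lambda>n. cnorm C (c \<ominus>\<^bsub>C\<^esub> \<iota> (s c n))) \<longlonglongrightarrow> 0" using s(2)[OF c] by (simp add: C.converges_def)
    have "Cauchy (\<lambda>n. \<tau> (s c n))"
    proof (rule CauchyI)
      fix e :: real assume "0 < e"
      then obtain N where N: "\<And>n. n \<ge> N \<Longrightarrow> cnorm C (c \<ominus>\<^bsub>C\<^esub> \<iota> (s c n)) < e / 2"
        using z unfolding LIMSEQ_iff by (metis abs_less_iff diff_zero half_gt_zero real_norm_def)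
      have "cmod (\<tau> (s c m) - \<tau> (s c n)) < e" if "m \<ge> N" "n \<ge> N" for m n
        using Cauchy_diff[OF s(1)[OF c, of m] s(1)[OF c, of n] c] N[OF that(1)] N[OF that(2)] by simp
      then show "\<exists>M. \<forall>m\<ge>M. \<forall>n\<ge>M. cmod (\<tau> (s c m) - \<tau> (s c n)) < e" by blast
    qed
    then show ?thesis unfolding \<sigma>_def by (simp add: Cauchy_convergent_iff convergent_LIMSEQ_iff)
  qed
  have lim: "(\<lambda>n. \<tau> (r n)) \<longlonglongrightarrow> \<sigma> c"
    if r: "\<And>n. r n \<in> carrier G" and conv: "C.converges (\<lambda>n. \<iota> (r n)) c" for r c
  proof -
    have c: "c \<in> carrier C" using conv by (simp add: C.converges_def)
    have "(\<lambda>n. cnorm C (c \<ominus>\<^bsub>C\<^esub> \<iota> (r n)) + cnorm C (c \<ominus>\<^bsub>C\<^esub> \<iota> (s c n))) \<longlonglongrightarrow> 0"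
      using conv s(2)[OF c] by (auto simp: C.converges_def intro: tendsto_add_zero)
    then have "(\<lambda>n. \<tau> (r n) - \<tau> (s c n)) \<longlonglongrightarrow> 0"
      by (rule Lim_null_comparison[rotated]) (use Cauchy_diff[OF r s(1)[OF c] c] in simp)
    from tendsto_add[OF this lim_s[OF c]] show ?thesis by simp
  qed
  have eq: "\<sigma> c = l" if "\<And>n. r n \<in> carrier G" "C.converges (\<lambda>n. \<iota> (r n)) c" "(\<lambda>n. \<tau> (r n)) \<longlonglongrightarrow> l" for r c l
    by (rule LIMSEQ_unique[OF lim[OF that(1,2)] that(3)])
  have ext: "\<sigma> (\<iota> a) = \<tau> a" if "a \<in> carrier G" for a
    by (rule eq[of "\<lambda>_. a"]) (use that cl C.converges_const in auto)
  have "tracial_state C \<sigma>"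
    unfolding tracial_state_def state_def tracial_def linear_functional_def
  proof (intro conjI ballI allI)
    fix c d assume c: "c \<in> carrier C" and d: "d \<in> carrier C"
    note sc = s[OF c] and sd = s[OF d]
    show "\<sigma> (c \<oplus>\<^bsub>C\<^esub> d) = \<sigma> c + \<sigma> d"
    proof (rule eq[of "\<lambda>n. s c n \<oplus>\<^bsub>G\<^esub> s d n"])
      have "\<iota> (s c n \<oplus>\<^bsub>G\<^esub> s d n) = \<iota> (s c n) \<oplus>\<^bsub>C\<^esub> \<iota> (s d n)" for n
        using lin sc(1)[of n] sd(1)[of n] by (simp add: linear_map_def)
      then show "C.converges (\<lambda>n. \<iota> (s c n \<oplus>\<^bsub>G\<^esub> s d n)) (c \<oplus>\<^bsub>C\<^esub> d)"
        using C.converges_add[OF sc(2) sd(2)] by simp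
      show "(\<lambda>n. \<tau> (s c n \<oplus>\<^bsub>G\<^esub> s d n)) \<longlonglongrightarrow> \<sigma> c + \<sigma> d"
        using tendsto_add[OF lim_s[OF c] lim_s[OF d]] sc(1) sd(1) by (simp add: linear_functional_add[OF t(2)])
    qed (use sc(1) sd(1) in simp)
    have conv: "C.converges (\<lambda>n. \<iota> (s c n \<otimes>\<^bsub>G\<^esub> s d n)) (c \<otimes>\<^bsub>C\<^esub> d)"
      if c: "c \<in> carrier C" and d: "d \<in> carrier C" for c d
      using C.converges_mult[OF s(2)[OF c] s(2)[OF d]] s(1)[OF c] s(1)[OF d] by (simp add: ring_hom_mult[OF hom])
    show "\<sigma> (c \<otimes>\<^bsub>C\<^esub> d) = \<sigma> (d \<otimes>\<^bsub>C\<^esub> c)"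
    proof (rule eq[OF _ conv[OF c d]])
      have "(\<lambda>n. \<tau> (s d n \<otimes>\<^bsub>G\<^esub> s c n)) \<longlonglongrightarrow> \<sigma> (d \<otimes>\<^bsub>C\<^esub> c)"
        by (rule lim[OF _ conv[OF d c]]) (use sc(1) sd(1) in simp)
      then show "(\<lambda>n. \<tau> (s c n \<otimes>\<^bsub>G\<^esub> s d n)) \<longlonglongrightarrow> \<sigma> (d \<otimes>\<^bsub>C\<^esub> c)"
        using t(6)[OF sc(1) sd(1)] by simp
    qed (use sc(1) sd(1) in simp)
  next
    fix k c assume c: "c \<in> carrier C"
    note sc = s[OF c]
    show "\<sigma> (k \<odot>\<^bsub>C\<^esub> c) = k * \<sigma> c"
    proof (rule eq[of "\<lambda>n. k \<odot>\<^bsub>G\<^esub> s c n"])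
      have "\<iota> (k \<odot>\<^bsub>G\<^esub> s c n) = k \<odot>\<^bsub>C\<^esub> \<iota> (s c n)" for n
        using lin sc(1)[of n] by (simp add: linear_map_def)
      then show "C.converges (\<lambda>n. \<iota> (k \<odot>\<^bsub>G\<^esub> s c n)) (k \<odot>\<^bsub>C\<^esub> c)"
        using C.converges_scale[OF sc(2)] by simp
      show "(\<lambda>n. \<tau> (k \<odot>\<^bsub>G\<^esub> s c n)) \<longlonglongrightarrow> k * \<sigma> c"
        using tendsto_mult_left[OF lim_s[OF c]] sc(1) by (simp add: linear_functional_scale[OF t(2)])
    qed (use sc(1) in simp)
  next
    show "\<sigma> \<one>\<^bsub>C\<^esub> = 1" using ext[of "\<one>\<^bsub>G\<^esub>"] t(4) by (simp add: ring_hom_one[OF hom])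
  next
    fix c assume c: "c \<in> carrier C"
    note sc = s[OF c]
    have "C.converges (\<lambda>n. \<iota> (star G (s c n) \<otimes>\<^bsub>G\<^esub> s c n)) (star C c \<otimes>\<^bsub>C\<^esub> c)"
      using C.converges_mult[OF C.converges_star[OF sc(2)] sc(2)] sc(1)
      by (simp add: ring_hom_mult[OF hom] star G.star_closed)
    from lim[OF _ this] have "(\<lambda>n. \<tau> (star G (s c n) \<otimes>\<^bsub>G\<^esub> s c n)) \<longlonglongrightarrow> \<sigma> (star C c \<otimes>\<^bsub>C\<^esub> c)"
      using sc(1) by (simp add: G.star_closed)
    then show "\<sigma> (star C c \<otimes>\<^bsub>C\<^esub> c) \<in> \<real>\<^sub>\<ge>\<^sub>0"
      by (rule Lim_in_closed_set[OF closed_nonneg_Reals_complex _ sequentially_bot, rotated])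
         (use t(5) sc(1) in simp)
  qed
  then show ?thesis using ext by blast
qed

text \<open>
  Restriction along \<iota> and extension by continuity match the tracial states of C with those of G.
\<close>

lemma kac_ideal_universal_completion:
  assumes G: "cqg_algebra G" and C: "universal_completion G C \<iota>" and a: "a \<in> carrier G"
  shows "\<iota> a \<in> kac_ideal C \<longleftrightarrow> a \<in> kac_ideal G"
proof -
  interpret G: star_algebra G using G by (auto simp: cqg_algebra_def hopf_star_algebra_def)
  interpret C: star_algebra C using C by (auto simp: universal_completion_def cstar_algebra_def)
  have \<iota>: "star_hom G C \<iota>" using C by (simp add: universal_completion_def)
  then have hom: "\<iota> \<in> ring_hom G C" and star: "\<iota> (star G a) = star C (\<iota> a)"
    using a by (auto simp: star_hom_def)
  have sq: "\<iota> (star G a \<otimes>\<^bsub>G\<^esub> a) = star C (\<iota> a) \<otimes>\<^bsub>C\<^esub> \<iota> a"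
    using a by (simp add: ring_hom_mult[OF hom] star G.star_closed)
  show ?thesis
  proof
    assume L: "\<iota> a \<in> kac_ideal C"
    show "a \<in> kac_ideal G"
    proof (rule G.kac_idealI[OF a])
      fix \<tau> assume "tracial_state G \<tau>"
      from tracial_state_extends[OF G C this] obtain \<sigma>
        where \<sigma>: "tracial_state C \<sigma>" "\<forall>a\<in>carrier G. \<sigma> (\<iota> a) = \<tau> a" by blast
      then show "\<tau> (star G a \<otimes>\<^bsub>G\<^esub> a) = 0"
        using C.kac_idealD(4)[OF L \<sigma>(1)] sq a by (metis G.m_closed G.star_closed)
    qed
  next
    assume R: "a \<in> kac_ideal G"
    show "\<iota> a \<in> kac_ideal C"
    proof (rule C.kac_idealI[OF ring_hom_closed[OF hom a]])
      fix \<sigma> assume "tracial_state C \<sigma>"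
      from G.kac_idealD(4)[OF R tracial_state_comp[OF G.star_algebra_axioms \<iota> this]]
      show "\<sigma> (star C (\<iota> a) \<otimes>\<^bsub>C\<^esub> \<iota> a) = 0" by (simp add: sq)
    qed
  qed
qed


section \<open>The canonical Kac quotient\<close>

lemma star_algebra_image:
  assumes P: "star_algebra P" and surj: "q ` carrier P = carrier K"
    and one: "\<one>\<^bsub>K\<^esub> = q \<one>\<^bsub>P\<^esub>" and zero: "\<zero>\<^bsub>K\<^esub> = q \<zero>\<^bsub>P\<^esub>"
    and add: "\<And>a b. a \<in> carrier P \<Longrightarrow> b \<in> carrier P \<Longrightarrow> q a \<oplus>\<^bsub>K\<^esub> q b = q (a \<oplus>\<^bsub>P\<^esub> b)"
    and mult: "\<And>a b. a \<in> carrier P \<Longrightarrow> b \<in> carrier P \<Longrightarrow> q a \<otimes>\<^bsub>K\<^esub> q b = q (a \<otimes>\<^bsub>P\<^esub> b)"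
    and scale: "\<And>k a. a \<in> carrier P \<Longrightarrow> k \<odot>\<^bsub>K\<^esub> q a = q (k \<odot>\<^bsub>P\<^esub> a)"
    and star: "\<And>a. a \<in> carrier P \<Longrightarrow> star K (q a) = q (star P a)"
  shows "star_algebra K" and "star_hom P K q"
proof -
  interpret P: star_algebra P by fact
  have cl: "q a \<in> carrier K" if "a \<in> carrier P" for a using surj that by blast
  have ex: "\<exists>a\<in>carrier P. X = q a" if "X \<in> carrier K" for X using surj that by blast
  note ops = add mult scale star one zero
  have abel: "abelian_group K"
  proof (rule abelian_groupI)
    fix X assume X: "X \<in> carrier K"
    then obtain a where a: "a \<in> carrier P" "X = q a" using ex by blast
    show "\<zero>\<^bsub>K\<^esub> \<oplus>\<^bsub>K\<^esub> X = X" using a by (simp add: ops)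
    show "\<exists>Y\<in>carrier K. Y \<oplus>\<^bsub>K\<^esub> X = \<zero>\<^bsub>K\<^esub>"
      by (rule bexI[of _ "q (\<ominus>\<^bsub>P\<^esub> a)"]) (use a cl in \<open>simp_all add: ops P.l_neg\<close>)
    fix Y assume "Y \<in> carrier K"
    then obtain b where b: "b \<in> carrier P" "Y = q b" using ex by blast
    show "X \<oplus>\<^bsub>K\<^esub> Y \<in> carrier K" using a b cl by (simp add: ops)
    show "X \<oplus>\<^bsub>K\<^esub> Y = Y \<oplus>\<^bsub>K\<^esub> X" using a b by (simp add: ops P.a_comm)
    fix Z assume "Z \<in> carrier K"
    then obtain c where c: "c \<in> carrier P" "Z = q c" using ex by blast
    show "X \<oplus>\<^bsub>K\<^esub> Y \<oplus>\<^bsub>K\<^esub> Z = X \<oplus>\<^bsub>K\<^esub> (Y \<oplus>\<^bsub>K\<^esub> Z)" using a b c by (simp add: ops P.a_assoc)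
  qed (use cl in \<open>simp add: zero\<close>)
  have ring: "ring K"
  proof (rule ringI[OF abel])
    show "Group.monoid K"
    proof (rule monoidI)
      fix X assume X: "X \<in> carrier K"
      then obtain a where a: "a \<in> carrier P" "X = q a" using ex by blast
      show "\<one>\<^bsub>K\<^esub> \<otimes>\<^bsub>K\<^esub> X = X" "X \<otimes>\<^bsub>K\<^esub> \<one>\<^bsub>K\<^esub> = X" using a by (simp_all add: ops)
      fix Y assume "Y \<in> carrier K"
      then obtain b where b: "b \<in> carrier P" "Y = q b" using ex by blast
      show "X \<otimes>\<^bsub>K\<^esub> Y \<in> carrier K" using a b cl by (simp add: ops)
      fix Z assume "Z \<in> carrier K"
      then obtain c where c: "c \<in> carrier P" "Z = q c" using ex by blast
      show "X \<otimes>\<^bsub>K\<^esub> Y \<otimes>\<^bsub>K\<^esub> Z = X \<otimes>\<^bsub>K\<^esub> (Y \<otimes>\<^bsub>K\<^esub> Z)" using a b c by (simp add: ops P.m_assoc)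
    qed (use cl in \<open>simp add: one\<close>)
    fix X Y Z assume "X \<in> carrier K" "Y \<in> carrier K" "Z \<in> carrier K"
    then obtain a b c where abc: "a \<in> carrier P" "X = q a" "b \<in> carrier P" "Y = q b" "c \<in> carrier P" "Z = q c"
      using ex by meson
    show "(X \<oplus>\<^bsub>K\<^esub> Y) \<otimes>\<^bsub>K\<^esub> Z = X \<otimes>\<^bsub>K\<^esub> Z \<oplus>\<^bsub>K\<^esub> Y \<otimes>\<^bsub>K\<^esub> Z" using abc by (simp add: ops P.l_distr)
    show "Z \<otimes>\<^bsub>K\<^esub> (X \<oplus>\<^bsub>K\<^esub> Y) = Z \<otimes>\<^bsub>K\<^esub> X \<oplus>\<^bsub>K\<^esub> Z \<otimes>\<^bsub>K\<^esub> Y" using abc by (simp add: ops P.r_distr)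
  qed
  have module: "module complex_ring K"
  proof (rule moduleI[OF cring_complex_ring abel])
    fix k l X Y assume "X \<in> carrier K"
    then obtain a where a: "a \<in> carrier P" "X = q a" using ex by blast
    show "k \<odot>\<^bsub>K\<^esub> X \<in> carrier K" using a cl by (simp add: ops)
    show "(k \<oplus>\<^bsub>complex_ring\<^esub> l) \<odot>\<^bsub>K\<^esub> X = k \<odot>\<^bsub>K\<^esub> X \<oplus>\<^bsub>K\<^esub> l \<odot>\<^bsub>K\<^esub> X"
      using a by (simp add: ops P.scale_add_left)
    show "(k \<otimes>\<^bsub>complex_ring\<^esub> l) \<odot>\<^bsub>K\<^esub> X = k \<odot>\<^bsub>K\<^esub> (l \<odot>\<^bsub>K\<^esub> X)" using a by (simp add: ops P.scale_scale)
    show "\<one>\<^bsub>complex_ring\<^esub> \<odot>\<^bsub>K\<^esub> X = X" using a by (simp add: ops)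
    assume "Y \<in> carrier K"
    then obtain b where b: "b \<in> carrier P" "Y = q b" using ex by blast
    show "k \<odot>\<^bsub>K\<^esub> (X \<oplus>\<^bsub>K\<^esub> Y) = k \<odot>\<^bsub>K\<^esub> X \<oplus>\<^bsub>K\<^esub> k \<odot>\<^bsub>K\<^esub> Y" using a b by (simp add: ops P.scale_add_right)
  qed
  show "star_algebra K"
  proof (rule star_algebra.intro[OF ring module], unfold_locales)
    fix k X Y assume "X \<in> carrier K"
    then obtain a where a: "a \<in> carrier P" "X = q a" using ex by blast
    show "star K X \<in> carrier K" using a cl by (simp add: ops P.star_closed)
    show "star K (star K X) = X" using a by (simp add: ops P.star_closed P.star_star)
    show "star K (k \<odot>\<^bsub>K\<^esub> X) = cnj k \<odot>\<^bsub>K\<^esub> star K X" using a by (simp add: ops P.star_closed P.star_smult)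
    assume "Y \<in> carrier K"
    then obtain b where b: "b \<in> carrier P" "Y = q b" using ex by blast
    show "(k \<odot>\<^bsub>K\<^esub> X) \<otimes>\<^bsub>K\<^esub> Y = k \<odot>\<^bsub>K\<^esub> (X \<otimes>\<^bsub>K\<^esub> Y)" using a b by (simp add: ops P.smult_mult_l)
    show "X \<otimes>\<^bsub>K\<^esub> (k \<odot>\<^bsub>K\<^esub> Y) = k \<odot>\<^bsub>K\<^esub> (X \<otimes>\<^bsub>K\<^esub> Y)" using a b by (simp add: ops P.smult_mult_r)
    show "star K (X \<oplus>\<^bsub>K\<^esub> Y) = star K X \<oplus>\<^bsub>K\<^esub> star K Y" using a b by (simp add: ops P.star_closed P.star_add)
    show "star K (X \<otimes>\<^bsub>K\<^esub> Y) = star K Y \<otimes>\<^bsub>K\<^esub> star K X" using a b by (simp add: ops P.star_closed P.star_mult)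
  qed
  show "star_hom P K q"
    unfolding star_hom_def linear_map_def using cl by (auto intro!: ring_hom_memI simp: ops)
qed

context star_algebra
begin

lemma star_quotient_ops:
  assumes x: "x \<in> carrier A"
  shows "y \<in> carrier A \<Longrightarrow> (kac_ideal A +> x) \<otimes>\<^bsub>star_quotient A (kac_ideal A)\<^esub> (kac_ideal A +> y) =
      kac_ideal A +> (x \<otimes> y)"
    and "y \<in> carrier A \<Longrightarrow> (kac_ideal A +> x) \<oplus>\<^bsub>star_quotient A (kac_ideal A)\<^esub> (kac_ideal A +> y) =
      kac_ideal A +> (x \<oplus> y)"
    and "k \<odot>\<^bsub>star_quotient A (kac_ideal A)\<^esub> (kac_ideal A +> x) = kac_ideal A +> (k \<odot> x)"
    and "star (star_quotient A (kac_ideal A)) (kac_ideal A +> x) = kac_ideal A +> star A x"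
    and "y \<in> carrier A \<Longrightarrow> kac_ideal A +> x = kac_ideal A +> y \<longleftrightarrow> x \<ominus> y \<in> kac_ideal A"
proof -
  interpret I: ideal "kac_ideal A" A by (rule kac_ideal_ideal)
  show "y \<in> carrier A \<Longrightarrow> (kac_ideal A +> x) \<otimes>\<^bsub>star_quotient A (kac_ideal A)\<^esub> (kac_ideal A +> y) =
      kac_ideal A +> (x \<otimes> y)"
    using I.rcoset_mult_add[OF x] by (simp add: star_quotient_def FactRing_def)
  show "y \<in> carrier A \<Longrightarrow> (kac_ideal A +> x) \<oplus>\<^bsub>star_quotient A (kac_ideal A)\<^esub> (kac_ideal A +> y) =
      kac_ideal A +> (x \<oplus> y)"
    using I.a_rcos_sum[OF x] by (simp add: star_quotient_def FactRing_def)
  have eq: "kac_ideal A +> a = kac_ideal A +> b \<longleftrightarrow> a \<ominus> b \<in> kac_ideal A"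
    if "a \<in> carrier A" "b \<in> carrier A" for a b
    using I.a_rcos_module_minus[OF ring_axioms that(2,1)] I.a_rcos_self[OF that(1)]
      I.a_repr_independence'[of a b] that by auto
  then show "y \<in> carrier A \<Longrightarrow> kac_ideal A +> x = kac_ideal A +> y \<longleftrightarrow> x \<ominus> y \<in> kac_ideal A"
    using x by blast
  have mem: "a \<in> carrier A" "a \<ominus> x \<in> kac_ideal A" if "a \<in> kac_ideal A +> x" for a
  proof -
    obtain i where i: "i \<in> kac_ideal A" "a = i \<oplus> x" using \<open>a \<in> _\<close> by (auto simp: a_r_coset_def')
    then have ic: "i \<in> carrier A" using kac_ideal_closed by blast
    then show "a \<in> carrier A" "a \<ominus> x \<in> kac_ideal A"
      using i x by (simp_all add: a_minus_def a_assoc r_neg)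
  qed
  have ne: "kac_ideal A +> x \<noteq> {}" using I.a_rcos_self[OF x] by blast
  have "kac_ideal A +> (k \<odot> a) = kac_ideal A +> (k \<odot> x)" if a: "a \<in> kac_ideal A +> x" for a
  proof -
    have "k \<odot> a \<ominus> k \<odot> x = k \<odot> (a \<ominus> x)"
      using mem[OF a] x by (simp add: a_minus_def minus_eq_scale scale_add_right scale_scale)
    then show ?thesis
      using eq[of "k \<odot> a" "k \<odot> x"] mem[OF a] x kac_ideal_subspace by (simp add: linear_subspace_def)
  qed
  then show "k \<odot>\<^bsub>star_quotient A (kac_ideal A)\<^esub> (kac_ideal A +> x) = kac_ideal A +> (k \<odot> x)"
    unfolding star_quotient_def by (simp add: ne)
  have "kac_ideal A +> star A a = kac_ideal A +> star A x" if a: "a \<in> kac_ideal A +> x" for a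
  proof -
    have "star A a \<ominus> star A x = star A (a \<ominus> x)"
      using mem[OF a] x by (simp add: a_minus_def minus_eq_scale star_add star_smult star_closed)
    then show ?thesis
      using eq[of "star A a" "star A x"] mem[OF a] x kac_ideal_star by (simp add: star_closed)
  qed
  then show "star (star_quotient A (kac_ideal A)) (kac_ideal A +> x) = kac_ideal A +> star A x"
    unfolding star_quotient_def by (simp add: ne)
qed

end

lemma kac_quotient_fields:
  "carrier (kac_quotient P C \<iota>) = kac_proj C \<iota> ` carrier P"
  "mult (kac_quotient P C \<iota>) = mult (star_quotient C (kac_ideal C))"
  "one (kac_quotient P C \<iota>) = one (star_quotient C (kac_ideal C))"
  "zero (kac_quotient P C \<iota>) = zero (star_quotient C (kac_ideal C))"
  "add (kac_quotient P C \<iota>) = add (star_quotient C (kac_ideal C))"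
  "smult (kac_quotient P C \<iota>) = smult (star_quotient C (kac_ideal C))"
  "star (kac_quotient P C \<iota>) = star (star_quotient C (kac_ideal C))"
  by (simp_all add: kac_quotient_def Let_def)

text \<open>
  The algebra C may be the universal completion, or P itself with \<iota> the identity. In the second case
  the elements of the quotient are cosets in P, hence subsets of P.
\<close>

lemma kac_quotient_by_kac_ideal:
  assumes P: "cqg P \<epsilon> S" and C: "star_algebra C" and \<iota>: "star_hom P C \<iota>"
    and kac: "\<And>a. a \<in> carrier P \<Longrightarrow> \<iota> a \<in> kac_ideal C \<longleftrightarrow> a \<in> kac_ideal P"
  shows "quotient_by_kac_ideal P \<epsilon> S (kac_quotient P C \<iota>) (kac_proj C \<iota>)"
proof -
  interpret P: cqg P \<epsilon> S by (rule P)
  interpret C: star_algebra C by (rule C)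
  interpret I: ideal "kac_ideal C" C by (rule C.kac_ideal_ideal)
  let ?K = "kac_quotient P C \<iota>" and ?q = "kac_proj C \<iota>"
  let ?B = "star_quotient C (kac_ideal C)\<lparr>carrier := ?q ` carrier P\<rparr>"
  have hom: "\<iota> \<in> ring_hom P C" and lin: "linear_map P C \<iota>"
    and star: "\<And>a. a \<in> carrier P \<Longrightarrow> \<iota> (star P a) = star C (\<iota> a)"
    using \<iota> by (auto simp: star_hom_def)
  have cl: "\<iota> a \<in> carrier C" if "a \<in> carrier P" for a by (rule ring_hom_closed[OF hom that])
  have z: "\<iota> \<zero>\<^bsub>P\<^esub> = \<zero>\<^bsub>C\<^esub>"
    by (rule linear_map_zero[OF P.complex_space_axioms C.complex_space_axioms lin])
  have K: "star_algebra ?K" "star_hom P ?K ?q"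
  proof (atomize (full), intro conjI)
    have ops: "?q ` carrier P = carrier ?K"
      "\<one>\<^bsub>?K\<^esub> = ?q \<one>\<^bsub>P\<^esub>" "\<zero>\<^bsub>?K\<^esub> = ?q \<zero>\<^bsub>P\<^esub>"
      "\<And>a b. a \<in> carrier P \<Longrightarrow> b \<in> carrier P \<Longrightarrow> ?q a \<oplus>\<^bsub>?K\<^esub> ?q b = ?q (a \<oplus>\<^bsub>P\<^esub> b)"
      "\<And>a b. a \<in> carrier P \<Longrightarrow> b \<in> carrier P \<Longrightarrow> ?q a \<otimes>\<^bsub>?K\<^esub> ?q b = ?q (a \<otimes>\<^bsub>P\<^esub> b)"
      "\<And>k a. a \<in> carrier P \<Longrightarrow> k \<odot>\<^bsub>?K\<^esub> ?q a = ?q (k \<odot>\<^bsub>P\<^esub> a)"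
      "\<And>a. a \<in> carrier P \<Longrightarrow> star ?K (?q a) = ?q (star P a)"
      using lin
      by (simp_all add: kac_quotient_fields kac_proj_def C.star_quotient_ops cl ring_hom_mult[OF hom] star
          linear_map_def ring_hom_one[OF hom] z)
        (simp_all add: star_quotient_def FactRing_def I.a_rcos_const[OF C.kac_ideal_subspace[unfolded linear_subspace_def, THEN conjunct2, THEN conjunct1]])
    show "star_algebra ?K" by (rule star_algebra_image(1)[OF P.star_algebra_axioms ops])
    show "star_hom P ?K ?q" by (rule star_algebra_image(2)[OF P.star_algebra_axioms ops])
  qed
  interpret K: star_algebra ?K by (rule K)
  have qlin: "linear_map P ?K ?q" using K(2) by (simp add: star_hom_def)
  have q_eq: "?q a = ?q b \<longleftrightarrow> a \<ominus>\<^bsub>P\<^esub> b \<in> kac_ideal P" if "a \<in> carrier P" "b \<in> carrier P" for a b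
  proof -
    have "\<iota> (a \<ominus>\<^bsub>P\<^esub> b) = \<iota> a \<ominus>\<^bsub>C\<^esub> \<iota> b"
      using that lin by (simp add: a_minus_def P.minus_eq_scale C.minus_eq_scale cl linear_map_def)
    then show ?thesis
      using C.star_quotient_ops(5)[OF cl[OF that(1)] cl[OF that(2)]] kac[of "a \<ominus>\<^bsub>P\<^esub> b"] that
      by (simp add: kac_proj_def)
  qed
  have q_zero: "?q \<zero>\<^bsub>P\<^esub> = \<zero>\<^bsub>?K\<^esub>"
    by (rule linear_map_zero[OF P.complex_space_axioms K.complex_space_axioms qlin])
  have kernel: "?q a = \<zero>\<^bsub>?K\<^esub> \<longleftrightarrow> a \<in> kac_ideal P" if "a \<in> carrier P" for a
    using q_eq[OF that P.zero_closed] that by (simp add: q_zero a_minus_def)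
  have BK: "bilinear_forms ?B ?B = bilinear_forms ?K ?K"
    by (simp add: bilinear_forms_def linear_functional_def kac_quotient_fields)
  have elem: "elem_tensor ?B ?B = elem_tensor ?K ?K" by (simp add: elem_tensor_def fun_eq_iff BK)
  have tensor: "tensor_algebra ?B ?B = tensor_algebra ?K ?K"
    by (simp add: tensor_algebra_def BK elem_tensor_def kac_quotient_fields)
  have map: "tensor_map P P ?B ?B ?q ?q = tensor_map P P ?K ?K ?q ?q"
    unfolding tensor_map_def elem tensor ..
  have comult: "comult ?K (?q a) = tensor_map P P ?K ?K ?q ?q (comult P a)" if a: "a \<in> carrier P" for a
  proof -
    have "comult ?K (?q a) = (THE T. \<exists>b\<in>carrier P. ?q a = ?q b \<and> T = tensor_map P P ?B ?B ?q ?q (comult P b))"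
      by (simp add: kac_quotient_def Let_def)
    also have "\<dots> = tensor_map P P ?K ?K ?q ?q (comult P a)"
      unfolding map
    proof (rule the_equality)
      fix T assume "\<exists>b\<in>carrier P. ?q a = ?q b \<and> T = tensor_map P P ?K ?K ?q ?q (comult P b)"
      then obtain b where b: "b \<in> carrier P" "?q a = ?q b" "T = tensor_map P P ?K ?K ?q ?q (comult P b)"
        by blast
      note cs = K.complex_space_axioms
      show "T = tensor_map P P ?K ?K ?q ?q (comult P a)"
        unfolding b(3)
      proof (rule tensor_eqI[of _ ?K ?K])
        fix \<beta> assume \<beta>: "\<beta> \<in> bilinear_forms ?K ?K"
        let ?\<gamma> = "\<lambda>x y. \<beta> (?q x) (?q y)"
        have \<gamma>: "?\<gamma> \<in> bilinear_forms P P" by (rule bilinear_forms_comp[OF qlin qlin \<beta>])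
        have z0: "\<beta> \<zero>\<^bsub>?K\<^esub> X = 0" "\<beta> X \<zero>\<^bsub>?K\<^esub> = 0" if "X \<in> carrier ?K" for X
          using bilinear_forms_simps(3)[OF \<beta> K.zero_closed that, of 0]
            bilinear_forms_simps(4)[OF \<beta> that K.zero_closed, of 0] by simp_all
        have qc: "?q x \<in> carrier ?K" if "x \<in> carrier P" for x using qlin that by (auto simp: linear_map_def)
        have "comult P (a \<ominus>\<^bsub>P\<^esub> b) ?\<gamma> = 0"
        proof (rule P.comult_kac_ideal[OF _ \<gamma>])
          show "a \<ominus>\<^bsub>P\<^esub> b \<in> kac_ideal P" using q_eq[OF a b(1)] b(2) by simp
          show "\<beta> (?q x) (?q y) = 0" if "x \<in> kac_ideal P" "y \<in> carrier P" for x y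
            using kernel[of x] that P.kac_ideal_closed[of x] z0(1) qc by simp
          show "\<beta> (?q x) (?q y) = 0" if "x \<in> carrier P" "y \<in> kac_ideal P" for x y
            using kernel[of y] that P.kac_ideal_closed[of y] z0(2) qc by simp
        qed
        then show "tensor_map P P ?K ?K ?q ?q (comult P b) \<beta> = tensor_map P P ?K ?K ?q ?q (comult P a) \<beta>"
          using P.linear_functional_diff[OF P.comult_linear[OF \<gamma>] a b(1)]
          by (simp add: tensor_map_eval[OF cs cs qlin qlin _ \<beta>] a b(1))
      qed (use a b(1) in \<open>auto intro!: tensor_map_closed[OF cs cs qlin qlin]\<close>)
    qed (use a in blast)
    finally show ?thesis .
  qed
  show ?thesis
    by (rule quotient_by_kac_ideal.intro[OF P K(1)], unfold_locales)
       (use K(2) kernel comult in \<open>simp_all add: kac_quotient_fields\<close>)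
qed

lemma factor_through_quotient:
  assumes A: "star_algebra A" and \<pi>: "star_hom A B \<pi>" "star_algebra B"
    and \<rho>: "star_hom A D \<rho>" "\<rho> ` carrier A = carrier D" "star_algebra D"
    and ker: "\<And>a. a \<in> carrier A \<Longrightarrow> \<rho> a = \<zero>\<^bsub>D\<^esub> \<Longrightarrow> \<pi> a = \<zero>\<^bsub>B\<^esub>"
  shows "\<exists>f. star_hom D B f \<and> (\<forall>a\<in>carrier A. \<pi> a = f (\<rho> a))"
proof -
  interpret A: star_algebra A by fact
  interpret B: star_algebra B by fact
  interpret D: star_algebra D by fact
  define f where "f X = \<pi> (SOME a. a \<in> carrier A \<and> \<rho> a = X)" for X
  have homs: "\<pi> \<in> ring_hom A B" "linear_map A B \<pi>" "\<rho> \<in> ring_hom A D" "linear_map A D \<rho>"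
    using \<pi>(1) \<rho>(1) by (simp_all add: star_hom_def)
  have cl: "\<pi> a \<in> carrier B" "\<rho> a \<in> carrier D" if "a \<in> carrier A" for a
    using ring_hom_closed[OF homs(1) that] ring_hom_closed[OF homs(3) that] by auto
  have eq: "\<pi> a = \<pi> b" if "a \<in> carrier A" "b \<in> carrier A" "\<rho> a = \<rho> b" for a b
  proof -
    have "\<rho> (a \<oplus>\<^bsub>A\<^esub> (-1) \<odot>\<^bsub>A\<^esub> b) = \<rho> a \<ominus>\<^bsub>D\<^esub> \<rho> b" "\<pi> (a \<oplus>\<^bsub>A\<^esub> (-1) \<odot>\<^bsub>A\<^esub> b) = \<pi> a \<ominus>\<^bsub>B\<^esub> \<pi> b"
      using that homs(2,4) by (simp_all add: a_minus_def D.minus_eq_scale B.minus_eq_scale cl linear_map_def)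
    then show ?thesis
      using ker[of "a \<oplus>\<^bsub>A\<^esub> (-1) \<odot>\<^bsub>A\<^esub> b"] that D.diff_eq_zero_iff[of "\<rho> a" "\<rho> b"]
        B.diff_eq_zero_iff[of "\<pi> a" "\<pi> b"] cl by simp
  qed
  have f: "f (\<rho> a) = \<pi> a" if a: "a \<in> carrier A" for a
  proof -
    have "(SOME b. b \<in> carrier A \<and> \<rho> b = \<rho> a) \<in> carrier A \<and> \<rho> (SOME b. b \<in> carrier A \<and> \<rho> b = \<rho> a) = \<rho> a"
      by (rule someI[of _ a]) (use a in simp)
    then show ?thesis unfolding f_def using eq a by blast
  qed
  have ex: "\<exists>a\<in>carrier A. X = \<rho> a" if "X \<in> carrier D" for X using \<rho>(2) that by blast
  have "star_hom D B f"
    unfolding star_hom_def linear_map_def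
  proof (intro conjI ballI allI funcsetI ring_hom_memI)
    fix X assume "X \<in> carrier D"
    then obtain a where a: "a \<in> carrier A" "X = \<rho> a" using ex by blast
    show "f X \<in> carrier B" "f X \<in> carrier B" using a f cl by simp_all
    have "star D X = \<rho> (star A a)" using a \<rho>(1) by (simp add: star_hom_def)
    then show "f (star D X) = star B (f X)" using a \<pi>(1) by (simp add: f A.star_closed star_hom_def)
    fix k
    have "k \<odot>\<^bsub>D\<^esub> X = \<rho> (k \<odot>\<^bsub>A\<^esub> a)" using a homs(4) by (simp add: linear_map_def)
    then show "f (k \<odot>\<^bsub>D\<^esub> X) = k \<odot>\<^bsub>B\<^esub> f X" using a homs(2) by (simp add: f linear_map_def)
  next
    fix X Y assume "X \<in> carrier D" "Y \<in> carrier D"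
    then obtain a b where ab: "a \<in> carrier A" "X = \<rho> a" "b \<in> carrier A" "Y = \<rho> b" using ex by meson
    have "X \<otimes>\<^bsub>D\<^esub> Y = \<rho> (a \<otimes>\<^bsub>A\<^esub> b)" "X \<oplus>\<^bsub>D\<^esub> Y = \<rho> (a \<oplus>\<^bsub>A\<^esub> b)"
      using ab ring_hom_mult[OF homs(3)] ring_hom_add[OF homs(3)] by simp_all
    then show "f (X \<otimes>\<^bsub>D\<^esub> Y) = f X \<otimes>\<^bsub>B\<^esub> f Y" "f (X \<oplus>\<^bsub>D\<^esub> Y) = f X \<oplus>\<^bsub>B\<^esub> f Y" "f (X \<oplus>\<^bsub>D\<^esub> Y) = f X \<oplus>\<^bsub>B\<^esub> f Y"
      using ab ring_hom_mult[OF homs(1)] ring_hom_add[OF homs(1)] f by simp_all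
  next
    have "\<one>\<^bsub>D\<^esub> = \<rho> \<one>\<^bsub>A\<^esub>" using ring_hom_one[OF homs(3)] by simp
    then show "f \<one>\<^bsub>D\<^esub> = \<one>\<^bsub>B\<^esub>" using f[OF A.one_closed] ring_hom_one[OF homs(1)] by simp
  qed
  then show ?thesis using f by auto
qed

lemma qsubgroup_leI:
  assumes "closed_qsubgroup G H \<pi>" "closed_qsubgroup G K \<rho>"
    and ker: "\<And>a. a \<in> carrier G \<Longrightarrow> \<rho> a = \<zero>\<^bsub>K\<^esub> \<Longrightarrow> \<pi> a = \<zero>\<^bsub>H\<^esub>"
  shows "qsubgroup_le G H \<pi> K \<rho>"
proof -
  have "star_algebra G" "star_algebra H" "star_algebra K" "star_hom G H \<pi>" "star_hom G K \<rho>"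
    "\<rho> ` carrier G = carrier K"
    using assms(1,2) by (auto simp: closed_qsubgroup_def cqg_algebra_def hopf_star_algebra_def)
  from factor_through_quotient[OF this(1,4,2,5,6,3) ker] show ?thesis
    using assms(1,2) by (simp add: qsubgroup_le_def)
qed

theorem proposition3p4:
  fixes G :: "'a quantum_group" and C :: "'c cstar_algebra" and \<iota> :: "'a \<Rightarrow> 'c"
    and M :: "'m quantum_group" and \<pi>\<^sub>M :: "'a \<Rightarrow> 'm"
  assumes "cqg_algebra G"
    and "universal_completion G C \<iota>"
    and "max_kac G M \<pi>\<^sub>M"
  shows "qsubgroup_eq G M \<pi>\<^sub>M (kac_quotient G C \<iota>) (kac_proj C \<iota>)"
proof -
  obtain \<epsilon> S where "cqg G \<epsilon> S" using assms(1) by (auto simp: cqg_algebra_iff)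
  then interpret G: cqg G \<epsilon> S .
  have M: "closed_qsubgroup G M \<pi>\<^sub>M" "kac_type M" using assms(3) by (auto simp: max_kac_def)
  interpret K: quotient_by_kac_ideal G \<epsilon> S "kac_quotient G C \<iota>" "kac_proj C \<iota>"
    using assms(2) kac_ideal_universal_completion[OF assms(1,2)]
    by (intro kac_quotient_by_kac_ideal G.cqg_axioms) (auto simp: universal_completion_def cstar_algebra_def)
  \<comment> \<open>Maximality of M is applied to this realization, whose elements are subsets of G.\<close>
  interpret K': quotient_by_kac_ideal G \<epsilon> S "kac_quotient G G id" "kac_proj G id"
    by (intro kac_quotient_by_kac_ideal G.cqg_axioms G.star_algebra_axioms)
       (auto simp: star_hom_def linear_map_def intro!: ring_hom_memI)
  have kernel: "\<pi>\<^sub>M a = \<zero>\<^bsub>M\<^esub> \<longleftrightarrow> a \<in> kac_ideal G" if a: "a \<in> carrier G" for a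
  proof
    assume zero: "\<pi>\<^sub>M a = \<zero>\<^bsub>M\<^esub>"
    have "qsubgroup_le G (kac_quotient G G id) (kac_proj G id) M \<pi>\<^sub>M"
      using assms(3) K'.quotient_closed_qsubgroup K'.quotient_kac_type by (simp add: max_kac_def)
    then obtain \<rho> where \<rho>: "\<And>b. b \<in> carrier G \<Longrightarrow> kac_proj G id b = \<rho> (\<pi>\<^sub>M b)"
      by (auto simp: qsubgroup_le_def)
    have "complex_space M" "linear_map G M \<pi>\<^sub>M"
      using M(1) star_algebra.axioms(2)[of M]
      by (auto simp: closed_qsubgroup_def cqg_algebra_def hopf_star_algebra_def star_hom_def complex_space_def)
    then have "\<pi>\<^sub>M \<zero>\<^bsub>G\<^esub> = \<zero>\<^bsub>M\<^esub>" by (rule linear_map_zero[OF G.complex_space_axioms])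
    then have "kac_proj G id a = \<zero>\<^bsub>kac_quotient G G id\<^esub>"
      using \<rho>[OF a] \<rho>[OF G.zero_closed] zero K'.q_zero by simp
    then show "a \<in> kac_ideal G" using K'.q_kernel[OF a] by simp
  next
    show "\<pi>\<^sub>M a = \<zero>\<^bsub>M\<^esub>" if "a \<in> kac_ideal G" by (rule kac_ideal_kac_type_quotient[OF M that])
  qed
  show ?thesis
    unfolding qsubgroup_eq_def
    using kernel K.q_kernel by (auto intro!: qsubgroup_leI M(1) K.quotient_closed_qsubgroup)
qed

end
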